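(* (1) The boundary $\partial\mathcal Z$ of the graph of zigzag diagrams is homeomorphic to the space $\mathcal U^{(2)}$. (2) Let $\Pi=(\Pi_n)_{n\ge 1}$ be a coherent sequence of random permutations with descent set as a sufficient statistic, i.e. such that for every $n$ the probability $\mathbb P(\Pi_n=\pi_n)$ depends on the permutation $\pi_n$ of $[n]$ only through $\mathrm{zs}(\pi_n)$. Then $\Pi$ has the same distribution as the random arrangement obtained by the oriented paintbox construction with some random $(U_\uparrow,U_\downarrow)\in\mathcal U^{(2)}$ (chosen from some probability distribution on $\mathcal U^{(2)}$, independently of the uniform sample used in the construction). (3) The distribution on $\mathcal U^{(2)}$ of the paintbox $(U_\uparrow,U_\downarrow)$ representing a given $\Pi$ is unique.
   Context: Notation: $[n]=\{1,\dots,n\}$, $\mathbb N=\{1,2,\dots\}$. Zigzags. A zigzag diagram with $n$ boxes is identified with a composition $\lambda=(\lambda_1,\dots,\lambda_\ell)$ of $n$ (a finite sequence of positive integers with sum $n$); $\mathcal Z_n$ is the set of compositions of $n$, $\mathcal Z_0=\{\varnothing\}$, $\mathcal Z=\bigcup_{n\ge0}\mathcal Z_n$. For a permutation $\pi_n$ of $[n]$, written as a word $\pi_n(1)\dots\pi_n(n)$, its zigzag shape $\mathrm{zs}(\pi_n)\in\mathcal Z_n$ is the composition formed by the lengths of the successive maximal increasing runs of the word (it encodes the descent set of $\pi_n$). Permutations $\pi_m$ of $[m]$ and $\pi_n$ of $[n]$, $m<n$, are coherent if the integers $1,\dots,m$ appear in the word $\pi_n$ in the same relative order as in $\pi_m$.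 Graph. $\mathcal Z$ is a graded graph with edges: $\varnothing\nearrow(1)$, and for $n\ge2$, $\mu\in\mathcal Z_{n-1}$, $\lambda\in\mathcal Z_n$: $\mu\nearrow\lambda$ iff $\mu=\mathrm{zs}(\pi_{n-1})$, $\lambda=\mathrm{zs}(\pi_n)$ for some coherent permutations $\pi_{n-1},\pi_n$. Boundary. $\mathcal V$ is the convex set of functions $p:\mathcal Z\to[0,\infty)$ with $p(\varnothing)=1$ and $p(\mu)=\sum_{\lambda:\mu\nearrow\lambda}p(\lambda)$ for all $\mu\in\mathcal Z$, with the topology of pointwise convergence. The boundary $\partial\mathcal Z$ is the set of extreme points of $\mathcal V$, with the subspace topology. Arrangements. An arrangement is a sequence $\pi=(\pi_n)_{n\ge1}$ of pairwise coherent permutations $\pi_n$ of $[n]$ (equivalently a total order on $\mathbb N$). A random arrangement (coherent sequence of random permutations) is a random element $\Pi=(\Pi_n)$ of the set of arrangements. Paintboxes. $\mathcal U^{(2)}$ is the set of pairs $(U_\uparrow,U_\downarrow)$ of disjoint open subsets of the open interval $]0,1[$. For $U\subset\,]0,1[$ put $U^{\rm compl}=[0,1]\setminus U$. The distance between $(U_\uparrow,U_\downarrow)$ and $(V_\uparrow,V_\downarrow)$ is the infimum of $\theta$ such that the $\theta$-neighbourhood of $U_\uparrow^{\rm compl}$ covers $V_\uparrow^{\rm compl}$ and vice versa, and the $\theta$-neighbourhood of $U_\downarrow^{\rm compl}$ covers $V_\downarrow^{\rm compl}$ and vice versa. $\mathcal U^{(2)}$ carries the topology (and Borel structure) of this metric.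 Oriented paintbox construction. Given $(U_\uparrow,U_\downarrow)\in\mathcal U^{(2)}$, let $\xi_1,\xi_2,\dots$ be i.i.d. uniform on $[0,1]$. Define a random arrangement $\Pi=(\Pi_n)$ by placing $i$ to the left of $j$ ($i\neq j$) in $\Pi_n$, $n\ge\max(i,j)$, iff one of the following holds: $\xi_i,\xi_j$ do not lie in the same interval component (connected component) of $U_\uparrow\cup U_\downarrow$ and $\xi_i<\xi_j$; or $\xi_i,\xi_j$ lie in the same interval component of $U_\uparrow$ and $i<j$; or $\xi_i,\xi_j$ lie in the same interval component of $U_\downarrow$ and $i>j$. (The $\xi_i$ are almost surely distinct.) *)

theory Defs
  imports "HOL-Probability.Probability" "HOL-Combinatorics.Multiset_Permutations"
begin

typedef zigzag = "{c :: nat list. \<forall>k\<in>set c. 0 < k}"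
  by (rule exI[of _ "[]"]) simp

setup_lifting type_definition_zigzag

lift_definition empty_zigzag :: zigzag is "[]" by simp

lift_definition box_zigzag :: zigzag is "[1]" by simp

lift_definition zigzag_size :: "zigzag \<Rightarrow> nat" is sum_list .

text \<open>A permutation \<open>\<pi>\<close> of \<open>{1..n}\<close> is represented by its word \<open>\<pi>(1) \<dots> \<pi>(n)\<close>.\<close>

abbreviation perms :: "nat \<Rightarrow> nat list set" where
  "perms n \<equiv> permutations_of_set {1..n}"

fun increasing_runs :: "nat list \<Rightarrow> nat list list" where
  "increasing_runs [] = []"
| "increasing_runs [x] = [[x]]"
| "increasing_runs (x # y # ys) =
     (if x < y
      then (x # hd (increasing_runs (y # ys))) # tl (increasing_runs (y # ys))
      else [x] # increasing_runs (y # ys))"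

lemma increasing_runs_nonempty: "r \<in> set (increasing_runs w) \<Longrightarrow> r \<noteq> []"
proof (induction w arbitrary: r rule: increasing_runs.induct)
  case (3 x y ys)
  then show ?case
    by (cases "increasing_runs (y # ys)") (auto split: if_splits)
qed auto

lemma increasing_runs_eq_Nil [simp]: "increasing_runs w = [] \<longleftrightarrow> w = []"
  by (cases w rule: increasing_runs.cases) auto

lemma concat_increasing_runs: "concat (increasing_runs w) = w"
proof (induction w rule: increasing_runs.induct)
  case (3 x y ys)
  then show ?case
    by (cases "increasing_runs (y # ys)") auto
qed auto

lift_definition zs :: "nat list \<Rightarrow> zigzag" is "\<lambda>w. map length (increasing_runs w)"
  using increasing_runs_nonempty by auto

lemma zigzag_size_zs: "zigzag_size (zs w) = length w"
  by transfer (metis concat_increasing_runs length_concat)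

definition left_of :: "nat list \<Rightarrow> nat \<Rightarrow> nat \<Rightarrow> bool" where
  "left_of w i j \<longleftrightarrow> (\<exists>a b. a < b \<and> b < length w \<and> w ! a = i \<and> w ! b = j)"

definition coherent :: "nat list \<Rightarrow> nat list \<Rightarrow> bool" where
  "coherent u w \<longleftrightarrow> (\<forall>i\<in>set u. \<forall>j\<in>set u. left_of u i j \<longleftrightarrow> left_of w i j)"

definition zigzag_edge :: "zigzag \<Rightarrow> zigzag \<Rightarrow> bool" where
  "zigzag_edge \<mu> \<nu> \<longleftrightarrow>
     \<mu> = empty_zigzag \<and> \<nu> = box_zigzag \<or>
     (\<exists>n\<ge>2. \<exists>u\<in>perms (n - 1). \<exists>w\<in>perms n. coherent u w \<and> \<mu> = zs u \<and> \<nu> = zs w)"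

text \<open>Finite branching, so that the sum over \<open>{\<nu>. zigzag_edge \<mu> \<nu>}\<close> below is a genuine finite sum.\<close>

lemma finite_zigzag_edge: "finite {\<nu>. zigzag_edge \<mu> \<nu>}"
proof (rule finite_subset)
  show "{\<nu>. zigzag_edge \<mu> \<nu>} \<subseteq> insert box_zigzag (zs ` perms (zigzag_size \<mu> + 1))"
    unfolding zigzag_edge_def
    by (auto simp: zigzag_size_zs length_finite_permutations_of_set)
  show "finite (insert box_zigzag (zs ` perms (zigzag_size \<mu> + 1)))"
    by simp
qed

definition harmonic_functions :: "(zigzag \<Rightarrow> real) set" where
  "harmonic_functions =
     {p. (\<forall>\<mu>. 0 \<le> p \<mu>) \<and> p empty_zigzag = 1 \<and>
         (\<forall>\<mu>. p \<mu> = (\<Sum>\<nu> | zigzag_edge \<mu> \<nu>. p \<nu>))}"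

text \<open>Extreme points are spelled out because \<^const>\<open>extreme_point_of\<close> requires a
  \<^class>\<open>real_vector\<close> type, which the function type is not. The topology on
  \<^typ>\<open>zigzag \<Rightarrow> real\<close> is the product topology, i.e. that of pointwise convergence.\<close>

definition zigzag_boundary :: "(zigzag \<Rightarrow> real) set" where
  "zigzag_boundary =
     {p \<in> harmonic_functions.
        \<forall>q\<in>harmonic_functions. \<forall>r\<in>harmonic_functions. \<forall>t. 0 < t \<and> t < 1 \<and>
          p = (\<lambda>\<mu>. (1 - t) * q \<mu> + t * r \<mu>) \<longrightarrow> q = r}"

definition arrangements :: "(nat \<Rightarrow> nat list) set" where
  "arrangements =
     {\<pi> \<in> \<Pi>\<^sub>E n\<in>{1..}. perms n. \<forall>m n. 1 \<le> m \<and> m < n \<longrightarrow> coherent (\<pi> m) (\<pi> n)}"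

definition arrangement_space :: "(nat \<Rightarrow> nat list) measure" where
  "arrangement_space =
     restrict_space (\<Pi>\<^sub>M n\<in>{1..}. count_space (perms n)) arrangements"

definition descent_sufficient :: "'a measure \<Rightarrow> ('a \<Rightarrow> nat \<Rightarrow> nat list) \<Rightarrow> bool" where
  "descent_sufficient M X \<longleftrightarrow>
     (\<forall>n\<ge>1. \<forall>u\<in>perms n. \<forall>w\<in>perms n. zs u = zs w \<longrightarrow>
        measure M {\<omega> \<in> space M. X \<omega> n = u} = measure M {\<omega> \<in> space M. X \<omega> n = w})"

typedef paintbox =
  "{(U :: real set, D :: real set).
      open U \<and> open D \<and> U \<subseteq> {0<..<1} \<and> D \<subseteq> {0<..<1} \<and> U \<inter> D = {}}"
  by (rule exI[of _ "({}, {})"]) simp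

definition up_set :: "paintbox \<Rightarrow> real set" where
  "up_set P = fst (Rep_paintbox P)"

definition down_set :: "paintbox \<Rightarrow> real set" where
  "down_set P = snd (Rep_paintbox P)"

lemma paintbox_props:
  "open (up_set P)" "open (down_set P)" "up_set P \<subseteq> {0<..<1}" "down_set P \<subseteq> {0<..<1}"
  "up_set P \<inter> down_set P = {}"
  using Rep_paintbox[of P] by (auto simp: up_set_def down_set_def)

lemma paintbox_eqI: "up_set P = up_set Q \<Longrightarrow> down_set P = down_set Q \<Longrightarrow> P = Q"
  by (metis Rep_paintbox_inject down_set_def prod.expand up_set_def)

definition unit_compl :: "real set \<Rightarrow> real set" where
  "unit_compl U = {0..1} - U"

definition neighbourhood :: "real \<Rightarrow> real set \<Rightarrow> real set" where
  "neighbourhood \<theta> A = (\<Union>a\<in>A. ball a \<theta>)"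

definition mutually_close :: "real \<Rightarrow> real set \<Rightarrow> real set \<Rightarrow> bool" where
  "mutually_close \<theta> A B \<longleftrightarrow> B \<subseteq> neighbourhood \<theta> A \<and> A \<subseteq> neighbourhood \<theta> B"

lemma mutually_close_triangle:
  assumes "mutually_close s A B" "mutually_close t B C"
  shows "mutually_close (s + t) A C"
proof -
  have *: "Z \<subseteq> neighbourhood (a + b) X"
    if sub: "Y \<subseteq> neighbourhood a X" "Z \<subseteq> neighbourhood b Y" for a b X Y Z
  proof
    fix z assume "z \<in> Z"
    then obtain y where y: "y \<in> Y" "dist y z < b"
      using sub(2) by (auto simp: neighbourhood_def)
    then obtain x where x: "x \<in> X" "dist x y < a"
      using sub(1) by (auto simp: neighbourhood_def)
    have "dist x z < a + b"
      using dist_triangle[of x z y] x y by simp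
    then show "z \<in> neighbourhood (a + b) X"
      using x by (auto simp: neighbourhood_def)
  qed
  show ?thesis
    using *[of B s A C t] *[of B t C A s] assms
    by (simp add: mutually_close_def add.commute)
qed

lemma mutually_close_sym: "mutually_close \<theta> A B \<longleftrightarrow> mutually_close \<theta> B A"
  by (auto simp: mutually_close_def)

lemma mutually_close_2:
  assumes "U \<subseteq> {0<..<1}" "V \<subseteq> {0<..<1}"
  shows "mutually_close 2 (unit_compl U) (unit_compl V)"
proof -
  have "unit_compl Y \<subseteq> neighbourhood 2 (unit_compl X)" if "X \<subseteq> {0<..<1}" for X Y
  proof -
    have "0 \<in> unit_compl X"
      using that by (auto simp: unit_compl_def)
    moreover have "z \<in> ball 0 2" if "z \<in> unit_compl Y" for z
      using that by (auto simp: unit_compl_def)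
    ultimately show ?thesis
      by (auto simp: neighbourhood_def)
  qed
  then show ?thesis
    using assms by (simp add: mutually_close_def)
qed

lemma mutually_close_subset:
  assumes "open U" "\<And>e. 0 < e \<Longrightarrow> \<exists>\<theta><e. mutually_close \<theta> (unit_compl U) (unit_compl V)"
  shows "unit_compl V \<subseteq> unit_compl U"
proof
  fix v assume v: "v \<in> unit_compl V"
  have "closed (unit_compl U)"
    using assms(1) by (simp add: unit_compl_def closed_Diff)
  moreover have "v \<in> closure (unit_compl U)"
    unfolding closure_approachable
  proof (intro allI impI)
    fix e :: real assume "0 < e"
    then obtain \<theta> where "\<theta> < e" "mutually_close \<theta> (unit_compl U) (unit_compl V)"
      using assms(2) by blast
    with v obtain a where "a \<in> unit_compl U" "dist a v < \<theta>"
      by (auto simp: mutually_close_def neighbourhood_def)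
    with \<open>\<theta> < e\<close> show "\<exists>y\<in>unit_compl U. dist y v < e"
      by force
  qed
  ultimately show "v \<in> unit_compl U"
    by simp
qed

definition close_paintboxes :: "paintbox \<Rightarrow> paintbox \<Rightarrow> real set" where
  "close_paintboxes P Q =
     {\<theta>. 0 < \<theta> \<and> mutually_close \<theta> (unit_compl (up_set P)) (unit_compl (up_set Q)) \<and>
         mutually_close \<theta> (unit_compl (down_set P)) (unit_compl (down_set Q))}"

instantiation paintbox :: metric_space
begin

definition dist_paintbox :: "paintbox \<Rightarrow> paintbox \<Rightarrow> real" where
  "dist_paintbox P Q = Inf (close_paintboxes P Q)"

definition uniformity_paintbox :: "(paintbox \<times> paintbox) filter" where
  "uniformity_paintbox = (INF e\<in>{0<..}. principal {(P, Q). dist P Q < e})"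

definition open_paintbox :: "paintbox set \<Rightarrow> bool" where
  "open_paintbox S = (\<forall>P\<in>S. \<forall>\<^sub>F (P', Q) in uniformity. P' = P \<longrightarrow> Q \<in> S)"

instance
proof
  have bdd: "bdd_below (close_paintboxes P Q)" for P Q
    by (rule bdd_belowI[of _ 0]) (simp add: close_paintboxes_def)
  have ne: "close_paintboxes P Q \<noteq> {}" for P Q
  proof -
    have "2 \<in> close_paintboxes P Q"
      by (simp add: close_paintboxes_def mutually_close_2 paintbox_props)
    then show ?thesis
      by blast
  qed
  have dist_le: "dist P Q \<le> \<theta>" if "\<theta> \<in> close_paintboxes P Q" for P Q \<theta>
    unfolding dist_paintbox_def using that bdd by (rule cInf_lower)
  have dist_less: "\<exists>\<theta>\<in>close_paintboxes P Q. \<theta> < e" if "dist P Q < e" for P Q e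
    using cInf_lessD[OF ne] that unfolding dist_paintbox_def by blast
  have sym: "close_paintboxes P Q = close_paintboxes Q P" for P Q
    unfolding close_paintboxes_def by (metis mutually_close_sym)
  have dist_sym: "dist P Q = dist Q P" for P Q :: paintbox
    by (simp add: dist_paintbox_def sym)
  have dist_nonneg: "0 \<le> dist P Q" for P Q :: paintbox
    unfolding dist_paintbox_def using ne
    by (rule cInf_greatest) (simp add: close_paintboxes_def)
  have triangle: "dist P R \<le> dist P Q + dist Q R" for P Q R :: paintbox
  proof (rule field_le_epsilon)
    fix e :: real assume "0 < e"
    then obtain s t where s: "s \<in> close_paintboxes P Q" "s < dist P Q + e / 2"
      and t: "t \<in> close_paintboxes Q R" "t < dist Q R + e / 2"
      using dist_less[of P Q "dist P Q + e / 2"] dist_less[of Q R "dist Q R + e / 2"] by auto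
    have "s + t \<in> close_paintboxes P R"
      using s(1) t(1) by (auto simp: close_paintboxes_def intro: mutually_close_triangle)
    from dist_le[OF this] s(2) t(2) show "dist P R \<le> dist P Q + dist Q R + e"
      by simp
  qed
  fix P Q R :: paintbox
  show "dist P Q = 0 \<longleftrightarrow> P = Q"
  proof
    assume "P = Q"
    have "dist P Q \<le> 0 + e" if "0 < e" for e :: real
    proof -
      have "A \<subseteq> neighbourhood e A" for A
        using that by (auto simp: neighbourhood_def)
      then have "e \<in> close_paintboxes P Q"
        using that \<open>P = Q\<close> by (simp add: close_paintboxes_def mutually_close_def)
      then show ?thesis
        using dist_le by simp
    qed
    then have "dist P Q \<le> 0"
      by (rule field_le_epsilon)
    with dist_nonneg[of P Q] show "dist P Q = 0"
      by simp
  next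
    assume 0: "dist P Q = 0"
    have "\<exists>\<theta><e. mutually_close \<theta> (unit_compl (up_set P)) (unit_compl (up_set Q)) \<and>
        mutually_close \<theta> (unit_compl (down_set P)) (unit_compl (down_set Q))"
      if "0 < e" for e :: real
      using dist_less[of P Q e] 0 that by (auto simp: close_paintboxes_def)
    then have "unit_compl (up_set P) = unit_compl (up_set Q)"
      "unit_compl (down_set P) = unit_compl (down_set Q)"
      by (intro subset_antisym mutually_close_subset paintbox_props; metis mutually_close_sym)+
    moreover have "up_set X = {0..1} - unit_compl (up_set X)"
      "down_set X = {0..1} - unit_compl (down_set X)" for X
      unfolding unit_compl_def using paintbox_props(3,4)[of X]
      by (auto simp: subset_iff less_imp_le)
    ultimately show "P = Q"
      by (metis paintbox_eqI)
  qed
  show "dist P Q \<le> dist P R + dist Q R"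
    using triangle[of P Q R] dist_sym[of Q R] by simp
  show "(uniformity :: (paintbox \<times> paintbox) filter) =
      (INF e\<in>{0<..}. principal {(P, Q). dist P Q < e})"
    by (rule uniformity_paintbox_def)
  show "open S \<longleftrightarrow> (\<forall>P\<in>S. \<forall>\<^sub>F (P', Q) in uniformity. P' = P \<longrightarrow> Q \<in> S)"
    for S :: "paintbox set"
    by (rule open_paintbox_def)
qed

end

definition placed_left :: "paintbox \<Rightarrow> (nat \<Rightarrow> real) \<Rightarrow> nat \<Rightarrow> nat \<Rightarrow> bool" where
  "placed_left P \<xi> i j \<longleftrightarrow>
     (\<not> connected_component (up_set P \<union> down_set P) (\<xi> i) (\<xi> j) \<and> \<xi> i < \<xi> j) \<or>
     (connected_component (up_set P) (\<xi> i) (\<xi> j) \<and> i < j) \<or>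
     (connected_component (down_set P) (\<xi> i) (\<xi> j) \<and> j < i)"

text \<open>For distinct sample points the description picks out exactly one word (lemma \<open>ex1_paintbox_word\<close> below); on the
  null event that two sample points coincide, where the rule need not define an order, the
  arrangement is set to the natural order.\<close>

definition paintbox_arrangement :: "paintbox \<Rightarrow> (nat \<Rightarrow> real) \<Rightarrow> nat \<Rightarrow> nat list" where
  "paintbox_arrangement P \<xi> =
     (\<lambda>n\<in>{1..}.
        if inj_on \<xi> {1..}
        then THE w. w \<in> perms n \<and>
          (\<forall>i\<in>{1..n}. \<forall>j\<in>{1..n}. i \<noteq> j \<longrightarrow> (left_of w i j \<longleftrightarrow> placed_left P \<xi> i j))
        else [1..<Suc n])"

lemma left_of_iff_sorted_wrt:
  assumes "distinct w" "set w = A"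
    and asym: "\<And>i j. i \<in> A \<Longrightarrow> j \<in> A \<Longrightarrow> R i j \<Longrightarrow> \<not> R j i"
    and total: "\<And>i j. i \<in> A \<Longrightarrow> j \<in> A \<Longrightarrow> i \<noteq> j \<Longrightarrow> R i j \<or> R j i"
  shows "(\<forall>i\<in>A. \<forall>j\<in>A. i \<noteq> j \<longrightarrow> (left_of w i j \<longleftrightarrow> R i j)) \<longleftrightarrow> sorted_wrt R w"
proof
  assume L: "\<forall>i\<in>A. \<forall>j\<in>A. i \<noteq> j \<longrightarrow> (left_of w i j \<longleftrightarrow> R i j)"
  show "sorted_wrt R w"
    unfolding sorted_wrt_iff_nth_less
  proof (intro allI impI)
    fix a b assume ab: "a < b" "b < length w"
    then have "left_of w (w ! a) (w ! b)" "w ! a \<noteq> w ! b" "w ! a \<in> A" "w ! b \<in> A"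
      using assms(1,2) by (auto simp: left_of_def nth_eq_iff_index_eq)
    then show "R (w ! a) (w ! b)"
      using L by blast
  qed
next
  assume S: "sorted_wrt R w"
  show "\<forall>i\<in>A. \<forall>j\<in>A. i \<noteq> j \<longrightarrow> (left_of w i j \<longleftrightarrow> R i j)"
  proof (intro ballI impI)
    fix i j assume ij: "i \<in> A" "j \<in> A" "i \<noteq> j"
    then obtain a b where "a < length w" "b < length w" "w ! a = i" "w ! b = j"
      using assms(2) by (metis in_set_conv_nth)
    moreover have "left_of w x y \<Longrightarrow> R x y" for x y
      using S by (auto simp: left_of_def sorted_wrt_iff_nth_less)
    ultimately show "left_of w i j \<longleftrightarrow> R i j"
      using ij asym left_of_def by (metis linorder_neqE_nat)
  qed
qed

lemma ex1_sorted_wrt: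
  fixes A :: "nat set"
  assumes "finite A"
    and asym: "\<And>i j. i \<in> A \<Longrightarrow> j \<in> A \<Longrightarrow> R i j \<Longrightarrow> \<not> R j i"
    and total: "\<And>i j. i \<in> A \<Longrightarrow> j \<in> A \<Longrightarrow> i \<noteq> j \<Longrightarrow> R i j \<or> R j i"
    and trans: "\<And>i j k. i \<in> A \<Longrightarrow> j \<in> A \<Longrightarrow> k \<in> A \<Longrightarrow> R i j \<Longrightarrow> R j k \<Longrightarrow> R i k"
  shows "\<exists>!w. set w = A \<and> distinct w \<and> sorted_wrt R w"
proof (rule ex_ex1I)
  have "\<exists>w. set w = B \<and> distinct w \<and> sorted_wrt R w" if "B \<subseteq> A" for B
    using finite_subset[OF that assms(1)] that
  proof (induction B rule: finite_induct)
    case empty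
    then show ?case by simp
  next
    case (insert x B)
    then obtain w where w: "set w = B" "distinct w" "sorted_wrt R w"
      by auto
    let ?w = "filter (\<lambda>y. R y x) w @ x # filter (\<lambda>y. R x y) w"
    have x: "x \<in> A" "\<And>y. y \<in> B \<Longrightarrow> y \<in> A" "x \<notin> B"
      using insert by auto
    have "set ?w = insert x B"
      using w x total by auto
    moreover have "distinct ?w"
      using w x asym by auto
    moreover have "sorted_wrt R ?w"
      using w x trans by (auto simp: sorted_wrt_append sorted_wrt_filter)
    ultimately show ?case by blast
  qed
  then show "\<exists>w. set w = A \<and> distinct w \<and> sorted_wrt R w"
    by blast
next
  have "v = w" if "set v \<subseteq> A" "set v = set w" "distinct v" "distinct w" "sorted_wrt R v" "sorted_wrt R w"
    for v w
    using that
  proof (induction v arbitrary: w)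
    case Nil
    then show ?case by simp
  next
    case (Cons a v)
    then obtain b w' where w: "w = b # w'"
      by (cases w) auto
    have "a = b"
    proof (rule ccontr)
      assume "a \<noteq> b"
      then have "a \<in> set w'" "b \<in> set v"
        using Cons.prems(2) w by auto
      then have "R b a" "R a b" "a \<in> A" "b \<in> A"
        using Cons.prems w by auto
      then show False
        using asym by blast
    qed
    moreover have "set v = set w'"
      using Cons.prems w \<open>a = b\<close> by auto
    ultimately show ?case
      using Cons w by auto
  qed
  then show "v = w"
    if "set v = A \<and> distinct v \<and> sorted_wrt R v"
      and "set w = A \<and> distinct w \<and> sorted_wrt R w" for v w
    using that by (metis order_refl)
qed

lemma connected_component_between:
  fixes x y z :: real
  assumes "connected_component S x z" "x \<le> y" "y \<le> z"
  shows "connected_component S x y" "connected_component S y z"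
proof -
  obtain T where T: "connected T" "T \<subseteq> S" "x \<in> T" "z \<in> T"
    using assms(1) by (auto simp: connected_component_def)
  then have "y \<in> T"
    using assms(2,3) by (meson connected_contains_Icc atLeastAtMost_iff subsetD)
  then show "connected_component S x y" "connected_component S y z"
    using T by (auto simp: connected_component_def)
qed

lemma connected_component_up_down:
  "connected_component (up_set P \<union> down_set P) x y \<longleftrightarrow>
     connected_component (up_set P) x y \<or> connected_component (down_set P) x y"
proof
  assume "connected_component (up_set P \<union> down_set P) x y"
  then obtain T where T: "connected T" "T \<subseteq> up_set P \<union> down_set P" "x \<in> T" "y \<in> T"
    by (auto simp: connected_component_def)
  then have "up_set P \<inter> T = {} \<or> down_set P \<inter> T = {}"
    using connectedD[OF T(1) paintbox_props(1,2)[of P]] paintbox_props(5)[of P] by blast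
  then show "connected_component (up_set P) x y \<or> connected_component (down_set P) x y"
    using T unfolding connected_component_def by blast
qed (auto intro: connected_component_of_subset)

lemma not_connected_component_both:
  "\<not> (connected_component (up_set P) x y \<and> connected_component (down_set P) x z)"
  using paintbox_props(5)[of P] connected_component_in by blast

lemma placed_left_order:
  assumes "inj_on \<xi> A"
  shows "i \<in> A \<Longrightarrow> j \<in> A \<Longrightarrow> placed_left P \<xi> i j \<Longrightarrow> \<not> placed_left P \<xi> j i"
    and "i \<in> A \<Longrightarrow> j \<in> A \<Longrightarrow> i \<noteq> j \<Longrightarrow> placed_left P \<xi> i j \<or> placed_left P \<xi> j i"
    and "placed_left P \<xi> i j \<Longrightarrow> placed_left P \<xi> j k \<Longrightarrow> placed_left P \<xi> i k"
proof -
  let ?U = "connected_component (up_set P)" and ?D = "connected_component (down_set P)"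
  note simps = placed_left_def connected_component_up_down
  have sym: "?U x y \<longleftrightarrow> ?U y x" "?D x y \<longleftrightarrow> ?D y x" for x y
    by (auto intro: connected_component_sym)
  have trans: "?U x y \<Longrightarrow> ?U y z \<Longrightarrow> ?U x z" "?D x y \<Longrightarrow> ?D y z \<Longrightarrow> ?D x z" for x y z
    by (auto intro: connected_component_trans)
  have excl: "\<not> (?U x y \<and> ?D x z)" "\<not> (?U x y \<and> ?D y z)" "\<not> (?U x y \<and> ?D z x)"
    "\<not> (?U x y \<and> ?D z y)" for x y z
    using not_connected_component_both sym by blast+
  show "\<not> placed_left P \<xi> j i" if "i \<in> A" "j \<in> A" "placed_left P \<xi> i j"
    using that(3) excl(1) sym unfolding simps by (metis less_asym)
  show "placed_left P \<xi> i j \<or> placed_left P \<xi> j i" if "i \<in> A" "j \<in> A" "i \<noteq> j"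
  proof -
    have "\<xi> i \<noteq> \<xi> j"
      using that assms by (auto dest: inj_onD)
    then show ?thesis
      using that sym unfolding simps by (metis linorder_neqE)
  qed
  show "placed_left P \<xi> i k" if L: "placed_left P \<xi> i j" "placed_left P \<xi> j k"
  proof -
    let ?C = "\<lambda>x y. ?U x y \<or> ?D x y"
    have Csym: "?C x y \<longleftrightarrow> ?C y x" for x y
      using sym by blast
    have Ctrans: "?C x y \<Longrightarrow> ?C y z \<Longrightarrow> ?C x z" for x y z
      using trans excl by blast
    have Cbet: "?C x y \<and> ?C y z" if "?C x z" "x \<le> y" "y \<le> z" for x y z
      using that connected_component_between by blast
    consider "?C (\<xi> i) (\<xi> j)" "?C (\<xi> j) (\<xi> k)"
      | "?C (\<xi> i) (\<xi> j)" "\<not> ?C (\<xi> j) (\<xi> k)"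
      | "\<not> ?C (\<xi> i) (\<xi> j)" "?C (\<xi> j) (\<xi> k)"
      | "\<not> ?C (\<xi> i) (\<xi> j)" "\<not> ?C (\<xi> j) (\<xi> k)"
      by blast
    then show ?thesis
    proof cases
      case 1
      then show ?thesis
        using L trans excl unfolding simps by (meson less_trans)
    next
      case 2
      then have n: "\<not> ?C (\<xi> i) (\<xi> k)"
        using Csym Ctrans by blast
      have "\<xi> j < \<xi> k"
        using L(2) 2(2) unfolding simps by blast
      moreover have "\<not> \<xi> k \<le> \<xi> i"
        using Cbet[of "\<xi> j" "\<xi> i" "\<xi> k"] 2 Csym calculation by force
      ultimately show ?thesis
        using n unfolding simps by auto
    next
      case 3
      then have n: "\<not> ?C (\<xi> i) (\<xi> k)"
        using Csym Ctrans by blast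
      have "\<xi> i < \<xi> j"
        using L(1) 3(1) unfolding simps by blast
      moreover have "\<not> \<xi> k \<le> \<xi> i"
        using Cbet[of "\<xi> k" "\<xi> j" "\<xi> i"] 3 Csym calculation by force
      ultimately show ?thesis
        using n unfolding simps by auto
    next
      case 4
      then have "\<xi> i < \<xi> j" "\<xi> j < \<xi> k"
        using L unfolding simps by blast+
      then have "\<xi> i < \<xi> k" "\<not> ?C (\<xi> i) (\<xi> k)"
        using Cbet[of "\<xi> i" "\<xi> k" "\<xi> j"] 4 by auto
      then show ?thesis
        unfolding simps by blast
    qed
  qed
qed

lemma ex1_paintbox_word:
  assumes "inj_on \<xi> {1..}"
  shows "\<exists>!w. w \<in> perms n \<and>
    (\<forall>i\<in>{1..n}. \<forall>j\<in>{1..n}. i \<noteq> j \<longrightarrow> (left_of w i j \<longleftrightarrow> placed_left P \<xi> i j))"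
proof -
  have inj: "inj_on \<xi> {1..n}"
    using assms by (rule inj_on_subset) auto
  note order = placed_left_order[OF inj, where P = P]
  have "w \<in> perms n \<and>
      (\<forall>i\<in>{1..n}. \<forall>j\<in>{1..n}. i \<noteq> j \<longrightarrow> (left_of w i j \<longleftrightarrow> placed_left P \<xi> i j)) \<longleftrightarrow>
      set w = {1..n} \<and> distinct w \<and> sorted_wrt (placed_left P \<xi>) w" for w
  proof (cases "set w = {1..n} \<and> distinct w")
    case True
    have "(\<forall>i\<in>{1..n}. \<forall>j\<in>{1..n}. i \<noteq> j \<longrightarrow> (left_of w i j \<longleftrightarrow> placed_left P \<xi> i j)) \<longleftrightarrow>
        sorted_wrt (placed_left P \<xi>) w"
      by (rule left_of_iff_sorted_wrt) (fact True[THEN conjunct2] True[THEN conjunct1] order)+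
    with True show ?thesis
      by (simp only: permutations_of_set_def mem_Collect_eq) blast
  next
    case False
    then show ?thesis
      by (simp only: permutations_of_set_def mem_Collect_eq) blast
  qed
  moreover have "\<exists>!w. set w = {1..n} \<and> distinct w \<and> sorted_wrt (placed_left P \<xi>) w"
    by (rule ex1_sorted_wrt) (fact finite_atLeastAtMost order(1,2) | erule (1) order(3))+
  ultimately show ?thesis
    by (simp only:)
qed

lemma paintbox_arrangement_in_arrangements: "paintbox_arrangement P \<xi> \<in> arrangements"
proof (cases "inj_on \<xi> {1..}")
  case True
  have W: "paintbox_arrangement P \<xi> n \<in> perms n \<and>
      (\<forall>i\<in>{1..n}. \<forall>j\<in>{1..n}. i \<noteq> j \<longrightarrow>
        (left_of (paintbox_arrangement P \<xi> n) i j \<longleftrightarrow> placed_left P \<xi> i j))" if "1 \<le> n" for n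
    using theI'[OF ex1_paintbox_word[OF True, of n P]] that True
    by (simp add: paintbox_arrangement_def)
  have irrefl: "\<not> left_of w i i" if "w \<in> perms n" for w n i
    using that by (auto simp: left_of_def permutations_of_set_def nth_eq_iff_index_eq)
  have "coherent (paintbox_arrangement P \<xi> m) (paintbox_arrangement P \<xi> n)"
    if "1 \<le> m" "m < n" for m n
    unfolding coherent_def
  proof (intro ballI)
    fix i j
    assume "i \<in> set (paintbox_arrangement P \<xi> m)" "j \<in> set (paintbox_arrangement P \<xi> m)"
    then have "i \<in> {1..m}" "j \<in> {1..m}"
      using W[OF that(1)] by (auto simp: permutations_of_set_def)
    then show "left_of (paintbox_arrangement P \<xi> m) i j \<longleftrightarrow>
        left_of (paintbox_arrangement P \<xi> n) i j"
      using W[of m] W[of n] that irrefl[of _ m i] irrefl[of _ n i] by (cases "i = j") auto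
  qed
  moreover have "paintbox_arrangement P \<xi> \<in> (\<Pi>\<^sub>E n\<in>{1..}. perms n)"
    using W by (auto simp: PiE_iff extensional_def paintbox_arrangement_def)
  ultimately show ?thesis
    by (auto simp: arrangements_def)
next
  case False
  have eq: "paintbox_arrangement P \<xi> = (\<lambda>n\<in>{1..}. [1..<Suc n])"
    using False by (simp add: paintbox_arrangement_def)
  have L: "left_of [1..<Suc n] i j \<longleftrightarrow> i < j" if "i \<in> {1..n}" "j \<in> {1..n}" for n i j
  proof
    assume "left_of [1..<Suc n] i j"
    then show "i < j"
      by (auto simp: left_of_def simp del: upt_Suc)
  next
    assume "i < j"
    with that show "left_of [1..<Suc n] i j"
      unfolding left_of_def
      by (intro exI[of _ "i - 1"] exI[of _ "j - 1"]) (auto simp del: upt_Suc)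
  qed
  have "coherent [1..<Suc m] [1..<Suc n]" if "m < n" for m n
    unfolding coherent_def using that L by (auto simp del: upt_Suc)
  moreover have "[1..<Suc n] \<in> perms n" for n
    by (auto simp: permutations_of_set_def simp del: upt_Suc)
  ultimately show ?thesis
    unfolding eq arrangements_def by (auto simp del: upt_Suc)
qed

definition uniform_sample :: "(nat \<Rightarrow> real) measure" where
  "uniform_sample = (\<Pi>\<^sub>M i\<in>{1..}. uniform_measure lborel {0..1})"

text \<open>The product measure expresses that the random paintbox, with distribution \<open>\<nu>\<close>, is
  independent of the uniform sample.\<close>

definition paintbox_law :: "paintbox measure \<Rightarrow> (nat \<Rightarrow> nat list) measure" where
  "paintbox_law \<nu> =
     distr (\<nu> \<Otimes>\<^sub>M uniform_sample) arrangement_space (\<lambda>(P, \<xi>). paintbox_arrangement P \<xi>)"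

end

theory Submission
  imports Defs "HOL-Complex_Analysis.Great_Picard"
begin

text \<open>The key step is that every harmonic function \<open>p\<close> is a mixture of paintbox functions. Regard \<open>p (zs w)\<close> as
  the probability of a word \<open>w\<close>; inserting a new letter, whatever its value, leaves the shapes of the
  shorter words distributed according to \<open>p\<close>. Take \<open>N\<close> small labels, \<open>n\<close> middle labels and \<open>N\<close> large labels, and group
  the middle labels into clusters, the maximal groups not separated by other labels. Exchanging the
  labels \<open>i\<close> and \<open>i + 1\<close> preserves the shape of a word unless they are adjacent; hence the middle labels are
  distributed exchangeably over the clusters, and, as \<open>N\<close> grows, each cluster is monotone with high
  probability. Up to an error of order \<open>1 / n\<close>, the first \<open>m\<close> middle labels are thus arranged by the paintbox whose
  intervals are the clusters, with lengths proportional to their sizes. As the space of paintboxes is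
  compact, a weak limit of these random paintboxes represents \<open>p\<close>.

  Sampling with disjoint sets of labels shows that products of paintbox functions are sums of paintbox
  functions, and a paintbox can be recovered from the joint moments of the masses lying to the left of a
  sample point among earlier and among later labels. By Stone--Weierstrass the mixing measure is
  therefore unique, and the extreme harmonic functions are exactly the paintbox functions.\<close>

section \<open>Shapes of words\<close>

text \<open>A shape records only comparisons of neighbouring letters, so a harmonic function gives a
  consistent family of random words over all finite sets of labels, not merely over initial
  segments. This freedom pays for the outside labels. A cluster that is not monotone contains a
  label \<open>y\<close> larger, or smaller, than two labels \<open>x\<close> and \<open>z\<close>
  standing on its two sides, with no outside label between \<open>x\<close> and \<open>z\<close>. A
  larger \<open>y\<close> competes with the large labels, a smaller one with the small labels, for
  being the only one between \<open>x\<close> and \<open>z\<close>; hence outside labels are needed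
  at both ends, and far more of them than the cube of the number of middle labels. The error of
  order 1/n comes from replacing a sample without repetition by independent uniform points. A sample
  point in a rising component has to its left, among earlier labels, the mass up to the right end of
  the component, and among later labels the mass up to its left end; in a falling component the ends
  are exchanged. So the two masses tell both sets apart. Extremality of paintbox functions is a
  vanishing variance, which the product formula turns into a linear expression.\<close>

fun ascents :: "nat list \<Rightarrow> bool list" where
  "ascents (x # y # v) = (x < y) # ascents (y # v)"
| "ascents v = []"

text \<open>The bijection between ascent patterns and compositions. A word of n letters has n - 1
  comparisons, so the recursion starts from \<open>[1]\<close> and reaches every composition except
  the empty one.\<close>

fun run_lengths :: "bool list \<Rightarrow> nat list" where
  "run_lengths [] = [1]"
| "run_lengths (b # s) =
     (if b then Suc (hd (run_lengths s)) # tl (run_lengths s) else 1 # run_lengths s)"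

lemma run_lengths_pos: "run_lengths s \<noteq> []" "0 < hd (run_lengths s)"
  by (induction s) auto

lemma run_lengths_inject: "run_lengths s = run_lengths t \<longleftrightarrow> s = t"
proof (induction s arbitrary: t)
  case Nil
  show ?case
  proof (cases t)
    case (Cons b s)
    then show ?thesis
      using run_lengths_pos[of s] by auto
  qed simp
next
  case (Cons b s)
  show ?case
  proof (cases t)
    case Nil
    then show ?thesis
      using run_lengths_pos[of s] by auto
  next
    case (Cons c t')
    have "run_lengths s = run_lengths t' \<longleftrightarrow>
        hd (run_lengths s) = hd (run_lengths t') \<and> tl (run_lengths s) = tl (run_lengths t')"
      by (metis list.collapse run_lengths_pos(1))
    then show ?thesis
      using run_lengths_pos[of s] run_lengths_pos[of t'] Cons Cons.IH[of t'] by auto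
  qed
qed

lemma length_runs: "map length (increasing_runs (x # v)) = run_lengths (ascents (x # v))"
proof (induction v arbitrary: x)
  case (Cons y v)
  obtain r rs where r: "increasing_runs (y # v) = r # rs"
    by (cases "increasing_runs (y # v)") auto
  show ?case
    using Cons[of y] by (simp add: r) (metis list.sel(1) list.sel(3))
qed simp

text \<open>The length separates the empty word from the one-letter words, which all have an empty
  list of ascents. Insertion of a letter is easier to follow in binary words than in
  compositions.\<close>

lemma zs_eq_iff: "zs u = zs w \<longleftrightarrow> length u = length w \<and> ascents u = ascents w"
proof -
  have *: "zs u = zs w \<longleftrightarrow> map length (increasing_runs u) = map length (increasing_runs w)"
    by transfer simp
  have len: "zs u = zs w \<Longrightarrow> length u = length w"
    by (metis zigzag_size_zs)
  show ?thesis
  proof (cases u)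
    case Nil
    then show ?thesis using len by auto
  next
    case (Cons x v)
    then show ?thesis
      using len * length_runs run_lengths_inject by (cases w) auto
  qed
qed

lemma length_ascents: "length (ascents u) = length u - 1"
  by (induction u rule: ascents.induct) auto

lemma ascents_eq_iff:
  assumes "length u = length w"
  shows "ascents u = ascents w \<longleftrightarrow> (\<forall>k. Suc k < length u \<longrightarrow> (u ! k < u ! Suc k \<longleftrightarrow> w ! k < w ! Suc k))"
proof -
  have nth: "ascents v ! k \<longleftrightarrow> v ! k < v ! Suc k" if "Suc k < length v" for v k
    using that
  proof (induction v arbitrary: k rule: ascents.induct)
    case (1 x y v)
    then show ?case by (cases k) auto
  qed auto
  show ?thesis
    unfolding list_eq_iff_nth_eq length_ascents using assms nth by auto
qed

lemma zs_eqI: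
  assumes "length u = length w" "\<And>k. Suc k < length u \<Longrightarrow> u ! k < u ! Suc k \<longleftrightarrow> w ! k < w ! Suc k"
  shows "zs u = zs w"
  using assms by (simp add: zs_eq_iff ascents_eq_iff)

section \<open>Inserting one letter and the shapes that result\<close>

fun insertions :: "'a \<Rightarrow> 'a list \<Rightarrow> 'a list list" where
  "insertions j [] = [[j]]"
| "insertions j (x # u) = (j # x # u) # map ((#) x) (insertions j u)"

lemma set_insertions: "set (insertions j u) = {xs @ j # ys | xs ys. u = xs @ ys}"
proof (induction u)
  case (Cons x u)
  have "w \<in> {xs @ j # ys | xs ys. x # u = xs @ ys} \<longleftrightarrow>
      w = j # x # u \<or> (\<exists>xs ys. w = x # xs @ j # ys \<and> u = xs @ ys)" for w
    by (simp add: Cons_eq_append_conv) (metis append_Cons append_Nil)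
  then have "{xs @ j # ys | xs ys. x # u = xs @ ys} =
      insert (j # x # u) ((#) x ` {xs @ j # ys | xs ys. u = xs @ ys})"
    by blast
  then show ?case
    using Cons by simp
qed auto

text \<open>The words covering a binary word in the subword order, each listed once: a new letter
  is inserted only in front of a different one, or at the end.\<close>

fun covers :: "bool list \<Rightarrow> bool list list" where
  "covers [] = [[True], [False]]"
| "covers (b # s) = ((\<not> b) # b # s) # map ((#) b) (covers s)"

lemma distinct_covers: "distinct (covers s)"
  by (induction s) (auto simp: distinct_map)

text \<open>Peel off the first letter \<open>x\<close>. Insertions behind the second letter
  \<open>y\<close> start with the bit \<open>x < y\<close> and come from the tail. Only the
  positions just before and just after \<open>x\<close> need care, and there the value of
  \<open>j\<close> merely decides which of them yields which of two words.\<close>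

lemma mset_ascents_insertions:
  assumes "u \<noteq> []" "distinct u" "j \<notin> set u"
  shows "mset (map ascents (insertions j u)) = mset (covers (ascents u))"
  using assms
proof (induction u rule: ascents.induct)
  case (1 x y v)
  let ?b = "x < y" and ?s = "ascents (y # v)"
  let ?R = "map ascents (map ((#) y) (insertions j v))"
  have "mset (map ascents (insertions j (y # v))) = mset (covers ?s)"
    using 1 by simp
  then have IH: "add_mset ((j < y) # ?s) (mset ?R) = mset (covers ?s)"
    by simp
  have "map ascents (map ((#) x) (map ((#) y) (insertions j v))) = map ((#) ?b) ?R"
    by (simp add: comp_def)
  then have "mset (map ascents (insertions j (x # y # v))) =
      {#(j < x) # ?b # ?s, (x < j) # (j < y) # ?s#} + image_mset ((#) ?b) (mset ?R)"
    by (simp add: add_mset_commute comp_def image_mset.compositionality)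
  moreover have "mset (covers (ascents (x # y # v))) =
      {#(\<not> ?b) # ?b # ?s, ?b # (j < y) # ?s#} + image_mset ((#) ?b) (mset ?R)"
    by (simp add: comp_def flip: IH)
  \<comment> \<open>If \<open>x < j\<close> agrees with \<open>x < y\<close>, the two words match in
    the given order. Otherwise \<open>j\<close> and \<open>y\<close> lie on opposite sides of
    \<open>x\<close>, so \<open>j < y\<close> equals \<open>x < y\<close> and the words match
    crosswise.\<close>
  moreover have "{#(j < x) # ?b # ?s, (x < j) # (j < y) # ?s#} = {#(\<not> ?b) # ?b # ?s, ?b # (j < y) # ?s#}"
  proof -
    have "j \<noteq> x" "j \<noteq> y" "x \<noteq> y"
      using 1 by auto
    then consider "(x < j) = ?b" "(j < x) = (\<not> ?b)" | "(x < j) = (\<not> ?b)" "(j < x) = ?b" "(j < y) = ?b"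
      by linarith
    then show ?thesis
      by cases (simp_all add: add_mset_commute)
  qed
  ultimately show ?case
    by simp
next
  case ("2_2" y)
  then show ?case
    by (cases "j < y") (auto simp: add_mset_commute)
qed auto

text \<open>A leading ascent arises by putting a new smallest letter in front after shifting the
  others up, a leading descent by putting a new largest letter in front.\<close>

lemma exists_word:
  assumes "0 < n" "length s = n - 1"
  shows "\<exists>w\<in>perms n. ascents w = s"
  using assms
proof (induction n arbitrary: s rule: nat_induct_non_zero)
  case 1
  then show ?case
    by (auto simp: permutations_of_set_def intro!: exI[of _ "[1]"])
next
  case (Suc n)
  then obtain b t where s: "s = b # t" "length t = n - 1"
    by (cases s) auto
  then obtain w where w: "set w = {1..n}" "distinct w" "ascents w = t"
    using Suc.IH by (auto simp: permutations_of_set_def)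
  then obtain x v where xv: "w = x # v"
    using Suc.hyps by (cases w) auto
  then have x: "x \<in> {1..n}"
    using w(1) by auto
  show ?case
  proof (cases b)
    case True
    have *: "ascents (map Suc w) = ascents w" for w
      by (induction w rule: ascents.induct) auto
    have "ascents (1 # map Suc w) = s"
      using *[of w] w s True xv x by auto
    moreover have "set (1 # map Suc w) = {1..Suc n}"
      using w(1) by (simp add: image_Suc_atLeastAtMost) auto
    ultimately show ?thesis
      using w by (intro bexI[of _ "1 # map Suc w"]) (auto simp: permutations_of_set_def distinct_map)
  next
    case False
    have "ascents (Suc n # w) = s"
      using w s False xv x by auto
    moreover have "set (Suc n # w) = {1..Suc n}"
      by (simp only: list.set w(1)) (simp add: atLeastAtMostSuc_conv)
    ultimately show ?thesis
      using w by (intro bexI[of _ "Suc n # w"]) (auto simp: permutations_of_set_def)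
  qed
qed

lemma run_lengths_surj: "c \<noteq> [] \<Longrightarrow> \<forall>k\<in>set c. 0 < k \<Longrightarrow> \<exists>s. run_lengths s = c"
proof (induction "sum_list c" arbitrary: c rule: less_induct)
  case less
  then obtain k c' where c: "c = k # c'" "0 < k"
    by (cases c) auto
  show ?case
  proof (cases "k = 1")
    case True
    show ?thesis
    proof (cases "c' = []")
      case True
      then show ?thesis using c \<open>k = 1\<close> by (intro exI[of _ "[]"]) auto
    next
      case False
      then obtain s where "run_lengths s = c'"
        using less(1)[of c'] less(3) c by auto
      then show ?thesis using c True by (intro exI[of _ "False # s"]) auto
    qed
  next
    case False
    then obtain s where "run_lengths s = (k - 1) # c'"
      using less(1)[of "(k - 1) # c'"] less(3) c by auto
    then show ?thesis using c False by (intro exI[of _ "True # s"]) auto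
  qed
qed

text \<open>Every shape gets a representative word, so that statements about shapes can be proved on
  words.\<close>

lemma exists_perm_zs: "\<exists>w\<in>perms (zigzag_size \<mu>). zs w = \<mu>"
proof -
  have "\<exists>w. zs w = \<mu> \<and> w \<in> perms (length w)"
  proof (cases "\<mu> = zs []")
    case True
    then show ?thesis by (intro exI[of _ "[]"]) auto
  next
    case False
    then have "Rep_zigzag \<mu> \<noteq> []"
      by transfer auto
    moreover have "\<forall>k\<in>set (Rep_zigzag \<mu>). 0 < k"
      using Rep_zigzag[of \<mu>] by auto
    ultimately obtain s where s: "run_lengths s = Rep_zigzag \<mu>"
      using run_lengths_surj by blast
    obtain w where w: "w \<in> perms (Suc (length s))" "ascents w = s"
      using exists_word[of "Suc (length s)" s] by auto
    then have len: "length w = Suc (length s)"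
      by (simp add: length_finite_permutations_of_set)
    then have "Rep_zigzag (zs w) = Rep_zigzag \<mu>"
      using s w length_runs by (cases w) (auto simp: zs.rep_eq)
    then show ?thesis
      using w len by (auto simp: Rep_zigzag_inject)
  qed
  then show ?thesis
    by (metis zigzag_size_zs)
qed

section \<open>Harmonic functions as weights on words\<close>

lemma left_of_order:
  assumes "distinct w"
  shows "\<not> left_of w i i"
    and "left_of w i j \<Longrightarrow> \<not> left_of w j i"
    and "i \<in> set w \<Longrightarrow> j \<in> set w \<Longrightarrow> i \<noteq> j \<Longrightarrow> left_of w i j \<or> left_of w j i"
    and "left_of w i j \<Longrightarrow> left_of w j k \<Longrightarrow> left_of w i k"
proof -
  have eq: "a = b" if "a < length w" "b < length w" "w ! a = w ! b" for a b
    using that assms nth_eq_iff_index_eq by blast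
  show "\<not> left_of w i i"
    unfolding left_of_def using eq by (metis less_trans nat_neq_iff)
  show "left_of w i j \<Longrightarrow> \<not> left_of w j i"
    unfolding left_of_def using eq by (metis less_asym less_trans)
  show "i \<in> set w \<Longrightarrow> j \<in> set w \<Longrightarrow> i \<noteq> j \<Longrightarrow> left_of w i j \<or> left_of w j i"
    unfolding left_of_def in_set_conv_nth by (metis nat_neq_iff)
  show "left_of w i j \<Longrightarrow> left_of w j k \<Longrightarrow> left_of w i k"
    unfolding left_of_def using eq by (metis less_trans)
qed

lemma left_of_in_set: "left_of w i j \<Longrightarrow> i \<in> set w" "left_of w i j \<Longrightarrow> j \<in> set w"
  by (auto simp: left_of_def)

lemma sorted_wrt_left_of: "sorted_wrt (left_of w) w"
  by (auto simp: sorted_wrt_iff_nth_less left_of_def)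

lemma filter_eq_iff_sorted:
  assumes "distinct u" "distinct w" "set u \<subseteq> set w"
  shows "filter (\<lambda>i. i \<in> set u) w = u \<longleftrightarrow> sorted_wrt (left_of w) u"
proof -
  note ord = left_of_order[OF assms(2)] and sub = subsetD[OF assms(3)]
  let ?f = "filter (\<lambda>i. i \<in> set u) w"
  have ex1: "\<exists>!v. set v = set u \<and> distinct v \<and> sorted_wrt (left_of w) v"
    by (rule ex1_sorted_wrt) (use ord sub in blast)+
  have "set ?f = set u" "distinct ?f" "sorted_wrt (left_of w) ?f"
    using assms by (auto intro!: sorted_wrt_filter sorted_wrt_left_of)
  with ex1 assms(1) show ?thesis
    by metis
qed

text \<open>Coherence becomes an equation: \<open>u\<close> is what remains of \<open>w\<close>
  after deleting the other letters. Sums over words coherent with \<open>u\<close> are then sums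
  over a fibre of \<open>filter\<close>.\<close>

lemma coherent_iff_filter:
  assumes "distinct u" "distinct w" "set u \<subseteq> set w"
  shows "coherent u w \<longleftrightarrow> filter (\<lambda>i. i \<in> set u) w = u"
proof -
  note ord = left_of_order[OF assms(2)] and sub = subsetD[OF assms(3)]
  have "(\<forall>i\<in>set u. \<forall>j\<in>set u. i \<noteq> j \<longrightarrow> (left_of u i j \<longleftrightarrow> left_of w i j)) \<longleftrightarrow>
      sorted_wrt (left_of w) u"
  proof (rule left_of_iff_sorted_wrt)
    show "left_of w i j \<Longrightarrow> \<not> left_of w j i" for i j
      by (rule ord(2))
    show "left_of w i j \<or> left_of w j i" if "i \<in> set u" "j \<in> set u" "i \<noteq> j" for i j
      by (rule ord(3)) (use that sub in auto)
  qed (use assms in auto)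
  then have "coherent u w \<longleftrightarrow> sorted_wrt (left_of w) u"
    unfolding coherent_def using ord(1) left_of_order(1)[OF assms(1)] by metis
  then show ?thesis
    using filter_eq_iff_sorted[OF assms] by simp
qed

lemma left_of_filter:
  assumes "distinct w" "P i" "P j"
  shows "left_of (filter P w) i j \<longleftrightarrow> left_of w i j"
proof (cases "i \<in> set w \<and> j \<in> set w")
  case True
  have "coherent (filter P w) w"
    using assms by (subst coherent_iff_filter) (auto cong: filter_cong)
  then show ?thesis
    using True assms by (auto simp: coherent_def)
qed (auto dest: left_of_in_set)

text \<open>The right-hand side contains \<open>u\<close> only through its length and ascents, and
  \<open>j\<close> not at all: the set of resulting shapes depends on the shape of \<open>u\<close>
  alone. Injectivity holds because \<open>covers\<close> has no repetitions, so no edge is counted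
  twice.\<close>

lemma zs_image_insertions:
  assumes "u \<noteq> []" "distinct u" "j \<notin> set u"
  shows "zs ` set (insertions j u) = {\<nu>. \<exists>t\<in>set (covers (ascents u)). \<exists>w. length w = Suc (length u) \<and> ascents w = t \<and> \<nu> = zs w}"
    and "inj_on zs (set (insertions j u))"
proof -
  have m: "mset (map ascents (insertions j u)) = mset (covers (ascents u))"
    by (rule mset_ascents_insertions[OF assms])
  then have set: "ascents ` set (insertions j u) = set (covers (ascents u))"
    by (metis image_set set_mset_mset)
  have len: "w \<in> set (insertions j u) \<Longrightarrow> length w = Suc (length u)" for w
    by (auto simp: set_insertions)
  show "zs ` set (insertions j u) = {\<nu>. \<exists>t\<in>set (covers (ascents u)). \<exists>w. length w = Suc (length u) \<and> ascents w = t \<and> \<nu> = zs w}"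
    unfolding set[symmetric] using len by (auto simp: zs_eq_iff image_iff) 
  have "distinct (map ascents (insertions j u))"
    using m distinct_covers mset_eq_imp_distinct_iff by blast
  then show "inj_on zs (set (insertions j u))"
    by (auto simp: distinct_map inj_on_def zs_eq_iff)
qed

lemma perms_Suc_iff:
  assumes "u \<in> perms n"
  shows "w \<in> set (insertions (Suc n) u) \<longleftrightarrow> w \<in> perms (Suc n) \<and> coherent u w"
proof -
  have u: "distinct u" "set u = {1..n}"
    using assms by (auto simp: permutations_of_set_def)
  have "coherent u w \<longleftrightarrow> filter (\<lambda>i. i \<in> set u) w = u" if "w \<in> perms (Suc n)"
    using that u by (intro coherent_iff_filter) (auto simp: permutations_of_set_def)
  moreover have "w \<in> perms (Suc n) \<and> filter (\<lambda>i. i \<in> set u) w = u"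
    if w: "w \<in> set (insertions (Suc n) u)"
  proof -
    obtain xs ys where xy: "u = xs @ ys" "w = xs @ Suc n # ys"
      using w by (auto simp: set_insertions)
    have "Suc n \<notin> set u"
      using u by simp
    then have "filter (\<lambda>i. i \<in> set u) w = u" "distinct w"
      using u(1) by (auto simp: xy filter_id_conv)
    moreover have "set w = insert (Suc n) (set u)"
      using xy by auto
    ultimately show ?thesis
      using u(2) by (simp add: permutations_of_set_def) auto
  qed
  moreover have "w \<in> set (insertions (Suc n) u)"
    if w: "w \<in> perms (Suc n)" "filter (\<lambda>i. i \<in> set u) w = u"
  proof -
    have "Suc n \<in> set w"
      using w(1) by (auto simp: permutations_of_set_def)
    then obtain xs ys where xy: "w = xs @ Suc n # ys"
      by (meson split_list)
    have "insert (Suc n) (set (xs @ ys)) = insert (Suc n) {1..n}" "Suc n \<notin> set (xs @ ys)"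
      using w(1) unfolding xy by (auto simp: permutations_of_set_def)
    then have "set (xs @ ys) = set u"
      unfolding u(2) by (metis Diff_insert_absorb atLeastAtMost_iff insert_absorb not_less_eq_eq order_refl)
    then have "\<forall>i\<in>set (xs @ ys). i \<in> set u"
      by simp
    then have "filter (\<lambda>i. i \<in> set u) w = xs @ ys"
      using u(2) unfolding xy filter_append by (simp add: filter_id_conv)
    then show ?thesis
      using w(2) xy by (auto simp: set_insertions)
  qed
  ultimately show ?thesis
    by blast
qed

text \<open>The edge relation is defined by inserting the largest label into a permutation of an
  initial segment. As the set of new shapes depends only on the old shape, any word with distinct
  letters and any fresh letter serve as well.\<close>

lemma zigzag_edge_iff:
  assumes "u \<noteq> []" "distinct u" "j \<notin> set u"
  shows "{\<nu>. zigzag_edge (zs u) \<nu>} = zs ` set (insertions j u)"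
proof -
  let ?E = "\<lambda>u j. zs ` set (insertions j u)"
  have ne: "zs u \<noteq> empty_zigzag"
    using assms(1) zigzag_size_zs[of u] by (auto simp: empty_zigzag.rep_eq zigzag_size.rep_eq)
  have eq: "?E u' n = ?E u j" if "u' \<in> perms (n - 1)" "2 \<le> n" "zs u' = zs u" for u' n
    using that assms by (subst (1 2) zs_image_insertions(1))
      (auto simp: permutations_of_set_def zs_eq_iff)
  have iff: "w \<in> perms n \<and> coherent u' w \<longleftrightarrow> w \<in> set (insertions n u')"
    if "u' \<in> perms (n - 1)" "2 \<le> n" for u' w n
    using perms_Suc_iff[OF that(1), of w] that(2) by simp
  obtain u' where u': "u' \<in> perms (length u)" "zs u' = zs u"
    using exists_perm_zs[of "zs u"] by (auto simp: zigzag_size_zs)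
  have len: "2 \<le> Suc (length u)"
    using assms(1) by (cases u) auto
  have "zigzag_edge (zs u) \<nu> \<longleftrightarrow> \<nu> \<in> ?E u j" for \<nu>
  proof
    assume "zigzag_edge (zs u) \<nu>"
    then obtain n v w where "2 \<le> n" "v \<in> perms (n - 1)" "w \<in> perms n" "coherent v w"
      "zs u = zs v" "\<nu> = zs w"
      using ne by (auto simp: zigzag_edge_def)
    then show "\<nu> \<in> ?E u j"
      using eq[of v n] iff[of v n w] by auto
  next
    assume "\<nu> \<in> ?E u j"
    then have "\<nu> \<in> ?E u' (Suc (length u))"
      using eq[of u' "Suc (length u)"] u' len by simp
    then obtain w where "w \<in> perms (Suc (length u))" "coherent u' w" "\<nu> = zs w"
      using iff[of u' "Suc (length u)"] u' len by auto
    then show "zigzag_edge (zs u) \<nu>"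
      unfolding zigzag_edge_def using u' len by (metis diff_Suc_1)
  qed
  then show ?thesis
    by auto
qed

lemma zs_singleton: "zs [j] = box_zigzag"
  by (rule Rep_zigzag_inject[THEN iffD1]) (simp add: zs.rep_eq box_zigzag.rep_eq)

lemma zs_Nil: "zs [] = empty_zigzag"
  by (rule Rep_zigzag_inject[THEN iffD1]) (simp add: zs.rep_eq empty_zigzag.rep_eq)

lemma zigzag_edge_empty: "{\<nu>. zigzag_edge empty_zigzag \<nu>} = {box_zigzag}"
proof -
  have "zs u \<noteq> empty_zigzag" if "u \<in> perms (n - 1)" "2 \<le> n" for u n
  proof -
    have "length u = n - 1"
      using that by (simp add: length_finite_permutations_of_set)
    then show ?thesis
      using that zigzag_size_zs[of u] by (auto simp: empty_zigzag.rep_eq zigzag_size.rep_eq)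
  qed
  then have "zigzag_edge empty_zigzag \<nu> \<longleftrightarrow> \<nu> = box_zigzag" for \<nu>
    unfolding zigzag_edge_def by metis
  then show ?thesis by auto
qed

lemma sum_zigzag_edge:
  assumes "distinct u" "j \<notin> set u"
  shows "(\<Sum>\<nu> | zigzag_edge (zs u) \<nu>. f \<nu>) = (\<Sum>w\<in>set (insertions j u). f (zs w))"
proof (cases "u = []")
  case True
  then show ?thesis
    by (simp add: zs_Nil zigzag_edge_empty zs_singleton)
next
  case False
  then show ?thesis
    using assms by (simp add: zigzag_edge_iff sum.reindex zs_image_insertions(2))
qed

lemma harmonic_insertions:
  assumes "p \<in> harmonic_functions" "distinct u" "j \<notin> set u"
  shows "(\<Sum>w\<in>set (insertions j u). p (zs w)) = p (zs u)"
proof -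
  have "p (zs u) = (\<Sum>\<nu> | zigzag_edge (zs u) \<nu>. p \<nu>)"
    using assms(1) unfolding harmonic_functions_def by blast
  then show ?thesis
    using sum_zigzag_edge[OF assms(2,3), of p] by simp
qed

lemma harmonicI:
  assumes "\<And>\<mu>. 0 \<le> p \<mu>" "p (zs []) = 1"
    and "\<And>u n. u \<in> perms n \<Longrightarrow> p (zs u) = (\<Sum>w\<in>set (insertions (Suc n) u). p (zs w))"
  shows "p \<in> harmonic_functions"
  unfolding harmonic_functions_def
proof (intro CollectI conjI allI)
  fix \<mu>
  obtain u where u: "u \<in> perms (zigzag_size \<mu>)" "zs u = \<mu>"
    using exists_perm_zs by blast
  then have "(\<Sum>\<nu> | zigzag_edge \<mu> \<nu>. p \<nu>) = (\<Sum>w\<in>set (insertions (Suc (zigzag_size \<mu>)) u). p (zs w))"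
    using sum_zigzag_edge[of u "Suc (zigzag_size \<mu>)" p] by (auto simp: permutations_of_set_def)
  then show "p \<mu> = (\<Sum>\<nu> | zigzag_edge \<mu> \<nu>. p \<nu>)"
    using assms(3)[OF u(1)] u(2) by simp
qed (use assms in \<open>auto simp: zs_Nil\<close>)

lemma sum_permutations_insert:
  assumes "finite S" "b \<notin> S"
  shows "(\<Sum>w\<in>permutations_of_set (insert b S). f w) =
    (\<Sum>u\<in>permutations_of_set S. \<Sum>w\<in>set (insertions b u). (f w :: real))"
proof -
  have filt: "filter (\<lambda>i. i \<in> S) w = u" if "u \<in> permutations_of_set S" "w \<in> set (insertions b u)" for u w
    using that assms(2) by (auto simp: set_insertions permutations_of_set_def filter_id_conv)
  have "permutations_of_set (insert b S) = (\<Union>u\<in>permutations_of_set S. set (insertions b u))"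
  proof (intro equalityI subsetI)
    fix w assume w: "w \<in> permutations_of_set (insert b S)"
    then obtain xs ys where xy: "w = xs @ b # ys"
      by (metis insertI1 permutations_of_setD(1) split_list)
    with w assms(2) have "xs @ ys \<in> permutations_of_set S"
      by (auto simp: permutations_of_set_def)
    then show "w \<in> (\<Union>u\<in>permutations_of_set S. set (insertions b u))"
      using xy by (auto simp: set_insertions)
  qed (use assms in \<open>auto simp: set_insertions permutations_of_set_def\<close>)
  moreover have "set (insertions b u) \<inter> set (insertions b v) = {}"
    if "u \<in> permutations_of_set S" "v \<in> permutations_of_set S" "u \<noteq> v" for u v
    using filt that by blast
  ultimately show ?thesis
    using assms(1) by (simp add: sum.UNION_disjoint)
qed

text \<open>Give each arrangement \<open>w\<close> of a label set the probability
  \<open>p (zs w)\<close>; then deleting labels maps these laws to each other. The labels of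
  \<open>B\<close> are removed one at a time, each by \<open>harmonic_insertions\<close>, and they
  may lie anywhere relative to \<open>A\<close>. The factor \<open>g\<close> stands for an arbitrary
  observable of the remaining word.\<close>

lemma harmonic_marginal:
  assumes "p \<in> harmonic_functions" "finite A" "finite B" "A \<inter> B = {}"
  shows "(\<Sum>w\<in>permutations_of_set (A \<union> B). g (filter (\<lambda>i. i \<in> A) w) * p (zs w)) =
    (\<Sum>u\<in>permutations_of_set A. g u * p (zs u))"
  using assms(3,4)
proof (induction B rule: finite_induct)
  case empty
  have "filter (\<lambda>i. i \<in> A) w = w" if "w \<in> permutations_of_set A" for w
    using that by (auto simp: permutations_of_set_def filter_id_conv)
  then show ?case
    by simp
next
  case (insert b B)
  have "(\<Sum>w\<in>set (insertions b u). g (filter (\<lambda>i. i \<in> A) w) * p (zs w)) =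
      g (filter (\<lambda>i. i \<in> A) u) * p (zs u)" if "u \<in> permutations_of_set (A \<union> B)" for u
  proof -
    have "filter (\<lambda>i. i \<in> A) w = filter (\<lambda>i. i \<in> A) u" if "w \<in> set (insertions b u)" for w
      using that insert.prems by (auto simp: set_insertions)
    moreover have "distinct u" "b \<notin> set u"
      using that insert by (auto simp: permutations_of_set_def)
    ultimately show ?thesis
      using harmonic_insertions[OF assms(1)] by (simp flip: sum_distrib_left)
  qed
  then show ?case
    using insert assms(2) by (simp add: sum_permutations_insert)
qed

lemma harmonicD:
  assumes "p \<in> harmonic_functions"
  shows "0 \<le> p \<mu>" "p (zs []) = 1"
  using assms unfolding harmonic_functions_def zs_Nil by blast+

lemma harmonic_sum_eq_1:
  assumes "p \<in> harmonic_functions" "finite A"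
  shows "(\<Sum>w\<in>permutations_of_set A. p (zs w)) = 1"
  using harmonic_marginal[OF assms(1) finite.emptyI assms(2), of "\<lambda>_. 1"] harmonicD(2)[OF assms(1)]
  by simp

section \<open>Weak limits on compact metric spaces\<close>

lemma (in prob_space) expectation_finite_range:
  fixes g :: "'b \<Rightarrow> real"
  assumes "h \<in> M \<rightarrow>\<^sub>M count_space UNIV" "\<And>x. x \<in> space M \<Longrightarrow> h x \<in> S" "finite S"
  shows "expectation (\<lambda>x. g (h x)) = (\<Sum>s\<in>S. g s * prob {x \<in> space M. h x = s})"
proof -
  have [measurable]: "{x \<in> space M. h x = s} \<in> events" for s
    using measurable_sets[OF assms(1), of "{s}"] by (simp add: vimage_def Int_def conj_commute)
  have "expectation (\<lambda>x. g (h x)) =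
      expectation (\<lambda>x. \<Sum>s\<in>S. g s * indicator {x \<in> space M. h x = s} x)"
  proof (rule Bochner_Integration.integral_cong)
    fix x assume x: "x \<in> space M"
    have "(\<Sum>s\<in>S. g s * indicator {x \<in> space M. h x = s} x) = (\<Sum>s\<in>S. if h x = s then g s else 0)"
      by (intro sum.cong) (auto simp: x indicator_def)
    also have "\<dots> = g (h x)"
      using assms(2)[OF x] assms(3) by (simp add: sum.delta)
    finally show "g (h x) = (\<Sum>s\<in>S. g s * indicator {x \<in> space M. h x = s} x)"
      by simp
  qed simp
  also have "\<dots> = (\<Sum>s\<in>S. expectation (\<lambda>x. g s * indicator {x \<in> space M. h x = s} x))"
    by (intro Bochner_Integration.integral_sum integrable_mult_right integrable_real_indicator)
      (auto simp: emeasure_eq_measure)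
  also have "\<dots> = (\<Sum>s\<in>S. g s * prob {x \<in> space M. h x = s})"
    by (simp add: Int_def conj_ac cong: conj_cong)
  finally show ?thesis .
qed

text \<open>For every radius 1/(j+1) finitely many balls cover the space; all these balls are
  enumerated in one sequence.\<close>

lemma compact_separating_sets:
  assumes "compact (UNIV :: 'a::metric_space set)"
  obtains B :: "nat \<Rightarrow> 'a::metric_space set"
  where "\<And>e. 0 < e \<Longrightarrow> \<exists>k. \<forall>x y. (\<forall>i<k. x \<in> B i \<longleftrightarrow> y \<in> B i) \<longrightarrow> dist x y < e"
proof -
  have "\<exists>C. finite C \<and> (UNIV :: 'a set) \<subseteq> (\<Union>x\<in>C. ball x (1 / real (Suc j)))" for j
    using assms unfolding compact_eq_totally_bounded by (auto dest!: spec[of _ "1 / real (Suc j)"])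
  then obtain C where C: "\<And>j. finite (C j)" "\<And>j. (UNIV :: 'a set) \<subseteq> (\<Union>x\<in>C j. ball x (1 / real (Suc j)))"
    by metis
  define BB where "BB = (\<Union>j. (\<lambda>x. ball x (1 / real (Suc j))) ` C j)"
  have BB: "countable BB" "BB \<noteq> {}"
  proof -
    show "countable BB"
      unfolding BB_def using C(1) by (auto intro: countable_finite)
    show "BB \<noteq> {}"
      using C(2)[of 0] by (auto simp: BB_def intro!: exI[of _ 0])
  qed
  have "\<exists>k. \<forall>x y. (\<forall>i<k. x \<in> from_nat_into BB i \<longleftrightarrow> y \<in> from_nat_into BB i) \<longrightarrow> dist x y < e"
    if "0 < e" for e
  proof -
    obtain j where j: "2 / real (Suc j) < e"
      using \<open>0 < e\<close> reals_Archimedean[of "e / 2"] by (auto simp: field_simps)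
    let ?F = "(\<lambda>x. ball x (1 / real (Suc j))) ` C j"
    have F: "finite ?F" "?F \<subseteq> BB"
      using C(1) by (auto simp: BB_def)
    \<comment> \<open>This exceeds the indices of all balls of radius 1/(j+1) in the cover. Points
      with the same first \<open>k\<close> bits then share such a ball, so their distance is below
      2/(j+1).\<close>
    define k where "k = Suc (Max (insert 0 (to_nat_on BB ` ?F)))"
    have k: "to_nat_on BB S < k" if "S \<in> ?F" for S
      unfolding k_def using that F(1) by (intro le_imp_less_Suc Max_ge) auto
    have "dist x y < e" if xy: "\<forall>i<k. x \<in> from_nat_into BB i \<longleftrightarrow> y \<in> from_nat_into BB i" for x y
    proof -
      obtain c where c: "c \<in> C j" "x \<in> ball c (1 / real (Suc j))"
        using C(2)[of j] by blast
      then have "ball c (1 / real (Suc j)) \<in> BB" "to_nat_on BB (ball c (1 / real (Suc j))) < k"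
        using F(2) by (auto intro: k)
      then have "y \<in> ball c (1 / real (Suc j))"
        using xy c(2) BB(1) by (metis from_nat_into_to_nat_on)
      then have "dist x y < 1 / real (Suc j) + 1 / real (Suc j)"
        using c(2) dist_triangle3[of x y c] by simp
      with j show ?thesis
        by simp
    qed
    then show ?thesis by blast
  qed
  then show ?thesis
    using that by blast
qed

section \<open>Binary codes of points and of branches\<close>

primrec bit_code :: "(nat \<Rightarrow> 'a set) \<Rightarrow> nat \<Rightarrow> 'a \<Rightarrow> bool list" where
  "bit_code B 0 x = []"
| "bit_code B (Suc k) x = (x \<in> B k) # bit_code B k x"

lemma length_bit_code [simp]: "length (bit_code B k x) = k"
  by (induction k) auto

lemma bit_code_eq_iff: "bit_code B k x = bit_code B k y \<longleftrightarrow> (\<forall>i<k. x \<in> B i \<longleftrightarrow> y \<in> B i)"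
  by (induction k) (auto simp: less_Suc_eq)

text \<open>Interval coding: the mass \<open>c s\<close> of a node \<open>s\<close> of the binary tree (a word with the latest bit
  first) is represented by a subinterval of \<open>[0, 1)\<close> of this length.\<close>

primrec tree_left :: "(bool list \<Rightarrow> real) \<Rightarrow> bool list \<Rightarrow> real" where
  "tree_left c [] = 0"
| "tree_left c (b # s) = tree_left c s + (if b then c (False # s) else 0)"

primrec tree_code :: "(bool list \<Rightarrow> real) \<Rightarrow> nat \<Rightarrow> real \<Rightarrow> bool list" where
  "tree_code c 0 x = []"
| "tree_code c (Suc k) x =
     (tree_left c (tree_code c k x) + c (False # tree_code c k x) \<le> x) # tree_code c k x"

lemma length_tree_code [simp]: "length (tree_code c k x) = k"
  by (induction k) auto

lemma tree_code_eq_iff: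
  assumes c: "c [] = 1" "\<And>s. c s = c (True # s) + c (False # s)" "\<And>s. 0 \<le> c s"
    and x: "0 \<le> x" "x < 1"
  shows "tree_code c (length s) x = s \<longleftrightarrow> tree_left c s \<le> x \<and> x < tree_left c s + c s"
proof (induction s)
  case Nil
  then show ?case using x c(1) by simp
next
  case (Cons b s)
  show ?case
  proof (cases "tree_code c (length s) x = s")
    case True
    then show ?thesis
      using Cons c(2)[of s] by auto
  next
    case False
    then show ?thesis
      using Cons c(2)[of s] c(3)[of "True # s"] c(3)[of "False # s"] by auto
  qed
qed

lemma measurable_tree_code: "tree_code c k \<in> borel \<rightarrow>\<^sub>M count_space UNIV"
proof (induction k)
  case (Suc k)
  note [measurable] = Suc
  show ?case
    unfolding tree_code.simps
    by (rule measurable_compose_countable[OF _ Suc]) measurable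
qed simp

text \<open>The limit law is built as the law of a random point. Cell masses converge along a
  subsequence, Lebesgue measure on [0,1) chooses a random branch of the tree with the limit masses,
  and the cells along a branch shrink to a point. A limit point need not lie in the cells that lead
  to it; since a continuous function varies little on a small cell, no condition on the boundaries
  of the cells arises.\<close>

theorem compact_weak_limit:
  fixes \<nu> :: "nat \<Rightarrow> 'a::metric_space pmf"
  assumes cpt: "compact (UNIV :: 'a set)"
  obtains \<mu> :: "'a::metric_space measure" and r :: "nat \<Rightarrow> nat"
  where "prob_space \<mu>" "sets \<mu> = sets borel" "strict_mono r"
    "\<And>f :: 'a \<Rightarrow> real. continuous_on UNIV f \<Longrightarrow>
       (\<lambda>n. measure_pmf.expectation (\<nu> (r n)) f) \<longlonglongrightarrow> integral\<^sup>L \<mu> f"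
proof -
  obtain B :: "nat \<Rightarrow> 'a set"
    where B: "\<And>e. 0 < e \<Longrightarrow> \<exists>k. \<forall>x y. (\<forall>i<k. x \<in> B i \<longleftrightarrow> y \<in> B i) \<longrightarrow> dist x y < e"
    using compact_separating_sets[OF cpt] by blast
  let ?cd = "bit_code B"
  define cn where "cn n s = measure (\<nu> n) {x. ?cd (length s) x = s}" for n s
  have cn01: "0 \<le> cn n s" "cn n s \<le> 1" for n s
    by (auto simp: cn_def)
  have cn_split: "cn n s = cn n (True # s) + cn n (False # s)" for n s
  proof -
    have "{x. ?cd (length s) x = s} = {x. ?cd (length (True # s)) x = True # s} \<union> {x. ?cd (length (False # s)) x = False # s}"
      by auto
    then show ?thesis
      unfolding cn_def by (subst measure_pmf.finite_measure_Union[symmetric]) auto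
  qed
  \<comment> \<open>There are countably many codes and all masses lie in [0,1], so one subsequence
    serves all cells.\<close>
  obtain r where r: "strict_mono (r :: nat \<Rightarrow> nat)" "\<And>s. \<exists>l. (\<lambda>n. cn (r n) s) \<longlonglongrightarrow> l"
  proof (rule function_convergent_subsequence[of "UNIV :: bool list set" cn 1])
    show "norm (cn n s) \<le> 1" for n s
      using cn01[of n s] by simp
  qed auto
  define c where "c s = lim (\<lambda>n. cn (r n) s)" for s
  have lim: "(\<lambda>n. cn (r n) s) \<longlonglongrightarrow> c s" for s
    using r(2)[of s] unfolding c_def by (metis limI)
  have c0: "0 \<le> c s" for s
    using lim by (rule LIMSEQ_le_const) (use cn01 in blast)
  have c_split: "c s = c (True # s) + c (False # s)" for s
    using lim[of s] tendsto_add[OF lim[of "True # s"] lim[of "False # s"]]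
    by (auto simp flip: cn_split intro: LIMSEQ_unique)
  have c_Nil: "c [] = 1"
    using lim[of "[]"] by (auto simp: cn_def LIMSEQ_const_iff)
  \<comment> \<open>A representative of each cell, meaningful only if the cell is nonempty;
    \<open>pt_pos\<close> shows that a positive limit mass guarantees this.\<close>
  define pt where "pt s = (SOME x. ?cd (length s) x = s)" for s
  have pt: "?cd (length s) (pt s) = s" if "?cd (length s) x = s" for s x
    unfolding pt_def using that by (rule someI)
  have pt_pos: "?cd (length s) (pt s) = s" if "0 < c s" for s
  proof (rule ccontr)
    assume "\<not> ?thesis"
    then have "{x. ?cd (length s) x = s} = {}"
      using pt by blast
    then have "cn n s = 0" for n
      by (simp add: cn_def)
    then show False
      using lim[of s] that by (simp add: LIMSEQ_const_iff)
  qed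
  define M where "M = restrict_space lborel {0..<1::real}"
  have space_M: "space M = {0..<1}"
    by (simp add: M_def)
  interpret M: prob_space M
    by (rule prob_spaceI) (simp add: M_def emeasure_restrict_space space_restrict_space)
  have meas_code [measurable]: "tree_code c k \<in> M \<rightarrow>\<^sub>M count_space UNIV" for k
    unfolding M_def by (intro measurable_restrict_space1) (simp add: measurable_tree_code)
  have prob_code: "M.prob {x \<in> space M. tree_code c (length s) x = s} = c s" for s
  proof -
    let ?I = "{tree_left c s ..< tree_left c s + c s}"
    have I: "0 \<le> tree_left c s \<and> tree_left c s + c s \<le> 1"
    proof (induction s)
      case (Cons b s)
      then show ?case
        using c_split[of s] c0[of "True # s"] c0[of "False # s"] by auto
    qed (simp add: c_Nil)
    have "{x \<in> space M. tree_code c (length s) x = s} = ?I"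
      using I tree_code_eq_iff[OF c_Nil c_split c0, of _ s] by (auto simp: space_M)
    moreover have "?I \<subseteq> {0..<1}"
      using I by auto
    ultimately show ?thesis
      using c0[of s] by (simp add: M_def measure_restrict_space)
  qed
  define y where "y k x = pt (tree_code c k x)" for k x
  \<comment> \<open>The branch of \<open>x\<close> never enters a node of mass zero, because
    \<open>x\<close> lies in a half-open interval whose length is the mass.\<close>
  have cd_y: "?cd k (y k x) = tree_code c k x" if "x \<in> space M" for k x
  proof -
    have "0 < c (tree_code c k x)"
      using that tree_code_eq_iff[OF c_Nil c_split c0, of x "tree_code c k x"]
      by (simp add: space_M)
    then show ?thesis
      using pt_pos[of "tree_code c k x"] by (simp add: y_def)
  qed
  \<comment> \<open>Codes list the latest bit first, so dropping bits at the front gives the code of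
    a shorter depth. All later representatives stay in the cell reached at depth
    \<open>k\<close>.\<close>
  have cd_mono: "?cd k (y j x) = tree_code c k x" if "x \<in> space M" "k \<le> j" for k j x
  proof -
    have drop: "drop d (?cd (k + d) z) = ?cd k z" "drop d (tree_code c (k + d) x) = tree_code c k x" for d z
      by (induction d) auto
    show ?thesis
      using drop[of "j - k"] cd_y[OF that(1), of j] that(2) by (metis le_add_diff_inverse)
  qed
  have Cauchy_y: "Cauchy (\<lambda>k. y k x)" if "x \<in> space M" for x
  proof (rule metric_CauchyI)
    fix e :: real assume "0 < e"
    then obtain k where "\<forall>x y. (\<forall>i<k. x \<in> B i \<longleftrightarrow> y \<in> B i) \<longrightarrow> dist x y < e"
      using B by blast
    then show "\<exists>K. \<forall>m\<ge>K. \<forall>n\<ge>K. dist (y m x) (y n x) < e"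
      using cd_mono[OF that, of k] by (metis bit_code_eq_iff)
  qed
  define Y where "Y x = lim (\<lambda>k. y k x)" for x
  have lim_y: "(\<lambda>k. y k x) \<longlonglongrightarrow> Y x" if "x \<in> space M" for x
    using Cauchy_y[OF that] compact_imp_complete[OF cpt] unfolding complete_def Y_def
    by (metis UNIV_I limI)
  have [measurable]: "y k \<in> M \<rightarrow>\<^sub>M borel" for k
    unfolding y_def by measurable
  have meas_Y [measurable]: "Y \<in> M \<rightarrow>\<^sub>M borel"
    by (rule borel_measurable_LIMSEQ_metric[of y]) (use lim_y in auto)
  show thesis
  proof
    show "prob_space (distr M borel Y)"
      by (rule M.prob_space_distr) simp
    show "sets (distr M borel Y) = sets borel" "strict_mono r"
      using r by auto
    fix f :: "'a \<Rightarrow> real" assume f: "continuous_on UNIV f"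
    have [measurable]: "f \<in> borel_measurable borel"
      using f by (rule borel_measurable_continuous_onI)
    have "compact (f ` UNIV)"
      using f cpt by (rule compact_continuous_image)
    then obtain K where K: "\<And>x. \<bar>f x\<bar> \<le> K"
      using compact_imp_bounded bounded_iff by (metis rangeI real_norm_def)
    have int_pmf: "integrable (measure_pmf (\<nu> n)) f" for n
      by (rule measure_pmf.integrable_const_bound[of _ K]) (use K in auto)
    have int_Y: "integrable M (\<lambda>x. f (Y x))"
      by (rule M.integrable_const_bound[of _ K]) (use K in auto)
    have int_y: "integrable M (\<lambda>x. f (y k x))" for k
      by (rule M.integrable_const_bound[of _ K]) (use K in auto)
    have "(\<lambda>n. measure_pmf.expectation (\<nu> (r n)) f) \<longlonglongrightarrow> M.expectation (\<lambda>x. f (Y x))"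
    proof (rule LIMSEQ_I)
      fix e :: real assume "0 < e"
      then obtain d where d: "0 < d" "\<And>x x'. dist x x' < d \<Longrightarrow> \<bar>f x - f x'\<bar> < e / 4"
        using compact_uniformly_continuous[OF f cpt] unfolding uniformly_continuous_on_def
        by (metis UNIV_I dist_real_def zero_less_divide_iff zero_less_numeral)
      obtain k where k: "\<forall>x y. (\<forall>i<k. x \<in> B i \<longleftrightarrow> y \<in> B i) \<longrightarrow> dist x y < d"
        using B d(1) by blast
      have f_close: "\<bar>f x - f x'\<bar> \<le> e / 4" if "?cd k x = ?cd k x'" for x x'
        using d(2)[of x x'] k that unfolding bit_code_eq_iff by (meson less_imp_le)
      let ?S = "{s :: bool list. length s = k}"
      have fin: "finite ?S"
        using finite_lists_length_eq[of "UNIV :: bool set" k] by simp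
      define h where "h n = (\<Sum>s\<in>?S. f (pt s) * cn n s)" for n
      define h' where "h' = (\<Sum>s\<in>?S. f (pt s) * c s)"
      have "(\<lambda>n. h (r n)) \<longlonglongrightarrow> h'"
        unfolding h_def h'_def by (intro tendsto_sum tendsto_mult tendsto_const lim)
      then obtain N where N: "\<And>n. N \<le> n \<Longrightarrow> \<bar>h (r n) - h'\<bar> < e / 4"
        using LIMSEQ_D[of _ h' "e / 4"] \<open>0 < e\<close> by (metis divide_pos_pos real_norm_def zero_less_numeral)
      have 1: "\<bar>measure_pmf.expectation (\<nu> n) f - h n\<bar> \<le> e / 4" for n
      proof -
        have "h n = measure_pmf.expectation (\<nu> n) (\<lambda>x. f (pt (?cd k x)))"
          unfolding h_def cn_def
          by (subst measure_pmf.expectation_finite_range[where S = ?S]) (use fin in auto)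
        moreover have "integrable (measure_pmf (\<nu> n)) (\<lambda>x. f (pt (?cd k x)))"
          by (rule measure_pmf.integrable_const_bound[of _ K]) (use K in auto)
        ultimately have "measure_pmf.expectation (\<nu> n) f - h n =
            measure_pmf.expectation (\<nu> n) (\<lambda>x. f x - f (pt (?cd k x)))"
          using int_pmf by simp
        also have "\<bar>\<dots>\<bar> \<le> measure_pmf.expectation (\<nu> n) (\<lambda>x. \<bar>f x - f (pt (?cd k x))\<bar>)"
          by (rule integral_abs_bound)
        also have "\<dots> \<le> measure_pmf.expectation (\<nu> n) (\<lambda>x. e / 4)"
        proof (rule integral_mono)
          show "integrable (measure_pmf (\<nu> n)) (\<lambda>x. \<bar>f x - f (pt (?cd k x))\<bar>)"
            using int_pmf \<open>integrable (measure_pmf (\<nu> n)) (\<lambda>x. f (pt (?cd k x)))\<close> by auto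
          show "\<bar>f x - f (pt (?cd k x))\<bar> \<le> e / 4" for x
            by (rule f_close) (use pt[of "?cd k x" x] in simp)
        qed simp
        finally show ?thesis
          by simp
      qed
      have 2: "\<bar>M.expectation (\<lambda>x. f (Y x)) - h'\<bar> \<le> e / 4"
      proof -
        have "h' = M.expectation (\<lambda>x. f (y k x))"
          unfolding h'_def y_def
          by (subst M.expectation_finite_range[where S = ?S])
            (use fin prob_code in \<open>auto intro!: sum.cong\<close>)
        then have "M.expectation (\<lambda>x. f (Y x)) - h' = M.expectation (\<lambda>x. f (Y x) - f (y k x))"
          using int_Y int_y by simp
        also have "\<bar>\<dots>\<bar> \<le> M.expectation (\<lambda>x. \<bar>f (Y x) - f (y k x)\<bar>)"
          by (rule integral_abs_bound)
        also have "\<dots> \<le> M.expectation (\<lambda>x. e / 4)"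
        proof (rule integral_mono)
          show "integrable M (\<lambda>x. \<bar>f (Y x) - f (y k x)\<bar>)"
            using int_Y int_y by auto
          fix x assume x: "x \<in> space M"
          have "(\<lambda>j. f (y j x)) \<longlonglongrightarrow> f (Y x)"
            using f lim_y[OF x] by (auto simp: continuous_on_tendsto_compose[of UNIV f])
          then have "(\<lambda>j. \<bar>f (y j x) - f (y k x)\<bar>) \<longlonglongrightarrow> \<bar>f (Y x) - f (y k x)\<bar>"
            by (intro tendsto_intros)
          \<comment> \<open>The bound holds for all later representatives, which share a cell with
            \<open>y k x\<close>, and passes to \<open>Y x\<close> even if that point has left the
            cell.\<close>
          moreover have "\<forall>j\<ge>k. \<bar>f (y j x) - f (y k x)\<bar> \<le> e / 4"
            using cd_mono[OF x, of k] by (intro allI impI f_close) simp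
          ultimately show "\<bar>f (Y x) - f (y k x)\<bar> \<le> e / 4"
            using LIMSEQ_le_const2 by blast
        qed simp
        finally show ?thesis
          by (simp add: M.prob_space)
      qed
      have "\<bar>measure_pmf.expectation (\<nu> (r n)) f - M.expectation (\<lambda>x. f (Y x))\<bar> < e" if "N \<le> n" for n
        using N[OF that] 1[of "r n"] 2 \<open>0 < e\<close> by linarith
      then show "\<exists>N. \<forall>n\<ge>N. norm (measure_pmf.expectation (\<nu> (r n)) f - M.expectation (\<lambda>x. f (Y x))) < e"
        by (auto intro!: exI[of _ N])
    qed
    also have "M.expectation (\<lambda>x. f (Y x)) = integral\<^sup>L (distr M borel Y) f"
      by (simp add: integral_distr)
    finally show "(\<lambda>n. measure_pmf.expectation (\<nu> (r n)) f) \<longlonglongrightarrow> integral\<^sup>L (distr M borel Y) f" .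
  qed
qed

section \<open>The compact space of paintboxes\<close>

lemma dist_paintbox_le:
  assumes "0 < \<theta>" "mutually_close \<theta> (unit_compl (up_set P)) (unit_compl (up_set Q))"
    "mutually_close \<theta> (unit_compl (down_set P)) (unit_compl (down_set Q))"
  shows "dist P Q \<le> \<theta>"
  unfolding dist_paintbox_def using assms
  by (intro cInf_lower bdd_belowI[of _ 0]) (auto simp: close_paintboxes_def)

lemma dist_paintbox_less:
  assumes "dist P Q < e"
  obtains \<theta> where "\<theta> < e" "mutually_close \<theta> (unit_compl (up_set P)) (unit_compl (up_set Q))"
    "mutually_close \<theta> (unit_compl (down_set P)) (unit_compl (down_set Q))"
proof -
  have "2 \<in> close_paintboxes P Q"
    by (simp add: close_paintboxes_def mutually_close_2 paintbox_props)
  then have "close_paintboxes P Q \<noteq> {}"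
    by blast
  from cInf_lessD[OF this] assms that show thesis
    unfolding dist_paintbox_def close_paintboxes_def by blast
qed

lemma paintbox_side:
  assumes "S \<in> {up_set, down_set}"
  shows "open (S P)" "S P \<subseteq> {0<..<1}"
    and "dist P Q < e \<Longrightarrow> \<exists>\<theta><e. mutually_close \<theta> (unit_compl (S P)) (unit_compl (S Q))"
  using assms paintbox_props[of P] by (auto elim: dist_paintbox_less)

lemma mutually_close_mem:
  assumes "mutually_close \<theta> A B" "\<theta> < e" "b \<in> B"
  shows "\<exists>a\<in>A. dist a b < e"
  using assms by (force simp: mutually_close_def neighbourhood_def)

lemma hausdorff_contains_Icc:
  assumes "mutually_close \<theta> (unit_compl U) (unit_compl V)" "\<theta> < e"
    "(\<Union>x\<in>{a..b}. ball x e) \<subseteq> U" "U \<subseteq> {0<..<1}" "0 < e"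
  shows "{a..b} \<subseteq> V"
proof (rule ccontr)
  assume "\<not> ?thesis"
  then obtain x where x: "x \<in> {a..b}" "x \<notin> V"
    by blast
  moreover have "x \<in> U"
    using assms(3,5) x(1) by force
  ultimately have "x \<in> unit_compl V"
    using assms(4) by (auto simp: unit_compl_def)
  then obtain y where y: "y \<in> unit_compl U" "dist y x < e"
    using mutually_close_mem[OF assms(1,2)] by blast
  then have "y \<in> (\<Union>x\<in>{a..b}. ball x e)"
    using x(1) by (auto simp: dist_commute)
  then have "y \<in> U"
    using assms(3) by blast
  with y show False
    by (auto simp: unit_compl_def)
qed

text \<open>A compact interval inside the open set keeps a positive distance from the complement,
  and complements at small Hausdorff distance cannot reach it. Measurability of the placement rule
  in the paintbox rests on this.\<close>

lemma open_contains_Icc: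
  assumes S: "S \<in> {up_set, down_set}"
  shows "open {P. {a..b} \<subseteq> S P}"
  unfolding open_dist
proof (intro ballI)
  fix P assume "P \<in> {P. {a..b} \<subseteq> S P}"
  then obtain e where e: "0 < e" "(\<Union>x\<in>{a..b}. ball x e) \<subseteq> S P"
    using compact_subset_open_imp_ball_epsilon_subset[OF compact_Icc paintbox_side(1)[OF S]] by blast
  have "{a..b} \<subseteq> S Q" if "dist Q P < e" for Q
    using that e paintbox_side(2,3)[OF S] by (metis dist_commute hausdorff_contains_Icc)
  then show "\<exists>e>0. \<forall>y. dist y P < e \<longrightarrow> y \<in> {P. {a..b} \<subseteq> S P}"
    using e(1) by blast
qed

text \<open>The missing point may move a little in either direction when the paintbox changes, which
  is why \<open>c\<close> has to be strictly inside the interval.\<close>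

lemma eventually_not_contains_Icc:
  assumes S: "S \<in> {up_set, down_set}" and c: "c \<in> {0..1}" "x < c" "c < y" "c \<notin> S P"
  shows "\<forall>\<^sub>F Q in nhds P. \<not> {x..y} \<subseteq> S Q"
proof -
  define e where "e = min (c - x) (y - c)"
  have e: "0 < e" "\<And>z. dist z c < e \<Longrightarrow> z \<in> {x..y}"
    using c by (auto simp: e_def dist_real_def)
  have c_compl: "c \<in> unit_compl (S P)"
    using c(1,4) by (simp add: unit_compl_def)
  have "\<not> {x..y} \<subseteq> S Q" if "dist Q P < e" for Q
  proof -
    obtain \<theta> where "\<theta> < e" "mutually_close \<theta> (unit_compl (S Q)) (unit_compl (S P))"
      using paintbox_side(3)[OF S \<open>dist Q P < e\<close>] by blast
    then obtain z where z: "z \<in> unit_compl (S Q)" "dist z c < e"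
      using mutually_close_mem c_compl by blast
    with e(2)[of z] show ?thesis
      unfolding unit_compl_def by blast
  qed
  then show ?thesis
    unfolding eventually_nhds_metric using e(1) by blast
qed

text \<open>Closed sets are encoded by their distance functions. One inclusion is immediate from
  uniform convergence. For the other, a small value \<open>f x\<close> does not yet give a zero of
  \<open>f\<close> near \<open>x\<close>; the zero is found as an accumulation point of points of
  later sets \<open>A m\<close> that are close to \<open>x\<close>.\<close>

lemma hausdorff_limit:
  fixes A :: "nat \<Rightarrow> real set"
  assumes A: "\<And>n. A n \<subseteq> {0..1}" "\<And>n. A n \<noteq> {}"
    and unif: "\<And>e. 0 < e \<Longrightarrow> \<exists>N. \<forall>n\<ge>N. \<forall>x\<in>{0..1}. \<bar>infdist x (A n) - f x\<bar> < e"
    and \<theta>: "0 < \<theta>"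
  shows "\<forall>\<^sub>F n in sequentially. mutually_close \<theta> {x \<in> {0..1}. f x = 0} (A n)"
proof -
  have near: "\<exists>a\<in>S. dist a x < e" if "infdist x S < e" "S \<noteq> {}" for x e and S :: "real set"
  proof -
    have "bdd_below (dist x ` S)"
      by (rule bdd_belowI2[of _ 0]) simp
    then show ?thesis
      using that cINF_less_iff[of S "dist x" e] by (auto simp: infdist_notempty dist_commute)
  qed
  obtain N where N: "\<And>n x. N \<le> n \<Longrightarrow> x \<in> {0..1} \<Longrightarrow> \<bar>infdist x (A n) - f x\<bar> < \<theta> / 4"
    using unif[of "\<theta> / 4"] \<theta> by (metis zero_less_divide_iff zero_less_numeral)
  have lim: "(\<lambda>n. infdist x (A n)) \<longlonglongrightarrow> f x" if "x \<in> {0..1}" for x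
    using unif that unfolding LIMSEQ_iff real_norm_def by meson
  have "mutually_close \<theta> {x \<in> {0..1}. f x = 0} (A n)" if n: "N \<le> n" for n
    unfolding mutually_close_def neighbourhood_def
  proof (intro conjI subsetI)
    fix x assume "x \<in> {x \<in> {0..1}. f x = 0}"
    then have "infdist x (A n) < \<theta>"
      using N[OF n, of x] \<theta> by auto
    then show "x \<in> (\<Union>a\<in>A n. ball a \<theta>)"
      using near A(2) by auto
  next
    fix x assume x: "x \<in> A n"
    then have x01: "x \<in> {0..1}"
      using A(1) by blast
    have "infdist x (A m) < \<theta> / 2" if "N \<le> m" for m
    proof -
      have "infdist x (A n) = 0"
        using x by simp
      then show ?thesis
        using N[OF n x01] N[OF that x01] by linarith
    qed
    then have "\<exists>a. a \<in> A (N + m) \<and> dist a x < \<theta> / 2" for m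
      using near A(2) by (metis le_add1)
    then obtain a where a: "\<And>m. a m \<in> A (N + m)" "\<And>m. dist (a m) x < \<theta> / 2"
      by metis
    then have "\<forall>m. a m \<in> {0..1}"
      using A(1) by blast
    then obtain l r where l: "l \<in> {0..1}" "strict_mono r" "(a \<circ> r) \<longlonglongrightarrow> l"
      using compact_Icc[of 0 "1 :: real"] unfolding compact_def by metis
    have "dist l x \<le> \<theta> / 2"
    proof (rule tendsto_upperbound)
      show "(\<lambda>m. dist ((a \<circ> r) m) x) \<longlonglongrightarrow> dist l x"
        by (rule tendsto_dist[OF l(3) tendsto_const])
      show "\<forall>\<^sub>F m in sequentially. dist ((a \<circ> r) m) x \<le> \<theta> / 2"
        by (intro always_eventually allI) (simp only: comp_def less_imp_le[OF a(2)])
    qed simp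
    moreover have "f l = 0"
    proof -
      have "strict_mono (\<lambda>m. N + r m)"
        using l(2) by (simp add: strict_mono_def)
      then have "(\<lambda>m. infdist l (A (N + r m))) \<longlonglongrightarrow> f l"
        using LIMSEQ_subseq_LIMSEQ[OF lim[OF l(1)]] by (simp add: comp_def)
      moreover have "(\<lambda>m. infdist l (A (N + r m))) \<longlonglongrightarrow> 0"
      proof (rule tendsto_sandwich[of "\<lambda>_. 0"])
        show "(\<lambda>m. dist l ((a \<circ> r) m)) \<longlonglongrightarrow> 0"
          using tendsto_dist[OF tendsto_const[of l] l(3)] by simp
        show "\<forall>\<^sub>F m in sequentially. infdist l (A (N + r m)) \<le> dist l ((a \<circ> r) m)"
          by (intro always_eventually allI) (simp add: infdist_le[OF a(1)])
      qed (auto simp: infdist_nonneg)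
      ultimately show ?thesis
        using LIMSEQ_unique by blast
    qed
    ultimately show "x \<in> (\<Union>a\<in>{x \<in> {0..1}. f x = 0}. ball a \<theta>)"
      using l(1) \<theta> by (auto intro!: bexI[of _ l])
  qed
  then show ?thesis
    by (auto simp: eventually_sequentially)
qed

text \<open>Distance functions of the complements are 1-Lipschitz and bounded on the unit interval,
  so Arzela-Ascoli applies. Disjointness of the two open sets means that the two complements cover
  the unit interval, a condition that survives the limit.\<close>

lemma compact_UNIV_paintbox: "compact (UNIV :: paintbox set)"
  unfolding compact_def
proof (intro allI impI)
  fix P :: "nat \<Rightarrow> paintbox"
  define A where "A n = unit_compl (up_set (P n))" for n
  define B where "B n = unit_compl (down_set (P n))" for n
  have sub: "A n \<subseteq> {0..1}" "B n \<subseteq> {0..1}" and zero: "0 \<in> A n" "0 \<in> B n" and one: "1 \<in> A n" "1 \<in> B n" for n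
    using paintbox_props(3,4)[of "P n"] by (auto simp: A_def B_def unit_compl_def)
  have ne: "A n \<noteq> {}" "B n \<noteq> {}" for n
    using zero by blast+
  \<comment> \<open>Both distance functions are put into one pair so that a single subsequence works
    for both sets.\<close>
  define F where "F n x = (infdist x (A n), infdist x (B n))" for n x
  obtain g k where g: "continuous_on {0..1} g" and k: "strict_mono (k :: nat \<Rightarrow> nat)"
    and unif: "\<And>e. 0 < e \<Longrightarrow> \<exists>N. \<forall>n x. n \<ge> N \<and> x \<in> {0..1} \<longrightarrow> norm (F (k n) x - g x) < e"
  proof (rule Arzela_Ascoli[of "{0..1}" F 2])
    \<comment> \<open>The point 0 belongs to both complements, so each distance is at most
      1.\<close>
    show "norm (F n x) \<le> 2" if x: "x \<in> {0..1}" for n x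
    proof -
      have "infdist x (A n) \<le> 1" "infdist x (B n) \<le> 1"
        using x infdist_le[OF zero(1)[of n], of x] infdist_le[OF zero(2)[of n], of x] by auto
      then show ?thesis
        unfolding F_def using norm_Pair_le[of "infdist x (A n)" "infdist x (B n)"]
        by (auto simp: infdist_nonneg)
    qed
    show "\<exists>d. 0 < d \<and> (\<forall>n y. y \<in> {0..1} \<and> norm (x - y) < d \<longrightarrow> norm (F n x - F n y) < e)"
      if "0 < e" for x e
    proof (intro exI conjI allI impI)
      show "0 < e / 2"
        using that by simp
      fix n y assume y: "y \<in> {0..1} \<and> norm (x - y) < e / 2"
      have "norm (F n x - F n y) \<le> \<bar>infdist x (A n) - infdist y (A n)\<bar> + \<bar>infdist x (B n) - infdist y (B n)\<bar>"
        unfolding F_def using norm_Pair_le by (metis diff_Pair real_norm_def)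
      also have "\<dots> \<le> dist x y + dist x y"
        by (intro add_mono infdist_triangle_abs)
      finally show "norm (F n x - F n y) < e"
        using y by (simp add: dist_norm)
    qed
  qed auto
  define f where "f x = fst (g x)" for x
  define h where "h x = snd (g x)" for x
  have cont: "continuous_on {0..1} f" "continuous_on {0..1} h"
    unfolding f_def h_def using g by (auto intro: continuous_intros)
  have unif_f: "\<exists>N. \<forall>n\<ge>N. \<forall>x\<in>{0..1}. \<bar>infdist x (A (k n)) - f x\<bar> < e" if "0 < e" for e
  proof -
    have "\<bar>infdist x (A (k n)) - f x\<bar> \<le> norm (F (k n) x - g x)" for n x
      using norm_fst_le[of "fst (F (k n) x - g x)" "snd (F (k n) x - g x)"]
      by (cases "g x") (simp add: F_def f_def)
    then show ?thesis
      using unif[OF that] by (meson le_less_trans)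
  qed
  have unif_h: "\<exists>N. \<forall>n\<ge>N. \<forall>x\<in>{0..1}. \<bar>infdist x (B (k n)) - h x\<bar> < e" if "0 < e" for e
  proof -
    have "\<bar>infdist x (B (k n)) - h x\<bar> \<le> norm (F (k n) x - g x)" for n x
      using norm_snd_le[of "snd (F (k n) x - g x)" "fst (F (k n) x - g x)"]
      by (cases "g x") (simp add: F_def h_def)
    then show ?thesis
      using unif[OF that] by (meson le_less_trans)
  qed
  have lim: "(\<lambda>n. infdist x (A (k n))) \<longlonglongrightarrow> f x" "(\<lambda>n. infdist x (B (k n))) \<longlonglongrightarrow> h x"
    if "x \<in> {0..1}" for x
    using unif_f unif_h that unfolding LIMSEQ_iff real_norm_def by meson+
  let ?A = "{x \<in> {0..1}. f x = 0}" and ?B = "{x \<in> {0..1}. h x = 0}"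
  have ends: "0 \<in> ?A" "1 \<in> ?A" "0 \<in> ?B" "1 \<in> ?B"
    using lim[of 0] lim[of 1] zero one by (auto simp: LIMSEQ_const_iff)
  have closed: "closed ?A" "closed ?B"
    by (intro continuous_closed_preimage_constant cont closed_atLeastAtMost)+
  \<comment> \<open>If both limit distances were positive at \<open>x\<close>, then for large n the
    point \<open>x\<close> would avoid both complements and lie in two disjoint sets.\<close>
  have cover: "x \<in> ?A \<or> x \<in> ?B" if x: "x \<in> {0..1}" for x
  proof (rule ccontr)
    assume "\<not> ?thesis"
    then have "f x \<noteq> 0" "h x \<noteq> 0"
      using x by auto
    then have "\<forall>\<^sub>F n in sequentially. infdist x (A (k n)) \<noteq> 0 \<and> infdist x (B (k n)) \<noteq> 0"
      by (intro eventually_conj tendsto_imp_eventually_ne[OF lim(1)[OF x]] tendsto_imp_eventually_ne[OF lim(2)[OF x]])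
    then obtain n where "infdist x (A (k n)) \<noteq> 0" "infdist x (B (k n)) \<noteq> 0"
      by (auto simp: eventually_sequentially)
    then have "x \<notin> A (k n)" "x \<notin> B (k n)"
      by auto
    then show False
      using x paintbox_props(5)[of "P (k n)"] by (auto simp: A_def B_def unit_compl_def)
  qed
  define Q where "Q = Abs_paintbox ({0<..<1} - ?A, {0<..<1} - ?B)"
  have "({0<..<1} - ?A) \<inter> ({0<..<1} - ?B) = {}"
  proof -
    have False if "x \<in> {0<..<1}" "x \<notin> ?A" "x \<notin> ?B" for x
      using cover[of x] that by simp
    then show ?thesis
      by blast
  qed
  then have "Rep_paintbox Q = ({0<..<1} - ?A, {0<..<1} - ?B)"
    unfolding Q_def
    by (intro Abs_paintbox_inverse CollectI case_prodI conjI open_Diff closed open_greaterThanLessThan Diff_subset)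
  then have "unit_compl (up_set Q) = {0..1} - ({0<..<1} - ?A)" "unit_compl (down_set Q) = {0..1} - ({0<..<1} - ?B)"
    by (simp_all add: up_set_def down_set_def unit_compl_def)
  moreover have "{0..1} - ({0<..<1} - X) = X" if "X \<subseteq> {0..1}" "0 \<in> X" "1 \<in> X" for X :: "real set"
    using that by (auto simp: less_le)
  from this[of ?A] this[of ?B] ends have "{0..1} - ({0<..<1} - ?A) = ?A" "{0..1} - ({0<..<1} - ?B) = ?B"
    by (simp_all only: Collect_restrict)
  ultimately have Q: "unit_compl (up_set Q) = ?A" "unit_compl (down_set Q) = ?B"
    by (simp_all only:)
  have "(P \<circ> k) \<longlonglongrightarrow> Q"
    unfolding tendsto_iff
  proof (intro allI impI)
    fix e :: real assume e: "0 < e"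
    have "\<forall>\<^sub>F n in sequentially. mutually_close (e / 2) ?A (A (k n))"
      by (intro hausdorff_limit unif_f sub ne) (use e in auto)
    moreover have "\<forall>\<^sub>F n in sequentially. mutually_close (e / 2) ?B (B (k n))"
      by (intro hausdorff_limit unif_h sub ne) (use e in auto)
    ultimately show "\<forall>\<^sub>F n in sequentially. dist ((P \<circ> k) n) Q < e"
    proof eventually_elim
      case (elim n)
      then have "dist Q (P (k n)) \<le> e / 2"
        using e by (intro dist_paintbox_le) (simp_all add: Q A_def B_def)
      then show ?case
        using e by (simp add: dist_commute)
    qed
  qed
  then show "\<exists>l\<in>UNIV. \<exists>r. strict_mono r \<and> (P \<circ> r) \<longlonglongrightarrow> l"
    using k by blast
qed

lemma connected_component_real_iff:
  fixes x y :: real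
  shows "connected_component S x y \<longleftrightarrow> {min x y..max x y} \<subseteq> S"
proof
  assume "connected_component S x y"
  then obtain T where "connected T" "T \<subseteq> S" "x \<in> T" "y \<in> T"
    by (auto simp: connected_component_def)
  then show "{min x y..max x y} \<subseteq> S"
    using connected_contains_Icc[of T x y] connected_contains_Icc[of T y x]
    by (auto simp: min_def max_def split: if_splits)
next
  assume "{min x y..max x y} \<subseteq> S"
  then show "connected_component S x y"
    unfolding connected_component_def by (intro exI[of _ "{min x y..max x y}"]) auto
qed

text \<open>Attach to a left endpoint \<open>x\<close> a rational \<open>q\<close> with
  \<open>{x<..q}\<close> inside \<open>S\<close>. Two left endpoints cannot share \<open>q\<close>,
  since the larger one would belong to \<open>S\<close>. Right endpoints are symmetric.\<close>

lemma countable_gap_endpoints: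
  fixes S :: "real set"
  shows "countable {x. x \<notin> S \<and> (\<exists>y>x. {x<..<y} \<subseteq> S)}" "countable {y. y \<notin> S \<and> (\<exists>x<y. {x<..<y} \<subseteq> S)}"
proof -
  have at_most_one: "countable T" if "\<And>x y. x \<in> T \<Longrightarrow> y \<in> T \<Longrightarrow> x = y" for T :: "real set"
    using that by (metis countable_empty countable_insert is_singletonI' is_singleton_def)
  have "countable (\<Union>q\<in>\<rat>. {x. x \<notin> S \<and> x < q \<and> {x<..q} \<subseteq> S})"
  proof (intro countable_UN countable_rat at_most_one)
    fix q x y assume "x \<in> {x. x \<notin> S \<and> x < q \<and> {x<..q} \<subseteq> S}" "y \<in> {x. x \<notin> S \<and> x < q \<and> {x<..q} \<subseteq> S}"
    then show "x = y"
      by (cases x y rule: linorder_cases) (auto simp: subset_iff)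
  qed
  moreover have "{x. x \<notin> S \<and> (\<exists>y>x. {x<..<y} \<subseteq> S)} \<subseteq> (\<Union>q\<in>\<rat>. {x. x \<notin> S \<and> x < q \<and> {x<..q} \<subseteq> S})"
  proof clarify
    fix x y assume "x \<notin> S" "x < y" "{x<..<y} \<subseteq> S"
    moreover then obtain q where "q \<in> \<rat>" "x < q" "q < y"
      using Rats_dense_in_real by blast
    ultimately show "x \<in> (\<Union>q\<in>\<rat>. {x. x \<notin> S \<and> x < q \<and> {x<..q} \<subseteq> S})"
      by (auto simp: subset_iff)
  qed
  ultimately show "countable {x. x \<notin> S \<and> (\<exists>y>x. {x<..<y} \<subseteq> S)}"
    by (rule countable_subset[rotated])
  have "countable (\<Union>q\<in>\<rat>. {y. y \<notin> S \<and> q < y \<and> {q..<y} \<subseteq> S})"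
  proof (intro countable_UN countable_rat at_most_one)
    fix q x y assume "x \<in> {y. y \<notin> S \<and> q < y \<and> {q..<y} \<subseteq> S}" "y \<in> {y. y \<notin> S \<and> q < y \<and> {q..<y} \<subseteq> S}"
    then show "x = y"
      by (cases x y rule: linorder_cases) (auto simp: subset_iff)
  qed
  moreover have "{y. y \<notin> S \<and> (\<exists>x<y. {x<..<y} \<subseteq> S)} \<subseteq> (\<Union>q\<in>\<rat>. {y. y \<notin> S \<and> q < y \<and> {q..<y} \<subseteq> S})"
  proof clarify
    fix x y assume "y \<notin> S" "x < y" "{x<..<y} \<subseteq> S"
    moreover then obtain q where "q \<in> \<rat>" "x < q" "q < y"
      using Rats_dense_in_real by blast
    ultimately show "y \<in> (\<Union>q\<in>\<rat>. {y. y \<notin> S \<and> q < y \<and> {q..<y} \<subseteq> S})"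
      by (auto simp: subset_iff)
  qed
  ultimately show "countable {y. y \<notin> S \<and> (\<exists>x<y. {x<..<y} \<subseteq> S)}"
    by (rule countable_subset[rotated])
qed

section \<open>Paintbox probabilities\<close>

abbreviation "uniform01 \<equiv> uniform_measure lborel {0..1::real}"

lemma prob_space_uniform01: "prob_space uniform01"
  by (rule prob_space_uniform_measure) auto

lemma prob_space_uniform_PiM: "prob_space (PiM I (\<lambda>_. uniform01))"
  by (intro prob_space_PiM prob_space_uniform01)

lemma prob_space_uniform_sample: "prob_space uniform_sample"
  unfolding uniform_sample_def by (rule prob_space_uniform_PiM)

lemma measurable_uniform_sample [measurable]: "1 \<le> i \<Longrightarrow> (\<lambda>\<xi>. \<xi> i) \<in> borel_measurable uniform_sample"
  unfolding uniform_sample_def using measurable_component_singleton[of i "{1..}" "\<lambda>_. uniform01"]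
  by (simp cong: measurable_cong_sets)

lemma AE_uniform_sample:
  assumes "1 \<le> i" "AE x in uniform01. Q x"
  shows "AE \<xi> in uniform_sample. Q (\<xi> i)"
  unfolding uniform_sample_def
  by (rule AE_PiM_component) (use assms prob_space_uniform01 in auto)

lemma AE_uniform01_range: "AE x in uniform01. x \<in> {0..1}"
  by (intro AE_uniform_measureI) auto

lemma AE_uniform01_countable:
  assumes "countable C"
  shows "AE x in uniform01. x \<notin> C"
proof (intro AE_uniform_measureI)
  show "AE x in lborel. x \<in> {0..1} \<longrightarrow> x \<notin> C"
    using AE_not_in[OF countable_imp_null_set_lborel[OF assms]] by eventually_elim auto
qed simp

lemma nn_integral_uniform_sample_insert:
  assumes "1 \<le> i" "f \<in> borel_measurable uniform_sample"
  shows "(\<integral>\<^sup>+\<xi>. f \<xi> \<partial>uniform_sample) =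
    (\<integral>\<^sup>+x. (\<integral>\<^sup>+X. f (X(i := x)) \<partial>(PiM ({1..} - {i}) (\<lambda>_. uniform01))) \<partial>uniform01)"
proof -
  let ?R = "PiM ({1..} - {i}) (\<lambda>_. uniform01)"
  interpret R: prob_space ?R
    by (rule prob_space_uniform_PiM)
  have ins: "insert i ({1..} - {i}) = {1..}"
    using assms(1) by auto
  have U: "uniform_sample = distr (uniform01 \<Otimes>\<^sub>M ?R) uniform_sample (\<lambda>(x, X). X(i := x))"
    unfolding uniform_sample_def
    using distr_pair_PiM_eq_PiM[of "{1..} - {i}" "\<lambda>_. uniform01" i] prob_space_uniform01 ins by simp
  have meas: "(\<lambda>(x, X). X(i := x)) \<in> uniform01 \<Otimes>\<^sub>M ?R \<rightarrow>\<^sub>M uniform_sample"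
    unfolding uniform_sample_def
    using measurable_add_dim[of i "{1..} - {i}" "\<lambda>_. uniform01"] ins
    by (subst measurable_pair_swap_iff) simp
  have "(\<integral>\<^sup>+\<xi>. f \<xi> \<partial>uniform_sample) = (\<integral>\<^sup>+z. f ((\<lambda>(x, X). X(i := x)) z) \<partial>(uniform01 \<Otimes>\<^sub>M ?R))"
    by (subst U, rule nn_integral_distr[OF meas]) (use assms(2) in simp)
  also have "\<dots> = (\<integral>\<^sup>+x. (\<integral>\<^sup>+X. f ((\<lambda>(x, X). X(i := x)) (x, X)) \<partial>?R) \<partial>uniform01)"
    by (rule R.nn_integral_fst[symmetric]) (rule measurable_compose[OF meas assms(2)])
  finally show ?thesis
    by simp
qed

text \<open>Condition on the coordinate \<open>i\<close>: given its value, the coordinate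
  \<open>j\<close> almost surely avoids that single point. Countably many pairs remain.\<close>

lemma AE_uniform_sample_inj: "AE \<xi> in uniform_sample. inj_on \<xi> {1..}"
proof -
  interpret prob_space uniform_sample
    by (rule prob_space_uniform_sample)
  have "AE \<xi> in uniform_sample. \<xi> i \<noteq> \<xi> j" if ij: "1 \<le> i" "1 \<le> j" "i \<noteq> j" for i j
  proof -
    have [measurable]: "{\<xi> \<in> space uniform_sample. \<xi> i = \<xi> j} \<in> events"
      using ij(1,2) by measurable
    have "emeasure uniform_sample {\<xi> \<in> space uniform_sample. \<xi> i = \<xi> j} =
        (\<integral>\<^sup>+\<xi>. indicator {0} (\<xi> i - \<xi> j) \<partial>uniform_sample)"
    proof -
      have "emeasure uniform_sample {\<xi> \<in> space uniform_sample. \<xi> i = \<xi> j} =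
          (\<integral>\<^sup>+\<xi>. indicator {\<xi> \<in> space uniform_sample. \<xi> i = \<xi> j} \<xi> \<partial>uniform_sample)"
        by simp
      also have "\<dots> = (\<integral>\<^sup>+\<xi>. indicator {0} (\<xi> i - \<xi> j) \<partial>uniform_sample)"
        by (intro nn_integral_cong) (auto simp: indicator_def)
      finally show ?thesis .
    qed
    also have "\<dots> = (\<integral>\<^sup>+x. (\<integral>\<^sup>+X. indicator {0} (x - X j) \<partial>(PiM ({1..} - {i}) (\<lambda>_. uniform01))) \<partial>uniform01)"
      by (subst nn_integral_uniform_sample_insert[of i]) (use ij in auto)
    also have "\<dots> = (\<integral>\<^sup>+x. 0 \<partial>uniform01)"
    proof (intro nn_integral_cong)
      fix x :: real
      have "AE X in PiM ({1..} - {i}) (\<lambda>_. uniform01). X j \<noteq> x"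
        using AE_uniform01_countable[of "{x}"] ij
        by (intro AE_PiM_component prob_space_uniform01) auto
      then have "(\<integral>\<^sup>+X. indicator {0} (x - X j) \<partial>(PiM ({1..} - {i}) (\<lambda>_. uniform01))) = (\<integral>\<^sup>+X. 0 \<partial>(PiM ({1..} - {i}) (\<lambda>_. uniform01)))"
        by (intro nn_integral_cong_AE) (auto simp: indicator_def elim!: eventually_mono)
      then show "(\<integral>\<^sup>+X. indicator {0} (x - X j) \<partial>(PiM ({1..} - {i}) (\<lambda>_. uniform01))) = 0"
        by simp
    qed
    finally show ?thesis
      by (simp add: AE_iff_measurable[OF _ refl])
  qed
  then have "AE \<xi> in uniform_sample. \<forall>i j. 1 \<le> i \<longrightarrow> 1 \<le> j \<longrightarrow> i \<noteq> j \<longrightarrow> \<xi> i \<noteq> \<xi> j"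
    by (simp add: AE_all_countable)
  then show ?thesis
    by eventually_elim (auto simp: inj_on_def)
qed

text \<open>In an open set, the closed interval spanned by two of its points can be enlarged to one
  with rational endpoints. The condition thus becomes a countable union of conditions that separate
  the paintbox from the two points, and the paintbox part is open.\<close>

lemma measurable_connected_side:
  assumes S: "S \<in> {up_set, down_set}"
    and [measurable]: "P \<in> N \<rightarrow>\<^sub>M borel" "f \<in> borel_measurable N" "g \<in> borel_measurable N"
  shows "Measurable.pred N (\<lambda>\<omega>. connected_component (S (P \<omega>)) (f \<omega>) (g \<omega>))"
proof -
  have iff: "connected_component T x y \<longleftrightarrow>
      (\<exists>p q :: rat. {real_of_rat p..real_of_rat q} \<subseteq> T \<and> real_of_rat p \<le> min x y \<and> max x y \<le> real_of_rat q)" if "open T" for T and x y :: real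
  proof
    assume "connected_component T x y"
    then have sub: "{min x y..max x y} \<subseteq> T"
      by (simp add: connected_component_real_iff)
    then have "min x y \<in> T" "max x y \<in> T"
      by auto
    then obtain d e where d: "0 < d" "ball (min x y) d \<subseteq> T" and e: "0 < e" "ball (max x y) e \<subseteq> T"
      using \<open>open T\<close> by (meson openE)
    have "min x y - d < min x y" "max x y < max x y + e"
      using d(1) e(1) by linarith+
    then obtain a b where a: "a \<in> \<rat>" "min x y - d < a" "a < min x y"
      and b: "b \<in> \<rat>" "max x y < b" "b < max x y + e"
      using Rats_dense_in_real by meson
    have "{a..b} \<subseteq> T"
    proof
      fix z assume "z \<in> {a..b}"
      then have "z \<in> {min x y..max x y} \<or> z \<in> ball (min x y) d \<or> z \<in> ball (max x y) e"
        using a b unfolding mem_ball dist_real_def atLeastAtMost_iff by linarith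
      then show "z \<in> T"
        using sub d(2) e(2) by blast
    qed
    then show "\<exists>p q :: rat. {real_of_rat p..real_of_rat q} \<subseteq> T \<and> real_of_rat p \<le> min x y \<and> max x y \<le> real_of_rat q"
      using a b unfolding Rats_def by (metis imageE less_imp_le)
  next
    assume "\<exists>p q :: rat. {real_of_rat p..real_of_rat q} \<subseteq> T \<and> real_of_rat p \<le> min x y \<and> max x y \<le> real_of_rat q"
    then obtain p q :: rat where "{real_of_rat p..real_of_rat q} \<subseteq> T" "real_of_rat p \<le> min x y" "max x y \<le> real_of_rat q"
      by blast
    moreover from this have "{min x y..max x y} \<subseteq> {real_of_rat p..real_of_rat q}"
      by (simp only: atLeastatMost_subset_iff) simp
    ultimately show "connected_component T x y"
      unfolding connected_component_real_iff by blast
  qed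
  have [measurable]: "Measurable.pred N (\<lambda>\<omega>. {a..b} \<subseteq> S (P \<omega>))" for a b
  proof -
    have [measurable]: "{P. {a..b} \<subseteq> S P} \<in> sets borel"
      using open_contains_Icc[OF S] by auto
    have "Measurable.pred N (\<lambda>\<omega>. P \<omega> \<in> {P. {a..b} \<subseteq> S P})"
      by measurable
    then show ?thesis
      by simp
  qed
  show ?thesis
    unfolding iff[OF paintbox_side(1)[OF S]] by measurable
qed

lemmas measurable_connected_component [measurable] =
  measurable_connected_side[of up_set, simplified] measurable_connected_side[of down_set, simplified]

lemma measurable_placed_left [measurable (raw)]:
  assumes [measurable]: "P \<in> N \<rightarrow>\<^sub>M borel" "(\<lambda>\<omega>. \<xi> \<omega> i) \<in> borel_measurable N" "(\<lambda>\<omega>. \<xi> \<omega> j) \<in> borel_measurable N"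
  shows "Measurable.pred N (\<lambda>\<omega>. placed_left (P \<omega>) (\<xi> \<omega>) i j)"
  unfolding placed_left_def connected_component_up_down by measurable

lemma measurable_sorted_placed_left:
  assumes "P \<in> N \<rightarrow>\<^sub>M borel" "\<And>i. i \<in> set w \<Longrightarrow> (\<lambda>\<omega>. \<xi> \<omega> i) \<in> borel_measurable N"
  shows "Measurable.pred N (\<lambda>\<omega>. sorted_wrt (placed_left (P \<omega>) (\<xi> \<omega>)) w)"
  using assms(2)
proof (induction w)
  case (Cons i w)
  note [measurable] = assms(1)
  have [measurable]: "Measurable.pred N (\<lambda>\<omega>. sorted_wrt (placed_left (P \<omega>) (\<xi> \<omega>)) w)"
    using Cons by simp
  have "Measurable.pred N (\<lambda>\<omega>. \<forall>j\<in>set w. placed_left (P \<omega>) (\<xi> \<omega>) i j)"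
    by (intro pred_intros_finite measurable_placed_left assms(1) Cons.prems) auto
  then show ?case
    by simp
qed simp

lemma paintbox_arrangement_eq_iff:
  assumes "inj_on \<xi> {1..}" "1 \<le> n" "w \<in> perms n"
  shows "paintbox_arrangement P \<xi> n = w \<longleftrightarrow> sorted_wrt (placed_left P \<xi>) w"
proof -
  have inj: "inj_on \<xi> {1..n}"
    using assms(1) by (rule inj_on_subset) auto
  have *: "(\<forall>i\<in>{1..n}. \<forall>j\<in>{1..n}. i \<noteq> j \<longrightarrow> (left_of w i j \<longleftrightarrow> placed_left P \<xi> i j)) \<longleftrightarrow>
      sorted_wrt (placed_left P \<xi>) w"
    by (rule left_of_iff_sorted_wrt)
      (use assms(3) placed_left_order(1,2)[OF inj] in \<open>auto simp: permutations_of_set_def\<close>)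
  have eq: "paintbox_arrangement P \<xi> n = (THE w. w \<in> perms n \<and>
          (\<forall>i\<in>{1..n}. \<forall>j\<in>{1..n}. i \<noteq> j \<longrightarrow> (left_of w i j \<longleftrightarrow> placed_left P \<xi> i j)))"
    using assms(1,2) by (simp add: paintbox_arrangement_def)
  show ?thesis
    unfolding *[symmetric] eq
    using ex1_paintbox_word[OF assms(1), of n P] assms(3)
      theI'[OF ex1_paintbox_word[OF assms(1), of n P]] by blast
qed

lemma ex1_placed_left_word:
  assumes "inj_on \<xi> {1..}" "finite S" "S \<subseteq> {1..}"
  shows "\<exists>!w. w \<in> permutations_of_set S \<and> sorted_wrt (placed_left P \<xi>) w"
proof -
  have inj: "inj_on \<xi> S"
    using assms by (blast intro: inj_on_subset)
  have "\<exists>!w. set w = S \<and> distinct w \<and> sorted_wrt (placed_left P \<xi>) w"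
    by (rule ex1_sorted_wrt) (use assms(2) placed_left_order[OF inj] in blast)+
  then show ?thesis
    by (simp add: permutations_of_set_def conj_assoc)
qed

text \<open>For a permutation of {1..n} this is the probability that the arrangement at level n is
  \<open>w\<close>. Stating it with \<open>sorted_wrt\<close> gives it a meaning for words over any
  finite set of positive labels, which shuffles and shifts require.\<close>

definition paintbox_prob :: "paintbox \<Rightarrow> nat list \<Rightarrow> real" where
  "paintbox_prob P w =
     measure uniform_sample {\<xi> \<in> space uniform_sample. sorted_wrt (placed_left P \<xi>) w}"

lemma sorted_placed_left_event [measurable]:
  assumes "set w \<subseteq> {1..}"
  shows "{\<xi> \<in> space uniform_sample. sorted_wrt (placed_left P \<xi>) w} \<in> sets uniform_sample"
proof -
  have "Measurable.pred uniform_sample (\<lambda>\<xi>. sorted_wrt (placed_left P \<xi>) w)"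
    by (rule measurable_sorted_placed_left) (use assms in auto)
  then show ?thesis
    by (rule predE)
qed

text \<open>\<open>placed_left\<close> is transitive, so only neighbouring letters need comparing,
  and for them the outcome depends on the two sample points and on which label is larger, hence only
  on the ascents.\<close>

lemma sorted_placed_left_transfer:
  assumes "length u = length w" "distinct u" "distinct w" "ascents u = ascents w"
    and "\<And>k. k < length u \<Longrightarrow> X (u ! k) = \<xi> (w ! k)"
  shows "sorted_wrt (placed_left P X) u \<longleftrightarrow> sorted_wrt (placed_left P \<xi>) w"
proof -
  have trans: "transp (placed_left P Y)" for Y
    using placed_left_order(3)[OF inj_on_empty] by (auto simp: transp_def)
  have asc: "(u ! k < u ! Suc k) = (w ! k < w ! Suc k)" if "Suc k < length u" for k
    using assms(1,4) that by (simp add: ascents_eq_iff)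
  have neq: "u ! k \<noteq> u ! Suc k" "w ! k \<noteq> w ! Suc k" if "Suc k < length u" for k
    using assms(1-3) that by (simp_all add: nth_eq_iff_index_eq)
  have "(u ! Suc k < u ! k) = (w ! Suc k < w ! k)" if "Suc k < length u" for k
    using asc[OF that] neq[OF that] by linarith
  then show ?thesis
    using assms(1,5) asc by (simp add: sorted_wrt_iff_nth_Suc_transp[OF trans] placed_left_def)
qed

text \<open>Sending the k-th letter of \<open>u\<close> to the k-th letter of another word
  \<open>v\<close> is an injection of coordinates, and reindexing independent uniform coordinates
  along an injection preserves their law. Both probabilities are compared with one on the
  coordinates in \<open>u\<close>.\<close>

lemma paintbox_prob_cong:
  assumes "zs u = zs w" "distinct u" "distinct w" "set u \<subseteq> {1..}" "set w \<subseteq> {1..}"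
  shows "paintbox_prob P u = paintbox_prob P w"
proof -
  let ?I = "set u" and ?N = "PiM (set u) (\<lambda>_. uniform01)"
  have len: "length u = length w" "ascents u = ascents w"
    using assms(1) by (auto simp: zs_eq_iff)
  have main: "paintbox_prob P v = measure ?N {X \<in> space ?N. sorted_wrt (placed_left P X) u}"
    if v: "length u = length v" "ascents u = ascents v" "distinct v" "set v \<subseteq> {1..}" for v
  proof -
    define f where "f i = v ! inv_into {..<length u} ((!) u) i" for i
    have f: "f (u ! k) = v ! k" if "k < length u" for k
      unfolding f_def using that assms(2)
      by (subst inv_into_f_f) (auto simp: inj_on_def nth_eq_iff_index_eq)
    have "inj_on f ?I"
      using f v(1,3) by (auto simp: inj_on_def in_set_conv_nth nth_eq_iff_index_eq)
    moreover have f_in: "f \<in> ?I \<rightarrow> {1..}"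
    proof
      fix i assume "i \<in> ?I"
      then obtain k where "k < length u" "i = u ! k"
        by (metis in_set_conv_nth)
      then have "f i \<in> set v"
        using f v(1) by simp
      then show "f i \<in> {1..}"
        using v(4) by blast
    qed
    ultimately have N: "?N = distr uniform_sample ?N (\<lambda>\<omega>. \<lambda>n\<in>?I. \<omega> (f n))"
      unfolding uniform_sample_def
      using distr_PiM_reindex[of "{1..}" "\<lambda>_. uniform01" f ?I] prob_space_uniform01 by simp
    have meas: "(\<lambda>\<omega>. \<lambda>n\<in>?I. \<omega> (f n)) \<in> uniform_sample \<rightarrow>\<^sub>M ?N"
      unfolding uniform_sample_def using f_in
      by (intro measurable_restrict measurable_component_singleton) auto
    have "Measurable.pred ?N (\<lambda>X. sorted_wrt (placed_left P X) u)"
    proof (rule measurable_sorted_placed_left)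
      show "(\<lambda>X. X i) \<in> borel_measurable ?N" if "i \<in> set u" for i
        using measurable_component_singleton[OF that, of "\<lambda>_. uniform01"] by (simp cong: measurable_cong_sets)
    qed simp
    then have ev: "{X \<in> space ?N. sorted_wrt (placed_left P X) u} \<in> sets ?N"
      by (rule predE)
    have "measure ?N {X \<in> space ?N. sorted_wrt (placed_left P X) u} =
        measure uniform_sample ((\<lambda>\<omega>. \<lambda>n\<in>?I. \<omega> (f n)) -` {X \<in> space ?N. sorted_wrt (placed_left P X) u} \<inter> space uniform_sample)"
      by (subst N, subst measure_distr[OF meas]) (use ev in auto)
    also have "(\<lambda>\<omega>. \<lambda>n\<in>?I. \<omega> (f n)) -` {X \<in> space ?N. sorted_wrt (placed_left P X) u} \<inter> space uniform_sample =
        {\<xi> \<in> space uniform_sample. sorted_wrt (placed_left P \<xi>) v}"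
    proof -
      have "sorted_wrt (placed_left P (\<lambda>n\<in>?I. \<xi> (f n))) u \<longleftrightarrow> sorted_wrt (placed_left P \<xi>) v" for \<xi>
        by (rule sorted_placed_left_transfer) (use v assms(2) f in auto)
      then show ?thesis
        using measurable_space[OF meas] by auto
    qed
    finally show ?thesis
      by (simp add: paintbox_prob_def)
  qed
  show ?thesis
    using main[of u] main[of w] len assms by simp
qed

definition paintbox_function :: "paintbox \<Rightarrow> zigzag \<Rightarrow> real" where
  "paintbox_function P \<mu> = paintbox_prob P (SOME w. w \<in> perms (zigzag_size \<mu>) \<and> zs w = \<mu>)"

lemma paintbox_function_zs:
  assumes "distinct w" "set w \<subseteq> {1..}"
  shows "paintbox_function P (zs w) = paintbox_prob P w"
proof -
  let ?v = "SOME v. v \<in> perms (zigzag_size (zs w)) \<and> zs v = zs w"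
  have "?v \<in> perms (zigzag_size (zs w)) \<and> zs ?v = zs w"
    by (rule someI_ex) (use exists_perm_zs in blast)
  then show ?thesis
    unfolding paintbox_function_def
    by (intro paintbox_prob_cong) (use assms in \<open>auto simp: permutations_of_set_def\<close>)
qed

text \<open>A sample without ties orders exactly one word on all labels of \<open>A\<close> and
  \<open>B\<close>, and its restrictions are the only words that it orders on \<open>A\<close> and
  on \<open>B\<close>. The two label sets may overlap.\<close>

lemma sum_shuffles_indicator:
  assumes \<xi>: "inj_on \<xi> {1..}" and A: "finite A" "A \<subseteq> {1..}" and B: "finite B" "B \<subseteq> {1..}"
    and u: "u \<in> permutations_of_set A" and v: "v \<in> permutations_of_set B"
  shows "(\<Sum>w | w \<in> permutations_of_set (A \<union> B) \<and> filter (\<lambda>i. i \<in> A) w = u \<and> filter (\<lambda>i. i \<in> B) w = v.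
      of_bool (sorted_wrt (placed_left P \<xi>) w)) =
    (of_bool (sorted_wrt (placed_left P \<xi>) u \<and> sorted_wrt (placed_left P \<xi>) v) :: real)"
    (is "(\<Sum>w\<in>?W. _) = _")
proof -
  let ?R = "sorted_wrt (placed_left P \<xi>)"
  obtain x where x: "x \<in> permutations_of_set (A \<union> B)" "?R x"
    and x_unique: "\<And>w. w \<in> permutations_of_set (A \<union> B) \<Longrightarrow> ?R w \<Longrightarrow> w = x"
  proof -
    have "\<exists>!w. w \<in> permutations_of_set (A \<union> B) \<and> ?R w"
      by (rule ex1_placed_left_word[OF \<xi>]) (use A B in auto)
    then show ?thesis
      using that by blast
  qed
  have filt: "filter (\<lambda>i. i \<in> S) x \<in> permutations_of_set S \<and> ?R (filter (\<lambda>i. i \<in> S) x)" if "S \<subseteq> A \<union> B" for S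
    using x that by (auto simp: permutations_of_set_def intro!: sorted_wrt_filter)
  have "?R u \<longleftrightarrow> filter (\<lambda>i. i \<in> A) x = u" "?R v \<longleftrightarrow> filter (\<lambda>i. i \<in> B) x = v"
    using ex1_placed_left_word[OF \<xi> A, of P] ex1_placed_left_word[OF \<xi> B, of P] filt[of A] filt[of B] u v
    by blast+
  then have iff: "?R u \<and> ?R v \<longleftrightarrow> x \<in> ?W"
    using x by auto
  have fin: "finite ?W"
    using A B by simp
  have "(\<Sum>w\<in>?W. of_bool (?R w)) = (\<Sum>w\<in>?W. if x = w then 1 else (0::real))"
  proof (rule sum.cong[OF refl])
    fix w assume "w \<in> ?W"
    then have "?R w \<longleftrightarrow> x = w"
      using x x_unique[of w] by blast
    then show "of_bool (?R w) = (if x = w then 1 else (0::real))"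
      by simp
  qed
  also have "\<dots> = of_bool (x \<in> ?W)"
    unfolding sum.delta'[OF fin] of_bool_def ..
  finally show ?thesis
    using iff by simp
qed

lemma expectation_of_bool:
  assumes "prob_space M" "{x \<in> space M. Q x} \<in> sets M"
  shows "integrable M (\<lambda>x. of_bool (Q x) :: real)"
    and "(LINT x|M. of_bool (Q x)) = measure M {x \<in> space M. Q x}"
proof -
  interpret prob_space M by fact
  have *: "integrable M (indicator {x \<in> space M. Q x} :: _ \<Rightarrow> real)"
    using assms(2) by (intro integrable_real_indicator) (auto simp: emeasure_eq_measure)
  show "integrable M (\<lambda>x. of_bool (Q x) :: real)"
    by (rule Bochner_Integration.integrable_cong[THEN iffD1, OF refl _ *]) (auto simp: indicator_def)
  have "(LINT x|M. of_bool (Q x)) = (LINT x|M. indicator {x \<in> space M. Q x} x :: real)"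
    by (intro Bochner_Integration.integral_cong) (auto simp: indicator_def)
  also have "\<dots> = measure M {x \<in> space M. Q x}"
    using assms(2) by (simp add: Int_def conj_ac cong: conj_cong)
  finally show "(LINT x|M. of_bool (Q x)) = measure M {x \<in> space M. Q x}" .
qed

lemma sum_shuffles_paintbox_prob:
  assumes A: "finite A" "A \<subseteq> {1..}" and B: "finite B" "B \<subseteq> {1..}"
    and u: "u \<in> permutations_of_set A" and v: "v \<in> permutations_of_set B"
  shows "(\<Sum>w | w \<in> permutations_of_set (A \<union> B) \<and> filter (\<lambda>i. i \<in> A) w = u \<and> filter (\<lambda>i. i \<in> B) w = v.
      paintbox_prob P w) =
    measure uniform_sample {\<xi> \<in> space uniform_sample.
      sorted_wrt (placed_left P \<xi>) u \<and> sorted_wrt (placed_left P \<xi>) v}" (is "(\<Sum>w\<in>?W. _) = _")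
proof -
  note E = expectation_of_bool[OF prob_space_uniform_sample]
  let ?R = "\<lambda>\<xi>. sorted_wrt (placed_left P \<xi>)"
  have ev: "{\<xi> \<in> space uniform_sample. ?R \<xi> w} \<in> sets uniform_sample" if "w \<in> ?W" for w
    using that A B by (intro sorted_placed_left_event) (auto simp: permutations_of_set_def)
  have "{\<xi> \<in> space uniform_sample. ?R \<xi> u} \<inter> {\<xi> \<in> space uniform_sample. ?R \<xi> v} \<in> sets uniform_sample"
    using u v A B by (intro sets.Int sorted_placed_left_event) (auto simp: permutations_of_set_def)
  then have ev2: "{\<xi> \<in> space uniform_sample. ?R \<xi> u \<and> ?R \<xi> v} \<in> sets uniform_sample"
    by (simp add: Int_def conj_ac cong: conj_cong)
  have "(\<Sum>w\<in>?W. paintbox_prob P w) = (\<Sum>w\<in>?W. LINT \<xi>|uniform_sample. of_bool (?R \<xi> w))"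
    unfolding paintbox_prob_def using E(2) ev by (intro sum.cong) auto
  also have "\<dots> = (LINT \<xi>|uniform_sample. (\<Sum>w\<in>?W. of_bool (?R \<xi> w)))"
    by (rule Bochner_Integration.integral_sum[symmetric]) (rule E(1)[OF ev])
  also have "\<dots> = (LINT \<xi>|uniform_sample. of_bool (?R \<xi> u \<and> ?R \<xi> v))"
  proof (rule integral_cong_AE)
    show "AE \<xi> in uniform_sample. (\<Sum>w\<in>?W. of_bool (?R \<xi> w)) = (of_bool (?R \<xi> u \<and> ?R \<xi> v) :: real)"
      by (rule AE_mp[OF AE_uniform_sample_inj], rule AE_I2, rule impI,
          rule sum_shuffles_indicator[OF _ A B u v])
    show "(\<lambda>\<xi>. \<Sum>w\<in>?W. of_bool (?R \<xi> w) :: real) \<in> borel_measurable uniform_sample"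
      by (rule borel_measurable_sum, rule borel_measurable_integrable, rule E(1)[OF ev])
    show "(\<lambda>\<xi>. of_bool (?R \<xi> u \<and> ?R \<xi> v) :: real) \<in> borel_measurable uniform_sample"
      using E(1)[OF ev2] by (rule borel_measurable_integrable)
  qed
  also have "\<dots> = measure uniform_sample {\<xi> \<in> space uniform_sample. ?R \<xi> u \<and> ?R \<xi> v}"
    by (rule E(2)[OF ev2])
  finally show ?thesis .
qed

text \<open>Inserting a letter is shuffling with a one-letter word, which every sample orders;
  harmonicity is therefore an instance of the shuffle identity.\<close>

lemma paintbox_function_harmonic: "paintbox_function P \<in> harmonic_functions"
proof (rule harmonicI)
  interpret prob_space uniform_sample
    by (rule prob_space_uniform_sample)
  show "0 \<le> paintbox_function P \<mu>" for \<mu>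
    by (simp add: paintbox_function_def paintbox_prob_def)
  show "paintbox_function P (zs []) = 1"
    by (simp add: paintbox_function_zs paintbox_prob_def prob_space)
  fix u n assume u: "u \<in> perms n"
  let ?j = "Suc n"
  have du: "distinct u" "set u = {1..n}"
    using u by (auto simp: permutations_of_set_def)
  have W: "{w \<in> permutations_of_set ({1..n} \<union> {?j}). filter (\<lambda>i. i \<in> {1..n}) w = u \<and> filter (\<lambda>i. i \<in> {?j}) w = [?j]} =
      set (insertions ?j u)"
  proof (intro set_eqI)
    fix w
    have eq: "{1..n} \<union> {?j} = {1..Suc n}"
      by auto
    have c: "coherent u w \<longleftrightarrow> filter (\<lambda>i. i \<in> {1..n}) w = u" if "w \<in> perms (Suc n)"
      using coherent_iff_filter[of u w] that du by (auto simp: permutations_of_set_def)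
    have j: "filter (\<lambda>i. i = ?j) w = [?j]" if "w \<in> perms (Suc n)"
    proof -
      have "distinct (filter (\<lambda>i. i = ?j) w)" "set (filter (\<lambda>i. i = ?j) w) = {?j}"
        using that by (auto simp: permutations_of_set_def)
      then show ?thesis
        by (metis card_1_singleton_iff distinct_card empty_iff insertI1 length_Suc_conv_rev
            length_0_conv list.set_intros(1) singletonD append_Nil One_nat_def)
    qed
    show "w \<in> {w \<in> permutations_of_set ({1..n} \<union> {?j}). filter (\<lambda>i. i \<in> {1..n}) w = u \<and> filter (\<lambda>i. i \<in> {?j}) w = [?j]} \<longleftrightarrow>
        w \<in> set (insertions ?j u)"
      unfolding perms_Suc_iff[OF u] eq using c j by auto
  qed
  have "(\<Sum>w\<in>set (insertions ?j u). paintbox_prob P w) = paintbox_prob P u"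
    using sum_shuffles_paintbox_prob[of "{1..n}" "{?j}" u "[?j]" P] u
    unfolding W by (simp add: paintbox_prob_def)
  moreover have "paintbox_function P (zs w) = paintbox_prob P w" if "w \<in> set (insertions ?j u)" for w
    using that perms_Suc_iff[OF u, of w] by (intro paintbox_function_zs) (auto simp: permutations_of_set_def)
  ultimately show "paintbox_function P (zs u) = (\<Sum>w\<in>set (insertions ?j u). paintbox_function P (zs w))"
    using du by (simp add: paintbox_function_zs)
qed

lemma paintbox_prob_mult:
  assumes A: "finite A" "A \<subseteq> {1..}" and B: "finite B" "B \<subseteq> {1..}" and disj: "A \<inter> B = {}"
    and u: "u \<in> permutations_of_set A" and v: "v \<in> permutations_of_set B"
  shows "paintbox_prob P u * paintbox_prob P v =
    (\<Sum>w | w \<in> permutations_of_set (A \<union> B) \<and> filter (\<lambda>i. i \<in> A) w = u \<and> filter (\<lambda>i. i \<in> B) w = v.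
      paintbox_prob P w)"
proof -
  interpret prob_space uniform_sample
    by (rule prob_space_uniform_sample)
  let ?M = "\<lambda>_ :: nat. uniform01"
  have rv: "random_variable (?M i) (\<lambda>\<omega>. \<omega> i)" if "i \<in> {1..}" for i
    using that by (simp add: uniform_sample_def measurable_component_singleton)
  have "indep_vars ?M (\<lambda>i \<omega>. \<omega> i) {1..}"
  proof (subst indep_vars_iff_distr_eq_PiM')
    have "distr uniform_sample (PiM {1..} ?M) (\<lambda>x. \<lambda>i\<in>{1..}. x i) = distr uniform_sample uniform_sample (\<lambda>x. x)"
      by (intro distr_cong) (auto simp: uniform_sample_def space_PiM PiE_def extensional_restrict)
    also have "\<dots> = PiM {1..} ?M"
      by (simp add: distr_id uniform_sample_def)
    also have "\<dots> = (\<Pi>\<^sub>M i\<in>{1..}. distr uniform_sample (?M i) (\<lambda>\<omega>. \<omega> i))"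
      unfolding uniform_sample_def
      by (intro PiM_cong refl distr_PiM_component[symmetric] prob_space_uniform01) auto
    finally show "distr uniform_sample (PiM {1..} ?M) (\<lambda>x. \<lambda>i\<in>{1..}. x i) = (\<Pi>\<^sub>M i\<in>{1..}. distr uniform_sample (?M i) (\<lambda>\<omega>. \<omega> i))" .
  qed (use rv in auto)
  \<comment> \<open>Whether a word is ordered depends on the coordinates of its own letters only,
    and disjoint blocks of independent coordinates are independent.\<close>
  then have indep: "indep_var (PiM A ?M) (\<lambda>\<omega>. restrict (\<lambda>i. \<omega> i) A) (PiM B ?M) (\<lambda>\<omega>. restrict (\<lambda>i. \<omega> i) B)"
    by (rule indep_var_restrict) (use A B disj in auto)
  define E where "E S w = {X \<in> space (PiM S ?M). sorted_wrt (placed_left P X) w}" for S w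
  have sets_E: "E S w \<in> sets (PiM S ?M)" if "set w = S" for S w
  proof -
    have "Measurable.pred (PiM S ?M) (\<lambda>X. sorted_wrt (placed_left P X) w)"
    proof (rule measurable_sorted_placed_left)
      show "(\<lambda>X. X i) \<in> borel_measurable (PiM S ?M)" if "i \<in> set w" for i
        using measurable_component_singleton[of i S ?M] that \<open>set w = S\<close> by (simp cong: measurable_cong_sets)
    qed simp
    then show ?thesis
      unfolding E_def by (rule predE)
  qed
  have vim: "(\<lambda>\<omega>. restrict (\<lambda>i. \<omega> i) S) -` E S w \<inter> space uniform_sample =
      {\<xi> \<in> space uniform_sample. sorted_wrt (placed_left P \<xi>) w}" if "w \<in> permutations_of_set S" "S \<subseteq> {1..}" for S w
  proof -
    have "sorted_wrt (placed_left P (restrict \<xi> S)) w \<longleftrightarrow> sorted_wrt (placed_left P \<xi>) w" for \<xi>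
      by (rule sorted_placed_left_transfer) (use that in \<open>auto simp: permutations_of_set_def\<close>)
    then show ?thesis
      using that(2) by (auto simp: E_def uniform_sample_def space_PiM PiE_iff extensional_def)
  qed
  have "prob ((\<lambda>\<omega>. (restrict (\<lambda>i. \<omega> i) A, restrict (\<lambda>i. \<omega> i) B)) -` (E A u \<times> E B v) \<inter> space uniform_sample) =
      paintbox_prob P u * paintbox_prob P v"
    unfolding paintbox_prob_def vim[OF u A(2), symmetric] vim[OF v B(2), symmetric]
    by (rule indep_varD[OF indep]) (use u v sets_E in \<open>auto simp: permutations_of_set_def\<close>)
  also have "(\<lambda>\<omega>. (restrict (\<lambda>i. \<omega> i) A, restrict (\<lambda>i. \<omega> i) B)) -` (E A u \<times> E B v) \<inter> space uniform_sample =
      {\<xi> \<in> space uniform_sample. sorted_wrt (placed_left P \<xi>) u \<and> sorted_wrt (placed_left P \<xi>) v}"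
    using vim[OF u A(2)] vim[OF v B(2)] by auto
  finally show ?thesis
    using sum_shuffles_paintbox_prob[OF A B u v, of P] by simp
qed

section \<open>Clusters of labels\<close>

abbreviation label_swap :: "nat \<Rightarrow> nat \<Rightarrow> nat \<Rightarrow> nat" where
  "label_swap \<equiv> Transposition.transpose"

lemma inj_transpose: "inj (label_swap a b)"
  by (rule injI) (metis transpose_involutory)

lemma left_of_map_transpose:
  "left_of (map (label_swap a b) w) i j \<longleftrightarrow> left_of w (label_swap a b i) (label_swap a b j)"
proof -
  have "label_swap a b x = y \<longleftrightarrow> x = label_swap a b y" for x y
    by (metis transpose_involutory)
  then have "(x < y \<and> y < length w \<and> map (label_swap a b) w ! x = i \<and> map (label_swap a b) w ! y = j) \<longleftrightarrow>
      (x < y \<and> y < length w \<and> w ! x = label_swap a b i \<and> w ! y = label_swap a b j)" for x y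
    by auto
  then show ?thesis
    by (simp only: left_of_def length_map)
qed

lemma transpose_less_iff:
  assumes "a < b" "x \<noteq> y" "\<not> (x = a \<and> y = b)" "\<not> (x = b \<and> y = a)"
    "\<not> (a < x \<and> x < b)" "\<not> (a < y \<and> y < b)"
  shows "label_swap a b x < label_swap a b y \<longleftrightarrow> x < y"
  by (cases "x = a"; cases "x = b"; cases "y = a"; cases "y = b")
    (use assms in \<open>auto simp: Transposition.transpose_def\<close>)

text \<open>The labels only have to be consecutive among the letters present. Since \<open>e\<close>
  stands between them they are never neighbours, and the exchange alters no other
  comparison.\<close>

lemma zs_map_transpose:
  assumes w: "distinct w" and ab: "a < b" "\<And>x. x \<in> set w \<Longrightarrow> \<not> (a < x \<and> x < b)"
    and sep: "e \<in> set w" "left_of w a e \<and> left_of w e b \<or> left_of w b e \<and> left_of w e a"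
  shows "zs (map (label_swap a b) w) = zs w"
proof (rule zs_eqI)
  fix k assume "Suc k < length (map (label_swap a b) w)"
  then have k: "Suc k < length w"
    by simp
  let ?x = "w ! k" and ?y = "w ! Suc k"
  have nbet: "\<not> (left_of w ?x e \<and> left_of w e ?y)"
  proof
    assume "left_of w ?x e \<and> left_of w e ?y"
    then obtain i j i' j' where "i < j" "j < length w" "w ! i = ?x" "w ! j = e"
      "i' < j'" "j' < length w" "w ! i' = e" "w ! j' = ?y"
      by (auto simp: left_of_def)
    then have "i = k" "j = i'" "j' = Suc k"
      using w k by (auto simp: nth_eq_iff_index_eq)
    then show False
      using \<open>i < j\<close> \<open>i' < j'\<close> by simp
  qed
  have "?x \<noteq> ?y"
    using w k by (simp add: nth_eq_iff_index_eq)
  moreover have "left_of w ?x ?y"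
    unfolding left_of_def using k by (intro exI[of _ k] exI[of _ "Suc k"]) simp
  then have "\<not> (?x = a \<and> ?y = b)" "\<not> (?x = b \<and> ?y = a)"
    using nbet sep(2) left_of_order(2)[OF w, of a b] left_of_order(2)[OF w, of b a]
      left_of_order(4)[OF w, of a e b] left_of_order(4)[OF w, of b e a] by auto
  moreover have "\<not> (a < ?x \<and> ?x < b)" "\<not> (a < ?y \<and> ?y < b)"
    using ab(2) k by simp_all
  ultimately show "map (label_swap a b) w ! k < map (label_swap a b) w ! Suc k \<longleftrightarrow> w ! k < w ! Suc k"
    using k ab(1) by (simp add: transpose_less_iff)
qed simp

lemma map_transpose_permutations:
  assumes "a \<in> S" "b \<in> S" "w \<in> permutations_of_set S"
  shows "map (label_swap a b) w \<in> permutations_of_set S"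
proof -
  have "label_swap a b ` S = S"
    by (rule transpose_image_eq) (use assms(1,2) in simp)
  then show ?thesis
    using assms(3) inj_on_subset[OF inj_transpose subset_UNIV]
    by (auto simp: permutations_of_set_def distinct_map)
qed

lemma map_transpose_involutory: "map (label_swap a b) (map (label_swap a b) w) = w"
  by (simp add: comp_def)

lemma constant_on_if_consecutive:
  fixes q :: "nat \<Rightarrow> 'a"
  assumes "\<And>f g. f \<in> F \<Longrightarrow> g \<in> F \<Longrightarrow> f < g \<Longrightarrow> (\<forall>h\<in>F. \<not> (f < h \<and> h < g)) \<Longrightarrow> q f = q g"
    and "f \<in> F" "g \<in> F"
  shows "q f = q g"
proof -
  have less: "q f = q g" if "f \<in> F" "g \<in> F" "f < g" for f g
    using that
  proof (induction "g - f" arbitrary: f g rule: less_induct)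
    case less
    show ?case
    proof (cases "\<exists>h\<in>F. f < h \<and> h < g")
      case True
      then obtain h where "h \<in> F" "f < h" "h < g"
        by blast
      then have "q f = q h" "q h = q g"
        using less by auto
      then show ?thesis by simp
    next
      case False
      then show ?thesis
        using assms(1) less.prems by blast
    qed
  qed
  then show ?thesis
    using assms(2,3) by (metis linorder_neqE_nat)
qed

definition between :: "nat list \<Rightarrow> nat \<Rightarrow> nat \<Rightarrow> nat \<Rightarrow> bool" where
  "between w x y z \<longleftrightarrow> left_of w x y \<and> left_of w y z \<or> left_of w z y \<and> left_of w y x"

text \<open>If \<open>f\<close> is the only element of \<open>F\<close> between \<open>x\<close> and \<open>z\<close>, then \<open>f\<close> may be exchanged with the
  next element of \<open>F\<close> without changing the shape; hence these disjoint events are equally likely.\<close>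

lemma only_between_prob:
  assumes p: "p \<in> harmonic_functions" and F: "finite F" "f \<in> F" and xz: "x \<noteq> z"
    and sep: "(\<forall>g\<in>F. x < g \<and> z < g) \<or> (\<forall>g\<in>F. g < x \<and> g < z)"
  shows "(\<Sum>w\<in>permutations_of_set (F \<union> {x, z}). of_bool (\<forall>g\<in>F. between w x g z \<longleftrightarrow> g = f) * p (zs w)) \<le> 1 / card F"
proof -
  let ?S = "F \<union> {x, z}"
  let ?W = "permutations_of_set ?S"
  define B where "B f w \<longleftrightarrow> (\<forall>g\<in>F. between w x g z \<longleftrightarrow> g = f)" for f w
  define q where "q f = (\<Sum>w\<in>?W. of_bool (B f w) * p (zs w))" for f
  have xzF: "x \<notin> F" "z \<notin> F"
    using sep by auto
  have consec: "q f = q g" if fg: "f \<in> F" "g \<in> F" "f < g" "\<forall>h\<in>F. \<not> (f < h \<and> h < g)" for f g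
  proof -
    let ?t = "map (label_swap f g)"
    have bij: "bij_betw ?t ?W ?W"
      by (rule bij_betw_byWitness[of _ ?t]) (use fg map_transpose_permutations[of f ?S g] in \<open>auto simp: map_transpose_involutory\<close>)
    have fixed: "label_swap f g x = x" "label_swap f g z = z"
      using xzF fg by (auto simp: Transposition.transpose_def)
    have tF: "label_swap f g h \<in> F" if "h \<in> F" for h
      using that fg by (auto simp: Transposition.transpose_def)
    have B_t: "B g (?t w) \<longleftrightarrow> B f w" for w
    proof -
      have *: "between (?t w) x h z \<longleftrightarrow> between w x (label_swap f g h) z" for h
        by (simp add: between_def left_of_map_transpose fixed)
      have "B g (?t w) \<longleftrightarrow> (\<forall>h\<in>F. between w x (label_swap f g h) z \<longleftrightarrow> label_swap f g h = f)"
        unfolding B_def * by (metis transpose_apply_second transpose_involutory)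
      also have "\<dots> \<longleftrightarrow> B f w"
        unfolding B_def by (metis tF transpose_involutory)
      finally show ?thesis .
    qed
    have zs_t: "zs (?t w) = zs w" if w: "w \<in> ?W" "B f w" for w
    proof -
      have dw: "distinct w" "set w = ?S"
        using w(1) by (auto simp: permutations_of_set_def)
      note ord = left_of_order[OF dw(1)]
      have "between w x f z" "\<not> between w x g z"
        using w(2) fg by (auto simp: B_def)
      \<comment> \<open>The label \<open>f\<close> stands between \<open>x\<close> and
        \<open>z\<close> and \<open>g\<close> does not, so one of these two separates
        \<open>f\<close> from \<open>g\<close>.\<close>
      then have "\<exists>e\<in>{x, z}. left_of w f e \<and> left_of w e g \<or> left_of w g e \<and> left_of w e f"
        using ord(3)[of g x] ord(3)[of g z] ord(4) fg xzF unfolding dw(2) between_def by blast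
      then obtain e where "e \<in> set w" "left_of w f e \<and> left_of w e g \<or> left_of w g e \<and> left_of w e f"
        using dw(2) by auto
      moreover have "\<not> (f < h \<and> h < g)" if "h \<in> set w" for h
        using that fg sep unfolding dw(2) by force
      ultimately show ?thesis
        using zs_map_transpose[OF dw(1) fg(3)] by blast
    qed
    have "q g = (\<Sum>w\<in>?W. of_bool (B g (?t w)) * p (zs (?t w)))"
      unfolding q_def by (rule sum.reindex_bij_betw[OF bij, symmetric])
    also have "\<dots> = q f"
      unfolding q_def B_t using zs_t by (intro sum.cong) auto
    finally show ?thesis by simp
  qed
  have const: "q g = q f" if "g \<in> F" for g
    by (rule constant_on_if_consecutive[of F q]) (use consec that F(2) in auto)
  have "real (card F) * q f = (\<Sum>g\<in>F. q g)"
    using const by simp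
  also have "\<dots> = (\<Sum>w\<in>?W. (\<Sum>g\<in>F. of_bool (B g w)) * p (zs w))"
    unfolding q_def by (subst sum.swap) (simp add: sum_distrib_right)
  also have "\<dots> \<le> (\<Sum>w\<in>?W. 1 * p (zs w))"
  proof (intro sum_mono mult_right_mono harmonicD(1)[OF p])
    fix w
    show "(\<Sum>g\<in>F. of_bool (B g w)) \<le> (1 :: real)"
    proof (cases "\<exists>g\<in>F. B g w")
      case True
      then obtain g where g: "g \<in> F" "B g w"
        by blast
      then have "B h w \<longleftrightarrow> h = g" if "h \<in> F" for h
        using that unfolding B_def by blast
      then have "(\<Sum>h\<in>F. of_bool (B h w)) = (\<Sum>h\<in>F. if h = g then 1 else 0 :: real)"
        by (intro sum.cong) auto
      then show ?thesis
        using F(1) by (simp add: sum.delta)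
    qed (simp add: sum.neutral)
  qed
  also have "\<dots> = 1"
    using harmonic_sum_eq_1[OF p, of ?S] F(1) by simp
  finally have "q f * real (card F) \<le> 1"
    by (simp add: mult.commute)
  moreover have "0 < real (card F)"
    using F card_gt_0_iff by fastforce
  ultimately show ?thesis
    unfolding q_def B_def by (simp add: pos_le_divide_eq)
qed

text \<open>One ascending pair fixes the direction: everything to the right of its first member
  \<open>i\<close> is larger than \<open>i\<close> and everything to the left is smaller. Comparing
  an arbitrary pair with \<open>i\<close> then settles it.\<close>

lemma monotone_if_no_peak_or_valley:
  assumes total: "\<And>x y. x \<in> C \<Longrightarrow> y \<in> C \<Longrightarrow> x \<noteq> y \<Longrightarrow> L x y \<or> L y x"
    and trans: "\<And>x y z. L x y \<Longrightarrow> L y z \<Longrightarrow> L x z"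
    and irrefl: "\<And>x. \<not> L x x"
    and mono: "\<And>x y z. x \<in> C \<Longrightarrow> y \<in> C \<Longrightarrow> z \<in> C \<Longrightarrow> L x y \<Longrightarrow> L y z \<Longrightarrow> x < y \<longleftrightarrow> y < (z :: nat)"
  shows "(\<forall>x\<in>C. \<forall>y\<in>C. L x y \<longrightarrow> x < y) \<or> (\<forall>x\<in>C. \<forall>y\<in>C. L x y \<longrightarrow> y < x)"
proof (rule disjCI)
  assume "\<not> (\<forall>x\<in>C. \<forall>y\<in>C. L x y \<longrightarrow> y < x)"
  then obtain i j where ij: "i \<in> C" "j \<in> C" "L i j" "i < j"
    using irrefl by (metis linorder_neqE_nat)
  have right: "i < k" if k: "k \<in> C" "L i k" for k
  proof (cases "k = j")
    case False
    then have "L j k \<or> L k j"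
      using total[of j k] ij(2) k(1) by simp
    then consider "L j k" | "L k j"
      by blast
    then show ?thesis
    proof cases
      case 1
      then show ?thesis
        using mono[of i j k] ij k by simp
    next
      case 2
      show ?thesis
      proof (rule ccontr)
        assume "\<not> i < k"
        then have "\<not> k < j"
          using mono[of i k j] ij k 2 by simp
        with \<open>\<not> i < k\<close> ij(4) show False
          by linarith
      qed
    qed
  qed (use ij in simp)
  have left: "k < i" if "k \<in> C" "L k i" for k
    using mono[of k i j] ij that by simp
  show "\<forall>x\<in>C. \<forall>y\<in>C. L x y \<longrightarrow> x < y"
  proof (intro ballI impI)
    fix x y assume xy: "x \<in> C" "y \<in> C" "L x y"
    consider "x = i" | "y = i" | "L i x" | "L x i" "L i y" | "L y i"
      using total ij(1) xy by metis
    then show "x < y"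
    proof cases
      case 3
      then show ?thesis using mono[of i x y] right[of x] ij(1) xy by simp
    next
      case 4
      then show ?thesis using left[of x] right[of y] xy by simp
    next
      case 5
      then show ?thesis using mono[of x y i] left[of y] ij(1) xy by simp
    qed (use left right xy in auto)
  qed
qed

text \<open>\<open>c i\<close> is the cluster of the label \<open>i\<close> and \<open>s v\<close> tells whether the cluster \<open>v\<close> is increasing.\<close>

definition cluster_before :: "(nat \<Rightarrow> nat) \<Rightarrow> (nat \<Rightarrow> bool) \<Rightarrow> nat \<Rightarrow> nat \<Rightarrow> bool" where
  "cluster_before c s i j \<longleftrightarrow> c i < c j \<or> c i = c j \<and> (if s (c i) then i < j else j < i)"

lemma cluster_before_asym: "cluster_before c s i j \<Longrightarrow> \<not> cluster_before c s j i"
  by (cases "c i = c j") (simp_all add: cluster_before_def split: if_splits)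

text \<open>\<open>A\<close> holds the middle labels and \<open>E\<close> the outside ones. As
  \<open>A\<close> has no holes, the exchanges of \<open>a\<close> and \<open>Suc a\<close> inside
  \<open>A\<close> generate all permutations of \<open>A\<close>.\<close>

locale cluster_setup =
  fixes A E :: "nat set"
  assumes finite: "finite A" "finite E" and disjoint: "A \<inter> E = {}"
    and interval: "\<And>i j k. i \<in> A \<Longrightarrow> k \<in> A \<Longrightarrow> i < j \<Longrightarrow> j < k \<Longrightarrow> j \<in> A"
begin

abbreviation words :: "nat list set" where
  "words \<equiv> permutations_of_set (A \<union> E)"

text \<open>Two labels from \<open>A\<close> are in the same cluster if no label from \<open>E\<close> separates them.\<close>

definition cluster :: "nat list \<Rightarrow> nat \<Rightarrow> nat" where
  "cluster w i = card {e \<in> E. left_of w e i}"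

text \<open>A cluster with at most one label of \<open>A\<close> is both rising and falling.\<close>

definition rising :: "nat list \<Rightarrow> nat \<Rightarrow> bool" where
  "rising w v \<longleftrightarrow> (\<forall>i\<in>A. \<forall>j\<in>A. cluster w i = v \<and> cluster w j = v \<and> left_of w i j \<longrightarrow> i < j)"

definition falling :: "nat list \<Rightarrow> nat \<Rightarrow> bool" where
  "falling w v \<longleftrightarrow> (\<forall>i\<in>A. \<forall>j\<in>A. cluster w i = v \<and> cluster w j = v \<and> left_of w i j \<longrightarrow> j < i)"

definition good :: "nat list \<Rightarrow> bool" where
  "good w \<longleftrightarrow> (\<forall>v. rising w v \<or> falling w v)"

lemma words_props:
  assumes "w \<in> words"
  shows "distinct w" "set w = A \<union> E"
  using assms by (auto simp: permutations_of_set_def)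

text \<open>The cluster number counts the outside labels passed so far; going from \<open>i\<close>
  to \<open>j\<close> it grows by those met on the way, including \<open>i\<close> itself if it is
  one of them.\<close>

lemma cluster_mono:
  assumes w: "w \<in> words" and ij: "left_of w i j"
  shows "cluster w i \<le> cluster w j"
    and "cluster w i < cluster w j \<longleftrightarrow> (\<exists>e\<in>E. e \<noteq> i \<and> e \<noteq> j \<and> left_of w i e \<and> left_of w e j) \<or> i \<in> E"
proof -
  note ord = left_of_order[OF words_props(1)[OF w]]
  have sub: "{e \<in> E. left_of w e i} \<subseteq> {e \<in> E. left_of w e j}"
    using ord(4) ij by blast
  have fin: "finite {e \<in> E. left_of w e j}"
    using finite by simp
  show "cluster w i \<le> cluster w j"
    unfolding cluster_def by (rule card_mono[OF fin sub])
  have "cluster w i < cluster w j \<longleftrightarrow> {e \<in> E. left_of w e i} \<noteq> {e \<in> E. left_of w e j}"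
  proof (cases "{e \<in> E. left_of w e i} = {e \<in> E. left_of w e j}")
    case True
    then show ?thesis
      unfolding cluster_def by simp
  next
    case False
    then show ?thesis
      unfolding cluster_def using psubset_card_mono[OF fin psubsetI[OF sub]] by simp
  qed
  also have "\<dots> \<longleftrightarrow> (\<exists>e\<in>E. left_of w e j \<and> \<not> left_of w e i)"
    using sub by blast
  also have "\<dots> \<longleftrightarrow> (\<exists>e\<in>E. e \<noteq> i \<and> e \<noteq> j \<and> left_of w i e \<and> left_of w e j) \<or> i \<in> E"
  proof
    assume "\<exists>e\<in>E. left_of w e j \<and> \<not> left_of w e i"
    then obtain e where e: "e \<in> E" "left_of w e j" "\<not> left_of w e i"
      by blast
    have "e \<noteq> j"
      using e(2) ord(1) by blast
    moreover have "left_of w i e" if "e \<noteq> i"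
      using ord(3)[of i e] that e left_of_in_set[OF ij] left_of_in_set[OF e(2)] by blast
    ultimately show "(\<exists>e\<in>E. e \<noteq> i \<and> e \<noteq> j \<and> left_of w i e \<and> left_of w e j) \<or> i \<in> E"
      using e(1,2) by (cases "e = i") auto
  next
    assume "(\<exists>e\<in>E. e \<noteq> i \<and> e \<noteq> j \<and> left_of w i e \<and> left_of w e j) \<or> i \<in> E"
    then show "\<exists>e\<in>E. left_of w e j \<and> \<not> left_of w e i"
      using ord(1,2) ij by blast
  qed
  finally show "cluster w i < cluster w j \<longleftrightarrow> (\<exists>e\<in>E. e \<noteq> i \<and> e \<noteq> j \<and> left_of w i e \<and> left_of w e j) \<or> i \<in> E" .
qed

text \<open>For a good word the order of the middle labels is a function of the cluster map and the
  directions of the clusters. This is the finite form of the paintbox rule.\<close>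

lemma left_of_iff_cluster_before:
  assumes w: "w \<in> words" "good w" and ij: "i \<in> A" "j \<in> A" "i \<noteq> j"
  shows "left_of w i j \<longleftrightarrow> cluster_before (cluster w) (rising w) i j"
proof -
  note ord = left_of_order[OF words_props(1)[OF w(1)]]
  have imp: "cluster_before (cluster w) (rising w) i j"
    if "i \<in> A" "j \<in> A" "left_of w i j" for i j
  proof (cases "cluster w i < cluster w j")
    case False
    then have eq: "cluster w j = cluster w i"
      using cluster_mono(1)[OF w(1) that(3)] by simp
    show ?thesis
    proof (cases "rising w (cluster w i)")
      case True
      then have "i < j"
        using that eq unfolding rising_def by blast
      with True eq show ?thesis
        by (simp add: cluster_before_def)
    next
      case False
      then have "falling w (cluster w i)"
        using w(2) by (auto simp: good_def)
      then have "j < i"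
        using that eq unfolding falling_def by blast
      with False eq show ?thesis
        by (simp add: cluster_before_def)
    qed
  qed (simp add: cluster_before_def)
  have "\<not> (cluster_before (cluster w) (rising w) i j \<and> cluster_before (cluster w) (rising w) j i)"
    using cluster_before_asym by blast
  moreover have "left_of w i j \<or> left_of w j i"
    by (rule ord(3)) (use ij words_props(2)[OF w(1)] in auto)
  ultimately show ?thesis
    using imp ij by blast
qed

text \<open>An involution on words keeps the shape, the directions and goodness, and composes the
  cluster map with the exchange of \<open>a\<close> and \<open>Suc a\<close>. The function
  \<open>h\<close> is any observable of these data.\<close>

lemma swap_invariant:
  fixes h :: "(nat \<Rightarrow> nat) \<Rightarrow> (nat \<Rightarrow> bool) \<Rightarrow> bool \<Rightarrow> real"
  assumes a: "a \<in> A" "Suc a \<in> A"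
  shows "(\<Sum>w\<in>words. h (restrict (cluster w \<circ> label_swap a (Suc a)) A) (rising w) (good w) * p (zs w)) =
    (\<Sum>w\<in>words. h (restrict (cluster w) A) (rising w) (good w) * p (zs w))"
proof -
  let ?\<tau> = "label_swap a (Suc a)" and ?t = "map (label_swap a (Suc a))"
  \<comment> \<open>Labels in the same cluster are left in place: exchanging them could alter the
    shape and the direction, while the cluster map is already symmetric in them.\<close>
  define \<phi> where "\<phi> w = (if cluster w a = cluster w (Suc a) then w else ?t w)" for w
  have aE: "a \<notin> E" "Suc a \<notin> E"
    using a disjoint by auto
  have \<tau>A: "?\<tau> i \<in> A \<longleftrightarrow> i \<in> A" for i
    using a by (auto simp: Transposition.transpose_def)
  have cl_t: "cluster (?t w) i = cluster w (?\<tau> i)" for w i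
  proof -
    have "?\<tau> e = e" if "e \<in> E" for e
      using that aE by (auto simp: Transposition.transpose_def)
    then show ?thesis
      unfolding cluster_def left_of_map_transpose by (metis (no_types, lifting))
  qed
  have cl_\<phi>: "cluster (\<phi> w) i = cluster w (?\<tau> i)" for w i
    by (auto simp: \<phi>_def cl_t Transposition.transpose_def)
  have \<phi>\<phi>: "\<phi> (\<phi> w) = w" for w
    by (auto simp: \<phi>_def cl_t map_transpose_involutory simp del: map_map)
  have \<phi>_words: "\<phi> w \<in> words" if "w \<in> words" for w
    using that a map_transpose_permutations[of a "A \<union> E" "Suc a" w] by (auto simp: \<phi>_def)
  have bij: "bij_betw \<phi> words words"
    by (rule bij_betw_byWitness[of _ \<phi>]) (use \<phi>\<phi> \<phi>_words in auto)
  have zs_\<phi>: "zs (\<phi> w) = zs w" if w: "w \<in> words" for w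
  proof (cases "cluster w a = cluster w (Suc a)")
    case False
    have "left_of w a (Suc a) \<or> left_of w (Suc a) a"
      by (rule left_of_order(3)) (use words_props[OF w] a in auto)
    then obtain e where "e \<in> E" "left_of w a e \<and> left_of w e (Suc a) \<or> left_of w (Suc a) e \<and> left_of w e a"
      using cluster_mono[OF w, of a "Suc a"] cluster_mono[OF w, of "Suc a" a] False aE
      by (metis le_neq_implies_less)
    then show ?thesis
      unfolding \<phi>_def using False words_props[OF w] by (auto intro!: zs_map_transpose)
  qed (simp add: \<phi>_def)
  \<comment> \<open>The exchange disturbs \<open>Q\<close> only at the pair \<open>a\<close>,
    \<open>Suc a\<close>. Whenever the labels are really exchanged they lie in different clusters,
    so this pair is never tested.\<close>
  have transfer: "(\<forall>i\<in>A. \<forall>j\<in>A. cluster (\<phi> w) i = v \<and> cluster (\<phi> w) j = v \<and> left_of (\<phi> w) i j \<longrightarrow> Q i j) \<longleftrightarrow>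
      (\<forall>i\<in>A. \<forall>j\<in>A. cluster w i = v \<and> cluster w j = v \<and> left_of w i j \<longrightarrow> Q i j)"
    if Q: "\<And>i j. {i, j} \<noteq> {a, Suc a} \<Longrightarrow> i \<noteq> j \<Longrightarrow> Q (?\<tau> i) (?\<tau> j) \<longleftrightarrow> Q i j" and w: "w \<in> words" for w v Q
  proof (cases "cluster w a = cluster w (Suc a)")
    case False
    have "(\<forall>i\<in>A. \<forall>j\<in>A. cluster (\<phi> w) i = v \<and> cluster (\<phi> w) j = v \<and> left_of (\<phi> w) i j \<longrightarrow> Q i j) \<longleftrightarrow>
        (\<forall>i\<in>A. \<forall>j\<in>A. cluster w (?\<tau> i) = v \<and> cluster w (?\<tau> j) = v \<and> left_of w (?\<tau> i) (?\<tau> j) \<longrightarrow> Q i j)"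
      unfolding cl_\<phi> using False by (simp add: \<phi>_def left_of_map_transpose)
    also have "\<dots> \<longleftrightarrow> (\<forall>i\<in>A. \<forall>j\<in>A. cluster w i = v \<and> cluster w j = v \<and> left_of w i j \<longrightarrow> Q (?\<tau> i) (?\<tau> j))"
      using \<tau>A by (metis transpose_involutory)
    also have "\<dots> \<longleftrightarrow> (\<forall>i\<in>A. \<forall>j\<in>A. cluster w i = v \<and> cluster w j = v \<and> left_of w i j \<longrightarrow> Q i j)"
    proof -
      have "Q (?\<tau> i) (?\<tau> j) \<longleftrightarrow> Q i j" if "cluster w i = v" "cluster w j = v" "left_of w i j" for i j
        using that False left_of_order(1)[OF words_props(1)[OF w]] by (intro Q) (auto simp: doubleton_eq_iff)
      then show ?thesis
        by blast
    qed
    finally show ?thesis .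
  qed (simp add: \<phi>_def)
  have rf: "rising (\<phi> w) = rising w" "falling (\<phi> w) = falling w" if "w \<in> words" for w
    unfolding rising_def falling_def using that
    by (intro ext transfer; force simp: Transposition.transpose_def doubleton_eq_iff)+
  have "(\<Sum>w\<in>words. h (restrict (cluster w) A) (rising w) (good w) * p (zs w)) =
      (\<Sum>w\<in>words. h (restrict (cluster (\<phi> w)) A) (rising (\<phi> w)) (good (\<phi> w)) * p (zs (\<phi> w)))"
    by (rule sum.reindex_bij_betw[OF bij, symmetric])
  also have "\<dots> = (\<Sum>w\<in>words. h (restrict (cluster w \<circ> ?\<tau>) A) (rising w) (good w) * p (zs w))"
  proof (rule sum.cong[OF refl])
    fix w assume w: "w \<in> words"
    have "restrict (cluster (\<phi> w)) A = restrict (cluster w \<circ> ?\<tau>) A"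
      using cl_\<phi> by (auto simp: restrict_def fun_eq_iff)
    then show "h (restrict (cluster (\<phi> w)) A) (rising (\<phi> w)) (good (\<phi> w)) * p (zs (\<phi> w)) =
        h (restrict (cluster w \<circ> ?\<tau>) A) (rising w) (good w) * p (zs w)"
      using rf[OF w] zs_\<phi>[OF w] by (simp add: good_def)
  qed
  finally show ?thesis ..
qed

text \<open>Invariance is phrased for all observables \<open>h\<close> at once, which makes it
  closed under composition: one permutation is absorbed into \<open>h\<close> while the other is
  applied.\<close>

lemma permutation_invariant:
  fixes h :: "(nat \<Rightarrow> nat) \<Rightarrow> (nat \<Rightarrow> bool) \<Rightarrow> bool \<Rightarrow> real"
  assumes "\<sigma> permutes A"
  shows "(\<Sum>w\<in>words. h (restrict (cluster w \<circ> \<sigma>) A) (rising w) (good w) * p (zs w)) =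
    (\<Sum>w\<in>words. h (restrict (cluster w) A) (rising w) (good w) * p (zs w))"
proof -
  define inv where "inv \<rho> \<longleftrightarrow> (\<forall>h :: (nat \<Rightarrow> nat) \<Rightarrow> (nat \<Rightarrow> bool) \<Rightarrow> bool \<Rightarrow> real.
    (\<Sum>w\<in>words. h (restrict (cluster w \<circ> \<rho>) A) (rising w) (good w) * p (zs w)) =
    (\<Sum>w\<in>words. h (restrict (cluster w) A) (rising w) (good w) * p (zs w)))" for \<rho>
  have comp: "inv (\<rho> \<circ> \<rho>')" if "inv \<rho>" "inv \<rho>'" "\<rho>' permutes A" for \<rho> \<rho>'
    unfolding inv_def
  proof
    fix h :: "(nat \<Rightarrow> nat) \<Rightarrow> (nat \<Rightarrow> bool) \<Rightarrow> bool \<Rightarrow> real"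
    have r: "restrict (restrict g A \<circ> \<rho>') A = restrict (g \<circ> \<rho>') A" for g :: "nat \<Rightarrow> nat"
      using permutes_in_image[OF that(3)] by (auto simp: restrict_def fun_eq_iff)
    have "(\<Sum>w\<in>words. h (restrict (restrict (cluster w \<circ> \<rho>) A \<circ> \<rho>') A) (rising w) (good w) * p (zs w)) =
        (\<Sum>w\<in>words. h (restrict (restrict (cluster w) A \<circ> \<rho>') A) (rising w) (good w) * p (zs w))"
      using that(1)[unfolded inv_def, rule_format, of "\<lambda>c. h (restrict (c \<circ> \<rho>') A)"] .
    then show "(\<Sum>w\<in>words. h (restrict (cluster w \<circ> (\<rho> \<circ> \<rho>')) A) (rising w) (good w) * p (zs w)) =
        (\<Sum>w\<in>words. h (restrict (cluster w) A) (rising w) (good w) * p (zs w))"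
      using that(2) unfolding r inv_def by (simp add: comp_assoc)
  qed
  have transp: "inv (label_swap a b)" if "a < b" "a \<in> A" "b \<in> A" for a b
    using that
  proof (induction b)
    case (Suc b)
    show ?case
    proof (cases "a = b")
      case True
      then show ?thesis
        using Suc.prems swap_invariant by (simp add: inv_def)
    next
      case False
      then have b: "a < b" "b \<in> A"
        using Suc.prems interval[of a "Suc b" b] by auto
      have "inv (label_swap a b)" "inv (label_swap b (Suc b))"
        using Suc b swap_invariant by (auto simp: inv_def)
      \<comment> \<open>Conjugating with an adjacent exchange turns the transposition of
        \<open>a\<close> and \<open>b\<close> into that of \<open>a\<close> and
        \<open>Suc b\<close>.\<close>
      moreover have "label_swap b (Suc b) \<circ> label_swap a b \<circ> label_swap b (Suc b) = label_swap a (Suc b)"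
        using b by (auto simp: fun_eq_iff Transposition.transpose_def)
      ultimately show ?thesis
        using comp b Suc.prems by (metis permutes_swap_id)
    qed
  qed simp
  have "inv \<sigma>"
    using assms finite(1)
  proof (induction \<sigma> rule: permutes_induct)
    case id
    then show ?case by (simp add: inv_def comp_def)
  next
    case (swap a b \<sigma>)
    have "inv (label_swap a b)"
      using transp[of a b] transp[of b a] swap by (metis linorder_neqE_nat transpose_commute)
    then show ?case
      using comp swap by blast
  qed
  then show ?thesis
    by (simp add: inv_def)
qed

text \<open>The complements of \<open>B\<close> and of its image in \<open>A\<close> have equal
  size, so the injection extends to a permutation of \<open>A\<close>. It says that any sample of
  distinct middle labels has the same joint law of clusters.\<close>

lemma injection_invariant:
  fixes h :: "(nat \<Rightarrow> nat) \<Rightarrow> (nat \<Rightarrow> bool) \<Rightarrow> bool \<Rightarrow> real"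
  assumes J: "inj_on J B" "J ` B \<subseteq> A" "B \<subseteq> A"
  shows "(\<Sum>w\<in>words. h (restrict (cluster w \<circ> J) B) (rising w) (good w) * p (zs w)) =
    (\<Sum>w\<in>words. h (restrict (cluster w) B) (rising w) (good w) * p (zs w))"
proof -
  have fin: "finite B" "finite (J ` B)"
    using finite_subset[OF J(3) finite(1)] finite_subset[OF J(2) finite(1)] by simp_all
  have "card (A - B) = card (A - J ` B)"
    using J fin by (simp add: card_Diff_subset card_image)
  then obtain g where g: "bij_betw g (A - B) (A - J ` B)"
    using finite_same_card_bij[of "A - B" "A - J ` B"] finite(1) by blast
  define \<sigma> where "\<sigma> i = (if i \<in> B then J i else if i \<in> A then g i else i)" for i
  have "bij_betw \<sigma> (B \<union> (A - B)) (J ` B \<union> (A - J ` B))"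
  proof (rule bij_betw_combine)
    show "bij_betw \<sigma> B (J ` B)"
      using J(1) by (auto simp: bij_betw_def inj_on_def \<sigma>_def)
    show "bij_betw \<sigma> (A - B) (A - J ` B)"
      using g by (rule bij_betw_cong[THEN iffD1, rotated]) (auto simp: \<sigma>_def)
  qed auto
  then have "bij_betw \<sigma> A A"
    using J by (simp add: Un_absorb1)
  then have "\<sigma> permutes A"
    by (rule bij_imp_permutes) (use J in \<open>auto simp: \<sigma>_def\<close>)
  note inv = permutation_invariant[OF this, of "\<lambda>c. h (restrict c B)" p]
  have "restrict (restrict (cluster w \<circ> \<sigma>) A) B = restrict (cluster w \<circ> J) B"
    "restrict (restrict (cluster w) A) B = restrict (cluster w) B" for w
    using J(3) by (auto simp: restrict_def fun_eq_iff \<sigma>_def)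
  with inv show ?thesis
    by simp
qed

end

section \<open>Finite sampling and paintboxes built from equal slots\<close>

lemma sorted_wrt_cong_on:
  assumes "distinct u" "\<And>x y. x \<in> set u \<Longrightarrow> y \<in> set u \<Longrightarrow> x \<noteq> y \<Longrightarrow> Q x y \<longleftrightarrow> R x y"
  shows "sorted_wrt Q u \<longleftrightarrow> sorted_wrt R u"
proof -
  have "Q (u ! i) (u ! j) \<longleftrightarrow> R (u ! i) (u ! j)" if "i < j" "j < length u" for i j
    using assms that by (simp add: nth_eq_iff_index_eq)
  then show ?thesis
    by (auto simp: sorted_wrt_iff_nth_less)
qed

text \<open>Sampling with and without repetition: among the maps from \<open>B\<close> to
  \<open>A\<close> a given pair of arguments collides with frequency at most 1 /
  \<open>card A\<close>, there are at most \<open>card B\<close> squared pairs, and each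
  non-injective map changes the sum by at most 1.\<close>

lemma average_injective_close:
  fixes a :: "('b \<Rightarrow> 'c) \<Rightarrow> real"
  assumes fin: "finite B" "finite A" "A \<noteq> {}"
    and a: "\<And>J. J \<in> B \<rightarrow>\<^sub>E A \<Longrightarrow> 0 \<le> a J" "\<And>J. J \<in> B \<rightarrow>\<^sub>E A \<Longrightarrow> a J \<le> 1"
    and V: "\<And>J. J \<in> B \<rightarrow>\<^sub>E A \<Longrightarrow> inj_on J B \<Longrightarrow> a J = V" "0 \<le> V" "V \<le> 1"
  shows "\<bar>(\<Sum>J\<in>B \<rightarrow>\<^sub>E A. a J) / real (card A) ^ card B - V\<bar> \<le> real (card B) ^ 2 / real (card A)"
proof -
  let ?T = "B \<rightarrow>\<^sub>E A"
  have finT: "finite ?T"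
    using fin by (intro finite_PiE)
  have cardT: "card ?T = card A ^ card B"
    using fin by (simp add: card_PiE)
  have posA: "0 < card A"
    using fin by (simp add: card_gt_0_iff)
  let ?n = "real (card A)" and ?m = "card B"
  \<comment> \<open>The value at \<open>x\<close> can be overwritten by any of the
    \<open>card A\<close> labels without loss of information, since it equals the value kept at
    \<open>y\<close>.\<close>
  have collision: "card {J \<in> ?T. J x = J y} * card A \<le> card A ^ ?m" if xy: "x \<in> B" "y \<in> B" "x \<noteq> y" for x y
  proof -
    let ?g = "\<lambda>(J, z). J(x := z)"
    have "inj_on ?g ({J \<in> ?T. J x = J y} \<times> A)"
    proof (rule inj_onI, clarify)
      fix J z J' z' assume J: "J \<in> ?T" "J x = J y" "J' \<in> ?T" "J' x = J' y" and eq: "J(x := z) = J'(x := z')"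
      have "J y = J' y"
        using fun_cong[OF eq, of y] xy by simp
      moreover have "J i = J' i" if "i \<noteq> x" for i
        using fun_cong[OF eq, of i] that by simp
      ultimately have "J = J'"
        using J by (metis ext)
      then show "J = J' \<and> z = z'"
        using fun_cong[OF eq, of x] by simp
    qed
    moreover have "?g ` ({J \<in> ?T. J x = J y} \<times> A) \<subseteq> ?T"
      using xy by (auto simp: PiE_iff extensional_def)
    ultimately have "card ({J \<in> ?T. J x = J y} \<times> A) \<le> card ?T"
      using card_inj_on_le finT by blast
    then show ?thesis
      by (simp add: card_cartesian_product cardT)
  qed
  let ?N = "{J \<in> ?T. \<not> inj_on J B}" and ?D = "B \<times> B - Id"
  have finD: "finite ?D"
    using fin by simp
  have "?N \<subseteq> (\<Union>z\<in>?D. {J \<in> ?T. J (fst z) = J (snd z)})"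
  proof
    fix J assume J: "J \<in> ?N"
    then obtain x y where "x \<in> B" "y \<in> B" "x \<noteq> y" "J x = J y"
      by (auto simp: inj_on_def)
    then show "J \<in> (\<Union>z\<in>?D. {J \<in> ?T. J (fst z) = J (snd z)})"
      using J by (intro UN_I[of "(x, y)"]) auto
  qed
  then have "card ?N \<le> card (\<Union>z\<in>?D. {J \<in> ?T. J (fst z) = J (snd z)})"
    by (rule card_mono[rotated]) (use finD finT in auto)
  also have "\<dots> \<le> (\<Sum>z\<in>?D. card {J \<in> ?T. J (fst z) = J (snd z)})"
    by (rule card_UN_le[OF finD])
  finally have "card ?N * card A \<le> (\<Sum>z\<in>?D. card {J \<in> ?T. J (fst z) = J (snd z)} * card A)"
    by (simp flip: sum_distrib_right)
  also have "\<dots> \<le> (\<Sum>z\<in>?D. card A ^ ?m)"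
    by (intro sum_mono collision) auto
  also have "\<dots> = card ?D * card A ^ ?m"
    by simp
  finally have "real (card ?N * card A) \<le> real (card ?D * card A ^ ?m)"
    by (rule of_nat_mono)
  then have "real (card ?N) * ?n \<le> real (card ?D) * ?n ^ ?m"
    by simp
  also have "\<dots> \<le> real ?m ^ 2 * ?n ^ ?m"
  proof -
    have "card (B \<times> B - Id) \<le> card (B \<times> B)"
      using fin by (intro card_mono) auto
    then have "real (card (B \<times> B - Id)) \<le> real ?m ^ 2"
      by (simp add: card_cartesian_product power2_eq_square flip: of_nat_mult)
    then show ?thesis
      by (simp add: mult_right_mono)
  qed
  finally have N: "real (card ?N) / ?n ^ ?m \<le> real ?m ^ 2 / ?n"
    using posA by (simp add: field_simps)
  have split: "(\<Sum>J\<in>?T. a J) = (\<Sum>J\<in>?T - ?N. a J) + (\<Sum>J\<in>?N. a J)"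
    by (rule sum.subset_diff) (use finT in auto)
  have "(\<Sum>J\<in>?T - ?N. a J) = (\<Sum>J\<in>?T - ?N. V)"
    using V(1) by (intro sum.cong) auto
  also have "\<dots> = (?n ^ ?m - card ?N) * V"
  proof -
    have "card ?N \<le> card ?T"
      by (rule card_mono[OF finT]) auto
    then have "real (card (?T - ?N)) = ?n ^ ?m - card ?N"
      using finT by (subst card_Diff_subset) (auto simp: cardT of_nat_diff)
    then show ?thesis
      by simp
  qed
  finally have "(\<Sum>J\<in>?T. a J) - ?n ^ ?m * V = (\<Sum>J\<in>?N. a J) - card ?N * V"
    using split by (simp add: algebra_simps)
  moreover have "0 \<le> (\<Sum>J\<in>?N. a J)" "(\<Sum>J\<in>?N. a J) \<le> card ?N"
    using a sum_bounded_above[of ?N a 1] by (auto intro!: sum_nonneg)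
  moreover have "0 \<le> card ?N * V" "card ?N * V \<le> card ?N"
    using V by (auto simp: mult_left_le)
  ultimately have "\<bar>(\<Sum>J\<in>?T. a J) - ?n ^ ?m * V\<bar> \<le> card ?N"
    by linarith
  then have "\<bar>(\<Sum>J\<in>?T. a J) - ?n ^ ?m * V\<bar> / ?n ^ ?m \<le> card ?N / ?n ^ ?m"
    by (rule divide_right_mono) simp
  moreover have "\<bar>(\<Sum>J\<in>?T. a J) - ?n ^ ?m * V\<bar> / ?n ^ ?m = \<bar>(\<Sum>J\<in>?T. a J) / ?n ^ ?m - V\<bar>"
  proof -
    have "(\<Sum>J\<in>?T. a J) / ?n ^ ?m - V = ((\<Sum>J\<in>?T. a J) - ?n ^ ?m * V) / ?n ^ ?m"
      using posA by (simp add: field_simps)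
    then show ?thesis
      by (simp add: abs_divide)
  qed
  ultimately show ?thesis
    using N by linarith
qed

lemma mono_floor_slot:
  fixes f :: "nat \<Rightarrow> nat"
  assumes "mono_on {..<n} f" "0 < x" "x \<le> y" "y < 1" "0 < n"
  shows "f (nat \<lfloor>real n * x\<rfloor>) \<le> f (nat \<lfloor>real n * y\<rfloor>)" "nat \<lfloor>real n * y\<rfloor> < n"
proof -
  show less: "nat \<lfloor>real n * y\<rfloor> < n"
    using assms by (simp add: nat_less_iff floor_less_iff)
  have "nat \<lfloor>real n * x\<rfloor> \<le> nat \<lfloor>real n * y\<rfloor>"
    using assms by (intro nat_mono floor_mono mult_left_mono) auto
  then show "f (nat \<lfloor>real n * x\<rfloor>) \<le> f (nat \<lfloor>real n * y\<rfloor>)"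
    using less by (intro mono_onD[OF assms(1)]) auto
qed

text \<open>The unit interval is cut into n equal slots, and slot k is assigned to the value
  \<open>f k\<close>. Monotonicity makes each level set an interval. The multiples of 1/n are left
  out because a jump of \<open>f\<close> may occur there; they form a null set.\<close>

lemma step_paintbox:
  fixes f :: "nat \<Rightarrow> nat" and s :: "nat \<Rightarrow> bool"
  assumes f: "mono_on {..<n} f" and n: "0 < n"
  obtains P where
    "\<And>x y. 0 < x \<Longrightarrow> x < 1 \<Longrightarrow> 0 < y \<Longrightarrow> y < 1 \<Longrightarrow> real n * x \<notin> \<int> \<Longrightarrow> real n * y \<notin> \<int> \<Longrightarrow>
      (connected_component (up_set P) x y \<longleftrightarrow>
        f (nat \<lfloor>real n * x\<rfloor>) = f (nat \<lfloor>real n * y\<rfloor>) \<and> s (f (nat \<lfloor>real n * x\<rfloor>))) \<and>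
      (connected_component (down_set P) x y \<longleftrightarrow>
        f (nat \<lfloor>real n * x\<rfloor>) = f (nat \<lfloor>real n * y\<rfloor>) \<and> \<not> s (f (nat \<lfloor>real n * x\<rfloor>)))"
proof -
  define g where "g x = f (nat \<lfloor>real n * x\<rfloor>)" for x :: real
  \<comment> \<open>Taking interiors joins neighbouring slots of equal value into one component and
    drops the jump points.\<close>
  define I where "I v = interior {x \<in> {0<..<1}. g x = v}" for v
  have I: "open (I v)" "I v \<subseteq> {0<..<1}" "x \<in> I v \<Longrightarrow> g x = v" for v x
    using interior_subset[of "{x \<in> {0<..<1}. g x = v}"] by (auto simp: I_def)
  define P where "P = Abs_paintbox (\<Union>v\<in>{v. s v}. I v, \<Union>v\<in>{v. \<not> s v}. I v)"
  have "Rep_paintbox P = (\<Union>v\<in>{v. s v}. I v, \<Union>v\<in>{v. \<not> s v}. I v)"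
    unfolding P_def by (rule Abs_paintbox_inverse) (use I in blast)
  then have P: "up_set P = (\<Union>v\<in>{v. s v}. I v)" "down_set P = (\<Union>v\<in>{v. \<not> s v}. I v)"
    by (auto simp: up_set_def down_set_def)
  have mono: "g x \<le> g y" if "0 < x" "x \<le> y" "y < 1" for x y
    unfolding g_def using mono_floor_slot(1)[OF f that n] .
  have local: "\<exists>e>0. \<forall>y. \<bar>y - x\<bar> < e \<longrightarrow> g y = g x" if x: "real n * x \<notin> \<int>" for x
  proof -
    have "of_int \<lfloor>real n * x\<rfloor> \<noteq> real n * x"
      using x by (metis Ints_of_int)
    then have fl: "of_int \<lfloor>real n * x\<rfloor> < real n * x" "real n * x < of_int \<lfloor>real n * x\<rfloor> + 1"
      by linarith+
    define d where "d = min (real n * x - of_int \<lfloor>real n * x\<rfloor>) (of_int \<lfloor>real n * x\<rfloor> + 1 - real n * x)"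
    have d: "0 < d / real n"
      using fl n by (simp add: d_def)
    have "g y = g x" if "\<bar>y - x\<bar> < d / real n" for y
    proof -
      have "\<bar>real n * y - real n * x\<bar> < d"
      proof -
        have "real n * \<bar>y - x\<bar> < d"
          using that n by (simp add: field_simps)
        moreover have "\<bar>real n * y - real n * x\<bar> = real n * \<bar>y - x\<bar>"
          by (simp add: abs_mult flip: right_diff_distrib)
        ultimately show ?thesis
          by simp
      qed
      then have "\<bar>real n * y - real n * x\<bar> < real n * x - of_int \<lfloor>real n * x\<rfloor>"
        "\<bar>real n * y - real n * x\<bar> < of_int \<lfloor>real n * x\<rfloor> + 1 - real n * x"
        by (simp_all add: d_def)
      then have "\<lfloor>real n * y\<rfloor> = \<lfloor>real n * x\<rfloor>"
        by (intro floor_unique) linarith+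
      then show ?thesis
        by (simp add: g_def)
    qed
    with d show ?thesis
      by blast
  qed
  have conn_le: "connected_component (\<Union>v\<in>V. I v) x y \<longleftrightarrow> g x = g y \<and> g x \<in> V"
    if xy: "0 < x" "x \<le> y" "y < 1" "real n * x \<notin> \<int>" "real n * y \<notin> \<int>" for x y and V :: "nat set"
  proof
    assume "connected_component (\<Union>v\<in>V. I v) x y"
    then obtain T where T: "connected T" "T \<subseteq> (\<Union>v\<in>V. I v)" "x \<in> T" "y \<in> T"
      by (auto simp: connected_component_def)
    then obtain v where v: "v \<in> V" "x \<in> I v"
      by blast
    let ?O = "\<Union>v'\<in>V - {v}. I v'"
    have O: "open ?O" "T \<subseteq> I v \<union> ?O"
      using T(2) by (auto intro!: open_UN I(1))
    have "I v \<inter> ?O = {}"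
      using I(3) by blast
    then have "I v \<inter> T = {} \<or> ?O \<inter> T = {}"
      using connectedD[OF T(1) I(1)[of v] O(1) _ O(2)] by blast
    then have "y \<in> I v"
      using T(3,4) v O(2) by blast
    then show "g x = g y \<and> g x \<in> V"
      using I(3) v by metis
  next
    assume v: "g x = g y \<and> g x \<in> V"
    obtain d e where d: "0 < d" "\<And>z. \<bar>z - x\<bar> < d \<Longrightarrow> g z = g x" and e: "0 < e" "\<And>z. \<bar>z - y\<bar> < e \<Longrightarrow> g z = g y"
      using local xy(4,5) by meson
    define a where "a = max 0 (x - d)"
    define b where "b = min 1 (y + e)"
    have "{a<..<b} \<subseteq> {x \<in> {0<..<1}. g x = g y}"
    proof
      fix z assume z: "z \<in> {a<..<b}"
      then have z01: "0 < z" "z < 1"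
        by (auto simp: a_def b_def)
      consider "z < x" | "x \<le> z" "z \<le> y" | "y < z"
        by linarith
      then have "g z = g y"
      proof cases
        case 1
        then show ?thesis using d(2)[of z] z v by (simp add: a_def)
      next
        case 2
        then have "g x \<le> g z" "g z \<le> g y"
          using mono xy z01 by auto
        then show ?thesis using v by simp
      next
        case 3
        then show ?thesis using e(2)[of z] z by (simp add: b_def)
      qed
      with z01 show "z \<in> {x \<in> {0<..<1}. g x = g y}"
        by simp
    qed
    then have "{a<..<b} \<subseteq> I (g y)"
      unfolding I_def by (intro interior_maximal) auto
    moreover have "{min x y..max x y} \<subseteq> {a<..<b}"
      using xy d(1) e(1) by (auto simp: a_def b_def)
    moreover have "I (g y) \<subseteq> (\<Union>v\<in>V. I v)"
      using v by auto
    ultimately have "{min x y..max x y} \<subseteq> (\<Union>v\<in>V. I v)"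
      by (meson subset_trans)
    then show "connected_component (\<Union>v\<in>V. I v) x y"
      by (simp add: connected_component_real_iff)
  qed
  have conn: "connected_component (\<Union>v\<in>V. I v) x y \<longleftrightarrow> g x = g y \<and> g x \<in> V"
    if "0 < x" "x < 1" "0 < y" "y < 1" "real n * x \<notin> \<int>" "real n * y \<notin> \<int>" for x y and V :: "nat set"
  proof (cases "x \<le> y")
    case True
    then show ?thesis using conn_le that by simp
  next
    case False
    then show ?thesis
      using conn_le[of y x V] that unfolding connected_component_sym_eq[of _ x y] by auto
  qed
  show ?thesis
    by (rule that[of P]) (use conn in \<open>simp add: P g_def[symmetric]\<close>)
qed

text \<open>The slots of independent uniform points are independent and uniform on
  \<open>{..<n}\<close>, so the probability is an average over all maps from letters to slots,
  repetitions included.\<close>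

lemma step_paintbox_prob:
  fixes f :: "nat \<Rightarrow> nat" and s :: "nat \<Rightarrow> bool"
  assumes f: "mono_on {..<n} f" and n: "0 < n"
  obtains P where "\<And>u. distinct u \<Longrightarrow> set u \<subseteq> {1..} \<Longrightarrow> paintbox_prob P u =
    (\<Sum>J\<in>set u \<rightarrow>\<^sub>E {..<n}. of_bool (sorted_wrt (cluster_before (f \<circ> J) s) u)) / real n ^ length u"
proof -
  obtain P where P: "\<And>x y. 0 < x \<Longrightarrow> x < 1 \<Longrightarrow> 0 < y \<Longrightarrow> y < 1 \<Longrightarrow> real n * x \<notin> \<int> \<Longrightarrow> real n * y \<notin> \<int> \<Longrightarrow>
      (connected_component (up_set P) x y \<longleftrightarrow>
        f (nat \<lfloor>real n * x\<rfloor>) = f (nat \<lfloor>real n * y\<rfloor>) \<and> s (f (nat \<lfloor>real n * x\<rfloor>))) \<and>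
      (connected_component (down_set P) x y \<longleftrightarrow>
        f (nat \<lfloor>real n * x\<rfloor>) = f (nat \<lfloor>real n * y\<rfloor>) \<and> \<not> s (f (nat \<lfloor>real n * x\<rfloor>)))"
    using step_paintbox[OF f n, of s] by blast
  interpret prob_space uniform_sample
    by (rule prob_space_uniform_sample)
  interpret U: product_prob_space "\<lambda>_ :: nat. uniform01" "{1..}"
    by (intro product_prob_spaceI prob_space_uniform01)
  define slot where "slot x = nat \<lfloor>real n * x\<rfloor>" for x :: real
  have [measurable]: "slot \<in> borel \<rightarrow>\<^sub>M count_space UNIV"
    unfolding slot_def by measurable
  have AE_slot: "AE \<xi> in uniform_sample. 0 < \<xi> i \<and> \<xi> i < 1 \<and> real n * \<xi> i \<notin> \<int>" if "1 \<le> i" for i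
  proof (rule AE_uniform_sample[OF that])
    have "countable ((\<lambda>z. z / real n) ` \<int>)"
      by (intro countable_image countable_int)
    then have "AE x in uniform01. x \<notin> (\<lambda>z. z / real n) ` \<int>"
      by (rule AE_uniform01_countable)
    moreover have "AE x in uniform01. x \<notin> {0, 1}"
      by (rule AE_uniform01_countable) simp
    ultimately show "AE x in uniform01. 0 < x \<and> x < 1 \<and> real n * x \<notin> \<int>"
      using AE_uniform01_range
    proof eventually_elim
      case (elim x)
      have "x = (real n * x) / real n"
        using n by simp
      then have "real n * x \<notin> \<int>"
        using elim(1) by blast
      then show ?case
        using elim by auto
    qed
  qed
  have slot_prob: "measure uniform01 {x. slot x = k} = 1 / real n" if k: "k < n" for k
  proof -
    have "{0..1} \<inter> {x. slot x = k} = {real k / real n..<(real k + 1) / real n}"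
    proof (intro set_eqI iffI)
      fix x assume "x \<in> {0..1} \<inter> {x. slot x = k}"
      then have "0 \<le> x" "\<lfloor>real n * x\<rfloor> = int k"
        by (auto simp: slot_def)
      then show "x \<in> {real k / real n..<(real k + 1) / real n}"
        using n by (auto simp: floor_eq_iff field_simps)
    next
      fix x assume x: "x \<in> {real k / real n..<(real k + 1) / real n}"
      then have "real k \<le> real n * x" "real n * x < real k + 1"
        using n by (auto simp: field_simps)
      then have "slot x = k"
        by (simp add: slot_def floor_eq_iff nat_eq_iff)
      moreover have "0 \<le> x"
        using x by (auto intro: order_trans[of 0 "real k / real n"])
      moreover have "(real k + 1) / real n \<le> 1"
        using k n by (simp add: field_simps)
      ultimately show "x \<in> {0..1} \<inter> {x. slot x = k}"
        using x by auto
    qed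
    moreover have "{x. slot x = k} \<in> sets borel"
      by measurable
    moreover have "real k / real n \<le> (real k + 1) / real n"
      using n by (simp add: field_simps)
    ultimately show ?thesis
      by (subst measure_uniform_measure) (auto simp: diff_divide_distrib[symmetric])
  qed
  show thesis
  proof
    fix u :: "nat list" assume u: "distinct u" "set u \<subseteq> {1..}"
    let ?T = "set u \<rightarrow>\<^sub>E {..<n}"
    have finT: "finite ?T"
      by (intro finite_PiE) auto
    let ?R = "\<lambda>\<xi>. sorted_wrt (placed_left P \<xi>) u"
    define h where "h \<xi> = restrict (slot \<circ> \<xi>) (set u)" for \<xi>
    have prob_h: "prob {\<xi> \<in> space uniform_sample. h \<xi> = J} = 1 / real n ^ length u" if J: "J \<in> ?T" for J
    proof -
      have "{\<xi> \<in> space uniform_sample. h \<xi> = J} = {\<xi> \<in> space (PiM {1..} (\<lambda>_. uniform01)). \<forall>i\<in>set u. \<xi> i \<in> {x. slot x = J i}}"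
        using J by (auto simp: h_def uniform_sample_def restrict_def PiE_iff extensional_def fun_eq_iff)
      then have "emeasure uniform_sample {\<xi> \<in> space uniform_sample. h \<xi> = J} = (\<Prod>i\<in>set u. emeasure uniform01 {x. slot x = J i})"
        unfolding uniform_sample_def
        by (simp only:, intro U.emeasure_PiM_Collect) (use u in auto)
      also have "\<dots> = (\<Prod>i\<in>set u. ennreal (1 / real n))"
        using J slot_prob prob_space_uniform01
        by (intro prod.cong refl) (auto simp: finite_measure.emeasure_eq_measure prob_space.finite_measure PiE_iff)
      also have "\<dots> = ennreal (1 / real n ^ length u)"
        using u(1) by (simp add: distinct_card prod_ennreal power_one_over ennreal_power)
      finally show ?thesis
        by (simp add: measure_def)
    qed
    have ev_h: "{\<xi> \<in> space uniform_sample. h \<xi> = J} \<in> events" if J: "J \<in> ?T" for J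
    proof -
      have "{\<xi> \<in> space uniform_sample. h \<xi> = J} = {\<xi> \<in> space uniform_sample. \<forall>i\<in>set u. slot (\<xi> i) = J i}"
        using J by (auto simp: h_def restrict_def PiE_iff extensional_def fun_eq_iff)
      moreover have "Measurable.pred uniform_sample (\<lambda>\<xi>. \<forall>i\<in>set u. slot (\<xi> i) = J i)"
      proof (intro pred_intros_finite)
        fix i assume "i \<in> set u"
        then have [measurable]: "(\<lambda>\<xi>. \<xi> i) \<in> borel_measurable uniform_sample"
          using u by (intro measurable_uniform_sample) auto
        show "Measurable.pred uniform_sample (\<lambda>\<xi>. slot (\<xi> i) = J i)"
          by measurable
      qed simp
      ultimately show ?thesis
        by (simp add: pred_def)
    qed
    let ?G = "{J \<in> ?T. sorted_wrt (cluster_before (f \<circ> J) s) u}"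
    have "AE \<xi> in uniform_sample. \<forall>i\<in>set u. 0 < \<xi> i \<and> \<xi> i < 1 \<and> real n * \<xi> i \<notin> \<int>"
      using AE_slot u(2) by (intro AE_finite_allI) auto
    \<comment> \<open>Outside a null set the slots and the labels decide the order, because points
      in slots of different value are ordered like these values. The event becomes a finite disjoint
      union over slot maps.\<close>
    then have "AE \<xi> in uniform_sample. ?R \<xi> \<longleftrightarrow> h \<xi> \<in> ?G"
      using AE_uniform_sample_inj
    proof eventually_elim
      case (elim \<xi>)
      have "slot (\<xi> i) < n" if "i \<in> set u" for i
        unfolding slot_def using mono_floor_slot(2)[OF f, of "\<xi> i" "\<xi> i"] elim(1) that n by auto
      then have "h \<xi> \<in> ?T"
        by (auto simp: h_def)
      moreover have pl: "placed_left P \<xi> x y \<longleftrightarrow> cluster_before (f \<circ> h \<xi>) s x y"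
        if xy: "x \<in> set u" "y \<in> set u" "x \<noteq> y" for x y
      proof -
        have ne: "\<xi> x \<noteq> \<xi> y"
          using xy elim(2) u(2) by (auto dest: inj_onD)
        have fh: "(f \<circ> h \<xi>) x = f (slot (\<xi> x))" "(f \<circ> h \<xi>) y = f (slot (\<xi> y))"
          using xy by (simp_all add: h_def)
        have conn: "connected_component (up_set P) (\<xi> x) (\<xi> y) \<longleftrightarrow>
              f (slot (\<xi> x)) = f (slot (\<xi> y)) \<and> s (f (slot (\<xi> x)))"
            "connected_component (down_set P) (\<xi> x) (\<xi> y) \<longleftrightarrow>
              f (slot (\<xi> x)) = f (slot (\<xi> y)) \<and> \<not> s (f (slot (\<xi> x)))"
          unfolding slot_def using P[of "\<xi> x" "\<xi> y"] elim(1) xy by blast+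
        have "f (slot (\<xi> x)) < f (slot (\<xi> y)) \<longleftrightarrow> \<xi> x < \<xi> y" if "f (slot (\<xi> x)) \<noteq> f (slot (\<xi> y))"
          using mono_floor_slot(1)[OF f, of "\<xi> x" "\<xi> y"] mono_floor_slot(1)[OF f, of "\<xi> y" "\<xi> x"]
            elim(1) xy n that unfolding slot_def by (metis le_less less_asym linorder_neqE_linordered_idom not_le)
        then show ?thesis
          unfolding placed_left_def connected_component_up_down cluster_before_def fh conn
          by (cases "f (slot (\<xi> x)) = f (slot (\<xi> y))"; cases "s (f (slot (\<xi> x)))") auto
      qed
      have "?R \<xi> \<longleftrightarrow> sorted_wrt (cluster_before (f \<circ> h \<xi>) s) u"
        by (rule sorted_wrt_cong_on[OF u(1)]) (rule pl)
      ultimately show ?case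
        by simp
    qed
    then have AE: "AE \<xi> in uniform_sample. \<xi> \<in> {\<xi> \<in> space uniform_sample. ?R \<xi>} \<longleftrightarrow>
        \<xi> \<in> (\<Union>J\<in>?G. {\<xi> \<in> space uniform_sample. h \<xi> = J})"
      by (rule AE_mp) (auto intro!: AE_I2)
    have finG: "finite ?G"
      using finT by simp
    have "paintbox_prob P u = prob (\<Union>J\<in>?G. {\<xi> \<in> space uniform_sample. h \<xi> = J})"
      unfolding paintbox_prob_def
      by (rule measure_eq_AE[OF AE]) (use u ev_h finG in \<open>auto intro!: sorted_placed_left_event sets.finite_UN\<close>)
    also have "\<dots> = (\<Sum>J\<in>?G. prob {\<xi> \<in> space uniform_sample. h \<xi> = J})"
      by (rule finite_measure_finite_Union[OF finG]) (use ev_h in \<open>auto simp: disjoint_family_on_def\<close>)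
    also have "\<dots> = (\<Sum>J\<in>?G. 1 / real n ^ length u)"
      using prob_h by (intro sum.cong) auto
    also have "\<dots> = (\<Sum>J\<in>?T. of_bool (sorted_wrt (cluster_before (f \<circ> J) s) u) / real n ^ length u)"
      by (rule sum.mono_neutral_cong_left) (use finT in auto)
    finally show "paintbox_prob P u = (\<Sum>J\<in>?T. of_bool (sorted_wrt (cluster_before (f \<circ> J) s) u)) / real n ^ length u"
      by (simp add: sum_divide_distrib)
  qed
qed

section \<open>Rarity of clusters that are not monotone, and approximation by paintboxes\<close>

context cluster_setup
begin

lemma not_good_imp:
  assumes w: "w \<in> words" "\<not> good w"
  obtains x y z where "x \<in> A" "y \<in> A" "z \<in> A" "x \<noteq> z" "between w x y z"
    "\<And>e. e \<in> E \<Longrightarrow> \<not> between w x e z" "x < y \<and> z < y \<or> y < x \<and> y < z"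
proof -
  note ord = left_of_order[OF words_props(1)[OF w(1)]]
  obtain v where v: "\<not> rising w v" "\<not> falling w v"
    using w(2) by (auto simp: good_def)
  let ?C = "{i \<in> A. cluster w i = v}"
  have "\<not> ((\<forall>x\<in>?C. \<forall>y\<in>?C. left_of w x y \<longrightarrow> x < y) \<or> (\<forall>x\<in>?C. \<forall>y\<in>?C. left_of w x y \<longrightarrow> y < x))"
    using v unfolding rising_def falling_def by blast
  moreover have "left_of w x y \<or> left_of w y x" if "x \<in> ?C" "y \<in> ?C" "x \<noteq> y" for x y
    using ord(3)[of x y] that words_props(2)[OF w(1)] by auto
  ultimately obtain x y z where xyz: "x \<in> ?C" "y \<in> ?C" "z \<in> ?C" "left_of w x y" "left_of w y z" "\<not> (x < y \<longleftrightarrow> y < z)"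
    using monotone_if_no_peak_or_valley[of ?C "left_of w"] ord(1,4) by blast
  have xz: "left_of w x z"
    using ord(4) xyz by blast
  have neq: "x \<noteq> z" "x \<noteq> y" "y \<noteq> z"
    using ord(1) xz xyz by blast+
  have "\<not> between w x e z" if e: "e \<in> E" for e
  proof
    assume "between w x e z"
    moreover have "\<not> (left_of w z e \<and> left_of w e x)"
      using ord(4)[of z e x] ord(2)[OF xz] by blast
    ultimately have "left_of w x e" "left_of w e z"
      unfolding between_def by blast+
    moreover have "e \<noteq> x" "e \<noteq> z"
      using e xyz disjoint by auto
    ultimately have "cluster w x < cluster w z"
      using cluster_mono(2)[OF w(1) xz] e by blast
    then show False
      using xyz by simp
  qed
  then show thesis
    using that[of x y z] xyz neq by (auto simp: between_def)
qed

text \<open>Which labels of \<open>F\<close> stand between \<open>x\<close> and \<open>z\<close> can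
  be read off after deleting all other labels, so the estimate for \<open>F\<close> with
  \<open>x\<close> and \<open>z\<close> alone applies.\<close>

lemma event_prob:
  assumes p: "p \<in> harmonic_functions" and F: "F \<subseteq> A \<union> E" "y \<in> F" and xz: "x \<in> A" "z \<in> A" "x \<noteq> z"
    and sep: "(\<forall>g\<in>F. x < g \<and> z < g) \<or> (\<forall>g\<in>F. g < x \<and> g < z)"
  shows "(\<Sum>w\<in>words. of_bool (\<forall>g\<in>F. between w x g z \<longleftrightarrow> g = y) * p (zs w)) \<le> 1 / card F"
proof -
  have finF: "finite F"
    using F(1) finite by (blast intro: finite_subset)
  let ?S = "F \<union> {x, z}"
  have S: "?S \<union> (A \<union> E - ?S) = A \<union> E"
    using F xz by auto
  let ?g = "\<lambda>w. of_bool (\<forall>g\<in>F. between w x g z \<longleftrightarrow> g = y) :: real"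
  have "?g (filter (\<lambda>i. i \<in> ?S) w) = ?g w" if "w \<in> words" for w
    using words_props(1)[OF that] by (auto simp: between_def left_of_filter)
  then have "(\<Sum>w\<in>words. ?g w * p (zs w)) = (\<Sum>w\<in>permutations_of_set (?S \<union> (A \<union> E - ?S)). ?g (filter (\<lambda>i. i \<in> ?S) w) * p (zs w))"
    unfolding S by (intro sum.cong) auto
  also have "\<dots> = (\<Sum>w\<in>permutations_of_set ?S. ?g w * p (zs w))"
    by (rule harmonic_marginal[OF p]) (use finF finite in auto)
  also have "\<dots> \<le> 1 / card F"
    by (rule only_between_prob[OF p finF F(2) xz(3) sep])
  finally show ?thesis .
qed

text \<open>A peak \<open>y\<close> over \<open>x\<close> and \<open>z\<close> is one of at least
  \<open>Suc N\<close> labels in \<open>insert y H\<close> that all exceed \<open>x\<close> and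
  \<open>z\<close>, and it is the only one of them in between; a valley is treated with
  \<open>L\<close>. Hence each kind has probability at most 1 / \<open>Suc N\<close>, and a union
  bound over the triples from \<open>A\<close> gives the two factors in the numerator.\<close>

lemma not_good_prob:
  assumes p: "p \<in> harmonic_functions"
    and L: "L \<subseteq> E" "\<And>e i. e \<in> L \<Longrightarrow> i \<in> A \<Longrightarrow> e < i" "N \<le> card L"
    and H: "H \<subseteq> E" "\<And>e i. e \<in> H \<Longrightarrow> i \<in> A \<Longrightarrow> i < e" "N \<le> card H"
  shows "(\<Sum>w\<in>words. of_bool (\<not> good w) * p (zs w)) \<le> 2 * real (card A) ^ 3 / real (Suc N)"
proof -
  let ?T = "A \<times> A \<times> A"
  define ev where "ev F t w \<longleftrightarrow> (\<forall>g\<in>F. between w (fst t) g (snd (snd t)) \<longleftrightarrow> g = fst (snd t))" for F t w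
  define pk where "pk t \<longleftrightarrow> fst t \<noteq> snd (snd t) \<and> fst t < fst (snd t) \<and> snd (snd t) < fst (snd t)" for t :: "nat \<times> nat \<times> nat"
  define vl where "vl t \<longleftrightarrow> fst t \<noteq> snd (snd t) \<and> fst (snd t) < fst t \<and> fst (snd t) < snd (snd t)" for t :: "nat \<times> nat \<times> nat"
  define q where "q t w = (of_bool (pk t \<and> ev (insert (fst (snd t)) H) t w) +
      of_bool (vl t \<and> ev (insert (fst (snd t)) L) t w) :: real)" for t w
  have LH: "finite L" "finite H" "A \<inter> L = {}" "A \<inter> H = {}"
    using L(1) H(1) finite disjoint by (auto intro: finite_subset)
  have q_nonneg: "0 \<le> q t w" for t w
    by (simp add: q_def)
  have finT: "finite ?T"
    using finite by simp
  have le: "of_bool (\<not> good w) \<le> (\<Sum>t\<in>?T. q t w)" if w: "w \<in> words" for w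
  proof (cases "good w")
    case False
    then obtain x y z where xyz: "x \<in> A" "y \<in> A" "z \<in> A" "x \<noteq> z" "between w x y z"
      "\<And>e. e \<in> E \<Longrightarrow> \<not> between w x e z" "x < y \<and> z < y \<or> y < x \<and> y < z"
      using not_good_imp[OF w] by metis
    have "ev (insert y H) (x, y, z) w" "ev (insert y L) (x, y, z) w"
      using xyz(2,5,6) L(1) H(1) LH unfolding ev_def by auto
    then have "1 \<le> q (x, y, z) w"
      using xyz(4,7) by (auto simp: q_def pk_def vl_def)
    also have "\<dots> \<le> (\<Sum>t\<in>?T. q t w)"
      using member_le_sum[of "(x, y, z)" ?T "\<lambda>t. q t w"] q_nonneg finT xyz(1-3) by auto
    finally show ?thesis
      by simp
  qed (use q_nonneg in \<open>simp add: sum_nonneg\<close>)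
  have "(\<Sum>w\<in>words. of_bool (\<not> good w) * p (zs w)) \<le> (\<Sum>w\<in>words. (\<Sum>t\<in>?T. q t w) * p (zs w))"
    by (rule sum_mono, rule mult_right_mono[OF le harmonicD(1)[OF p]])
  also have "\<dots> = (\<Sum>t\<in>?T. (\<Sum>w\<in>words. q t w * p (zs w)))"
    by (subst sum.swap) (simp add: sum_distrib_right)
  also have "\<dots> \<le> (\<Sum>t\<in>?T. 2 / real (Suc N))"
  proof (rule sum_mono)
    fix t assume t: "t \<in> ?T"
    obtain x y z where xyz: "t = (x, y, z)" "x \<in> A" "y \<in> A" "z \<in> A"
      using t by auto
    have 1: "(\<Sum>w\<in>words. of_bool (pk t \<and> ev (insert y H) t w) * p (zs w)) \<le> 1 / real (Suc N)"
    proof (cases "pk t")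
      case True
      then have "(\<Sum>w\<in>words. of_bool (ev (insert y H) t w) * p (zs w)) \<le> 1 / card (insert y H)"
        unfolding ev_def using xyz H by (simp only: fst_conv snd_conv, intro event_prob[OF p]) (auto simp: pk_def)
      also have "\<dots> \<le> 1 / real (Suc N)"
        using H(3) LH xyz(3) by (intro divide_left_mono) (auto simp: card_insert_if)
      finally show ?thesis
        using True by simp
    qed simp
    have 2: "(\<Sum>w\<in>words. of_bool (vl t \<and> ev (insert y L) t w) * p (zs w)) \<le> 1 / real (Suc N)"
    proof (cases "vl t")
      case True
      then have "(\<Sum>w\<in>words. of_bool (ev (insert y L) t w) * p (zs w)) \<le> 1 / card (insert y L)"
        unfolding ev_def using xyz L by (simp only: fst_conv snd_conv, intro event_prob[OF p]) (auto simp: vl_def)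
      also have "\<dots> \<le> 1 / real (Suc N)"
        using L(3) LH xyz(3) by (intro divide_left_mono) (auto simp: card_insert_if)
      finally show ?thesis
        using True by simp
    qed simp
    show "(\<Sum>w\<in>words. q t w * p (zs w)) \<le> 2 / real (Suc N)"
      using 1 2 xyz(1) by (simp add: q_def distrib_right sum.distrib)
  qed
  also have "\<dots> = 2 * real (card A) ^ 3 / real (Suc N)"
    by (simp add: card_cartesian_product power3_eq_cube)
  finally show ?thesis .
qed

text \<open>Each word gives the step paintbox of its cluster map. Its probability for
  \<open>u\<close> averages over all maps from the letters of \<open>u\<close> to \<open>A\<close>,
  whereas \<open>p (zs u)\<close> corresponds to the identity map. Injection invariance equates the
  identity with every injective map, and \<open>average_injective_close\<close> controls the
  rest.\<close>

lemma exists_paintbox_approx: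
  assumes p: "p \<in> harmonic_functions" and A: "A \<noteq> {}" "A \<subseteq> {1..}"
  shows "\<exists>U :: nat list \<Rightarrow> paintbox. \<forall>u. distinct u \<longrightarrow> set u \<subseteq> A \<longrightarrow>
    \<bar>(\<Sum>w\<in>words. p (zs w) * paintbox_prob (U w) u) - p (zs u)\<bar> \<le>
      real (length u) ^ 2 / real (card A) + 2 * (\<Sum>w\<in>words. of_bool (\<not> good w) * p (zs w))"
proof -
  let ?n = "card A"
  have n: "0 < ?n"
    using A finite by (simp add: card_gt_0_iff)
  \<comment> \<open>The labels of \<open>A\<close>, listed by increasing cluster, become the slots;
    this makes the cluster a monotone function of the slot, as the step paintbox demands.\<close>
  define e where "e w k = sort_key (cluster w) (sorted_list_of_set A) ! k" for w k
  have e: "bij_betw (e w) {..<?n} A" "mono_on {..<?n} (cluster w \<circ> e w)" for w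
  proof -
    let ?xs = "sort_key (cluster w) (sorted_list_of_set A)"
    have len: "length ?xs = ?n" "distinct ?xs" "set ?xs = A"
      using finite by auto
    then show "bij_betw (e w) {..<?n} A"
      unfolding e_def by (metis bij_betw_nth)
    have "sorted (map (cluster w) ?xs)"
      by simp
    then show "mono_on {..<?n} (cluster w \<circ> e w)"
      using len(1) by (auto simp: mono_on_def e_def sorted_iff_nth_mono)
  qed
  have "\<exists>P. \<forall>u. distinct u \<longrightarrow> set u \<subseteq> {1..} \<longrightarrow> paintbox_prob P u =
    (\<Sum>K\<in>set u \<rightarrow>\<^sub>E {..<?n}. of_bool (sorted_wrt (cluster_before (cluster w \<circ> e w \<circ> K) (rising w)) u)) / real ?n ^ length u" for w
    using step_paintbox_prob[OF e(2)[of w] n, of "rising w"] by metis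
  then obtain U where U: "\<And>w u. distinct u \<Longrightarrow> set u \<subseteq> {1..} \<Longrightarrow> paintbox_prob (U w) u =
    (\<Sum>K\<in>set u \<rightarrow>\<^sub>E {..<?n}. of_bool (sorted_wrt (cluster_before (cluster w \<circ> e w \<circ> K) (rising w)) u)) / real ?n ^ length u"
    by metis
  let ?bad = "\<Sum>w\<in>words. of_bool (\<not> good w) * p (zs w)"
  have pos: "0 \<le> p \<mu>" for \<mu>
    by (rule harmonicD(1)[OF p])
  have total: "(\<Sum>w\<in>words. p (zs w)) = 1"
    by (rule harmonic_sum_eq_1[OF p]) (use finite in simp)
  show ?thesis
  proof (intro exI allI impI)
    fix u :: "nat list" assume u: "distinct u" "set u \<subseteq> A"
    let ?B = "set u"
    define T where "T w J = (of_bool (sorted_wrt (cluster_before (cluster w \<circ> J) (rising w)) u) :: real)" for w J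
    have T01: "0 \<le> T w J" "T w J \<le> 1" for w J
      by (auto simp: T_def)
    have T_restrict: "T w J = of_bool (sorted_wrt (cluster_before (restrict (cluster w \<circ> J) ?B) (rising w)) u)" for w J
      unfolding T_def using u(1) by (intro arg_cong[of _ _ of_bool] sorted_wrt_cong_on) (auto simp: cluster_before_def)
    have prob_U: "paintbox_prob (U w) u = (\<Sum>J\<in>?B \<rightarrow>\<^sub>E A. T w J) / real ?n ^ length u" for w
    proof -
      have "(\<Sum>J\<in>?B \<rightarrow>\<^sub>E A. T w J) = (\<Sum>K\<in>?B \<rightarrow>\<^sub>E {..<?n}. T w (e w \<circ> K))"
      proof (rule sum.reindex_bij_witness[where
            i = "\<lambda>K. restrict (e w \<circ> K) ?B" and j = "\<lambda>J. restrict (inv_into {..<?n} (e w) \<circ> J) ?B"])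
        fix J assume J: "J \<in> ?B \<rightarrow>\<^sub>E A"
        have inv: "e w (inv_into {..<?n} (e w) x) = x" "inv_into {..<?n} (e w) x \<in> {..<?n}" if "x \<in> A" for x
          using bij_betw_inv_into_right[OF e(1) that] bij_betwE[OF bij_betw_inv_into[OF e(1)]] that by auto
        have JA: "J i \<in> A" if "i \<in> ?B" for i
          using J that by auto
        show "restrict (inv_into {..<?n} (e w) \<circ> J) ?B \<in> ?B \<rightarrow>\<^sub>E {..<?n}"
          using inv(2) JA by (simp add: PiE_iff)
        show "restrict (e w \<circ> restrict (inv_into {..<?n} (e w) \<circ> J) ?B) ?B = J"
        proof
          fix i show "restrict (e w \<circ> restrict (inv_into {..<?n} (e w) \<circ> J) ?B) ?B i = J i"
          proof (cases "i \<in> ?B")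
            case True
            then show ?thesis
              using inv(1)[OF JA[OF True]] by simp
          next
            case False
            then show ?thesis
              using PiE_arb[OF J False] by simp
          qed
        qed
        show "T w (e w \<circ> restrict (inv_into {..<?n} (e w) \<circ> J) ?B) = T w J"
          unfolding T_restrict using inv(1) JA by (intro arg_cong[of _ _ "\<lambda>c. of_bool (sorted_wrt (cluster_before c (rising w)) u)"]) (auto simp: restrict_def fun_eq_iff)
      next
        fix K assume K: "K \<in> ?B \<rightarrow>\<^sub>E {..<?n}"
        have KA: "K i \<in> {..<?n}" if "i \<in> ?B" for i
          using K that by auto
        show "restrict (e w \<circ> K) ?B \<in> ?B \<rightarrow>\<^sub>E A"
          using KA bij_betwE[OF e(1)[of w]] by (simp add: PiE_iff)
        show "restrict (inv_into {..<?n} (e w) \<circ> restrict (e w \<circ> K) ?B) ?B = K"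
        proof
          fix i show "restrict (inv_into {..<?n} (e w) \<circ> restrict (e w \<circ> K) ?B) ?B i = K i"
          proof (cases "i \<in> ?B")
            case True
            then show ?thesis
              using bij_betw_inv_into_left[OF e(1) KA[OF True]] by simp
          next
            case False
            then show ?thesis
              using PiE_arb[OF K False] by simp
          qed
        qed
      qed
      then show ?thesis
        using U[OF u(1), of w] u(2) A(2) by (simp add: T_def comp_assoc)
    qed
    \<comment> \<open>The letters of \<open>u\<close> take their clusters from the labels
      \<open>J i\<close>, but inside a cluster their own labels are compared. This mirrors the
      paintbox rule, where position and label of a sample point are unrelated.\<close>
    define a where "a J = (\<Sum>w\<in>words. of_bool (good w) * T w J * p (zs w))" for J
    have a_inj: "a J = a (\<lambda>i. i)" if "J \<in> ?B \<rightarrow>\<^sub>E A" "inj_on J ?B" for J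
      unfolding a_def T_restrict
      using injection_invariant[OF that(2) _ u(2), where p = p and
          h = "\<lambda>c s g. of_bool g * of_bool (sorted_wrt (cluster_before c s) u)"] that(1)
      by (simp add: comp_def image_subset_iff PiE_iff)
    have a01: "0 \<le> a J" "a J \<le> 1" for J
    proof -
      show "0 \<le> a J"
        unfolding a_def using T01 pos by (intro sum_nonneg) auto
      have "a J \<le> (\<Sum>w\<in>words. p (zs w))"
        unfolding a_def using T01 pos by (intro sum_mono mult_left_le_one_le) (auto simp: of_bool_def)
      then show "a J \<le> 1"
        using total by simp
    qed
    have close: "\<bar>(\<Sum>J\<in>?B \<rightarrow>\<^sub>E A. a J) / real ?n ^ card ?B - a (\<lambda>i. i)\<bar> \<le> real (card ?B) ^ 2 / real ?n"
      by (rule average_injective_close) (use finite A a01 a_inj in auto)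
    have card_B: "card ?B = length u"
      using u(1) by (rule distinct_card)
    have avg: "(\<Sum>J\<in>?B \<rightarrow>\<^sub>E A. a J) / real ?n ^ length u = (\<Sum>w\<in>words. of_bool (good w) * p (zs w) * paintbox_prob (U w) u)"
      unfolding a_def prob_U by (subst sum.swap) (simp add: sum_divide_distrib sum_distrib_left mult_ac)
    have prob01: "0 \<le> paintbox_prob (U w) u" "paintbox_prob (U w) u \<le> 1" for w
      using prob_space.prob_le_1[OF prob_space_uniform_sample] by (auto simp: paintbox_prob_def)
    \<comment> \<open>Words that are not good cost at most \<open>?bad\<close> here, and once more
      when \<open>a (\<lambda>i. i)\<close> is compared with \<open>p (zs u)\<close>; hence the
      factor 2 in the bound.\<close>
    have "(\<Sum>w\<in>words. p (zs w) * paintbox_prob (U w) u) =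
        (\<Sum>w\<in>words. of_bool (good w) * p (zs w) * paintbox_prob (U w) u) +
        (\<Sum>w\<in>words. of_bool (\<not> good w) * p (zs w) * paintbox_prob (U w) u)"
      by (simp only: sum.distrib[symmetric]) (auto intro!: sum.cong)
    moreover have "0 \<le> (\<Sum>w\<in>words. of_bool (\<not> good w) * p (zs w) * paintbox_prob (U w) u)"
      using pos prob01 by (intro sum_nonneg) auto
    moreover have "(\<Sum>w\<in>words. of_bool (\<not> good w) * p (zs w) * paintbox_prob (U w) u) \<le> ?bad"
      using pos prob01 by (intro sum_mono mult_right_le_one_le) auto
    ultimately have 1: "\<bar>(\<Sum>w\<in>words. p (zs w) * paintbox_prob (U w) u) - (\<Sum>J\<in>?B \<rightarrow>\<^sub>E A. a J) / real ?n ^ length u\<bar> \<le> ?bad"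
      unfolding avg by linarith
    have pu: "p (zs u) = (\<Sum>w\<in>words. of_bool (filter (\<lambda>i. i \<in> ?B) w = u) * p (zs w))"
    proof -
      have S: "?B \<union> (A \<union> E - ?B) = A \<union> E"
        using u by auto
      have "(\<Sum>w\<in>words. of_bool (filter (\<lambda>i. i \<in> ?B) w = u) * p (zs w)) =
          (\<Sum>v\<in>permutations_of_set ?B. of_bool (v = u) * p (zs v))"
        using harmonic_marginal[OF p, of ?B "A \<union> E - ?B" "\<lambda>v. of_bool (v = u)"] finite unfolding S by auto
      also have "\<dots> = (\<Sum>v\<in>permutations_of_set ?B. if v = u then p (zs v) else 0)"
        by (intro sum.cong) auto
      also have "\<dots> = p (zs u)"
      proof -
        have "u \<in> permutations_of_set ?B"
          using u(1) by (simp add: permutations_of_set_def)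
        then show ?thesis
          by (simp add: sum.delta)
      qed
      finally show ?thesis ..
    qed
    \<comment> \<open>For the identity map, clusters and labels belong together, so on good words
      the event says exactly that \<open>w\<close> restricts to \<open>u\<close>.\<close>
    have V: "a (\<lambda>i. i) = (\<Sum>w\<in>words. of_bool (good w) * of_bool (filter (\<lambda>i. i \<in> ?B) w = u) * p (zs w))"
      unfolding a_def
    proof (rule sum.cong[OF refl])
      fix w assume w: "w \<in> words"
      have "sorted_wrt (cluster_before (cluster w \<circ> (\<lambda>i. i)) (rising w)) u \<longleftrightarrow> filter (\<lambda>i. i \<in> ?B) w = u" if "good w"
      proof -
        have "filter (\<lambda>i. i \<in> ?B) w = u \<longleftrightarrow> sorted_wrt (left_of w) u"
          by (rule filter_eq_iff_sorted) (use u words_props[OF w] in auto)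
        also have "\<dots> \<longleftrightarrow> sorted_wrt (cluster_before (cluster w) (rising w)) u"
          by (rule sorted_wrt_cong_on[OF u(1)], rule left_of_iff_cluster_before[OF w that]) (use u in auto)
        finally show ?thesis
          by (simp add: comp_def)
      qed
      then show "of_bool (good w) * T w (\<lambda>i. i) * p (zs w) =
          of_bool (good w) * of_bool (filter (\<lambda>i. i \<in> ?B) w = u) * p (zs w)"
        by (cases "good w") (simp_all add: T_def)
    qed
    have "p (zs u) = a (\<lambda>i. i) + (\<Sum>w\<in>words. of_bool (\<not> good w) * of_bool (filter (\<lambda>i. i \<in> ?B) w = u) * p (zs w))"
      unfolding pu V by (subst sum.distrib[symmetric], rule sum.cong[OF refl]) (simp add: of_bool_def)
    moreover have "0 \<le> (\<Sum>w\<in>words. of_bool (\<not> good w) * of_bool (filter (\<lambda>i. i \<in> ?B) w = u) * p (zs w))"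
      using pos by (intro sum_nonneg) auto
    moreover have "(\<Sum>w\<in>words. of_bool (\<not> good w) * of_bool (filter (\<lambda>i. i \<in> ?B) w = u) * p (zs w)) \<le> ?bad"
      using pos by (intro sum_mono mult_right_mono) auto
    ultimately have 2: "\<bar>a (\<lambda>i. i) - p (zs u)\<bar> \<le> ?bad"
      by linarith
    show "\<bar>(\<Sum>w\<in>words. p (zs w) * paintbox_prob (U w) u) - p (zs u)\<bar> \<le>
        real (length u) ^ 2 / real (card A) + 2 * ?bad"
      using 1 2 close unfolding card_B by linarith
  qed
qed

end

lemma harmonic_paintbox_approx:
  assumes p: "p \<in> harmonic_functions" and n: "0 < n"
  shows "\<exists>(W :: nat list set) (U :: nat list \<Rightarrow> paintbox). finite W \<and> (\<Sum>w\<in>W. p (zs w)) = 1 \<and>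
    (\<forall>m. \<forall>u\<in>perms m. m \<le> n \<longrightarrow>
      \<bar>(\<Sum>w\<in>W. p (zs w) * paintbox_function (U w) (zs u)) - p (zs u)\<bar> \<le> (real m ^ 2 + 4) / real n)"
proof -
  \<comment> \<open>The fourth power beats the number of triples: words that are not good have total
    weight at most 2 / n. Counted twice this gives the 4 in the final bound.\<close>
  define N where "N = n ^ 4"
  define A where "A = {N+1..N+n}"
  define L where "L = {1..N}"
  define H where "H = {N+n+1..2*N+n}"
  interpret cluster_setup A "L \<union> H"
    by unfold_locales (auto simp: A_def L_def H_def)
  have A: "A \<noteq> {}" "A \<subseteq> {1..}" "card A = n"
    using n by (auto simp: A_def)
  have "(\<Sum>w\<in>words. of_bool (\<not> good w) * p (zs w)) \<le> 2 * real (card A) ^ 3 / real (Suc N)"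
    by (rule not_good_prob[OF p, of L N H]) (auto simp: A_def L_def H_def)
  also have "\<dots> \<le> 2 / real n"
  proof -
    have "real n ^ 3 * real n \<le> real (Suc N)"
      by (simp add: N_def power_Suc[symmetric] power_add[symmetric] eval_nat_numeral)
    then show ?thesis
      using n A(3) by (simp add: field_simps)
  qed
  finally have bad: "(\<Sum>w\<in>words. of_bool (\<not> good w) * p (zs w)) \<le> 2 / real n" .
  obtain U where U: "\<And>u. distinct u \<Longrightarrow> set u \<subseteq> A \<Longrightarrow>
    \<bar>(\<Sum>w\<in>words. p (zs w) * paintbox_prob (U w) u) - p (zs u)\<bar> \<le>
      real (length u) ^ 2 / real (card A) + 2 * (\<Sum>w\<in>words. of_bool (\<not> good w) * p (zs w))"
    using exists_paintbox_approx[OF p A(1,2)] by blast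
  have "\<bar>(\<Sum>w\<in>words. p (zs w) * paintbox_function (U w) (zs u)) - p (zs u)\<bar> \<le> (real m ^ 2 + 4) / real n"
    if u: "u \<in> perms m" "m \<le> n" for u m
  proof -
    \<comment> \<open>Adding \<open>N\<close> moves the word into the middle block without changing
      its shape; \<open>m \<le> n\<close> keeps it inside.\<close>
    let ?v = "map (\<lambda>i. N + i) u"
    have du: "distinct u" "set u = {1..m}" "length u = m"
      using u(1) by (auto simp: permutations_of_set_def length_finite_permutations_of_set[OF u(1)])
    have v: "distinct ?v" "set ?v \<subseteq> A" "length ?v = m" "set ?v \<subseteq> {1..}"
      using du u(2) by (auto simp: distinct_map A_def)
    have zs_v: "zs ?v = zs u"
      by (rule zs_eqI) auto
    have "paintbox_function (U w) (zs u) = paintbox_prob (U w) ?v" for w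
      using paintbox_function_zs[OF v(1,4)] zs_v by simp
    then show ?thesis
      using U[OF v(1,2)] bad zs_v v(3) A(3) n by (simp add: add_divide_distrib)
  qed
  moreover have "(\<Sum>w\<in>words. p (zs w)) = 1"
    by (rule harmonic_sum_eq_1[OF p]) (simp add: A_def L_def H_def)
  moreover have "finite words"
    by (simp add: A_def L_def H_def)
  ultimately show ?thesis
    by blast
qed

section \<open>Continuity and injectivity of the paintbox map\<close>

abbreviation gap_endpoints :: "real set \<Rightarrow> real set" where
  "gap_endpoints S \<equiv> {x. x \<notin> S \<and> (\<exists>y>x. {x<..<y} \<subseteq> S)} \<union> {y. y \<notin> S \<and> (\<exists>x<y. {x<..<y} \<subseteq> S)}"

text \<open>The unstable situation is an interval that meets the complement of \<open>S P\<close>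
  only in its own endpoints, and these are then gap endpoints. Otherwise either the whole closed
  interval is covered or some point strictly inside is missing, and both persist for nearby
  paintboxes.\<close>

lemma eventually_connected_iff:
  assumes S: "S \<in> {up_set, down_set}" and xy: "x \<in> {0..1}" "y \<in> {0..1}" "x \<noteq> y"
    and ends: "x \<notin> gap_endpoints (S P)" "y \<notin> gap_endpoints (S P)"
  shows "\<forall>\<^sub>F Q in nhds P. connected_component (S Q) x y \<longleftrightarrow> connected_component (S P) x y"
proof -
  define a b where "a = min x y" and "b = max x y"
  have ab: "a < b" "0 \<le> a" "b \<le> 1" and ab_cases: "a = x \<and> b = y \<or> a = y \<and> b = x"
    using xy by (auto simp: a_def b_def min_def max_def)
  have conn: "connected_component T x y \<longleftrightarrow> {a..b} \<subseteq> T" for T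
    by (simp add: connected_component_real_iff a_def b_def)
  show ?thesis
  proof (cases "{a..b} \<subseteq> S P")
    case True
    then have "\<forall>\<^sub>F Q in nhds P. {a..b} \<subseteq> S Q"
      using open_contains_Icc[OF S, of a b] by (auto simp: eventually_nhds)
    then show ?thesis
      unfolding conn by (rule eventually_mono) (use True in simp)
  next
    case False
    have "\<exists>c. a < c \<and> c < b \<and> c \<notin> S P"
    proof (rule ccontr)
      assume "\<not> ?thesis"
      then have sub: "{a<..<b} \<subseteq> S P"
        by auto
      obtain c where c: "c \<in> {a..b}" "c \<notin> S P"
        using False by blast
      then have "c = a \<or> c = b"
        using sub by (force simp: less_le)
      then have "a \<in> gap_endpoints (S P) \<or> b \<in> gap_endpoints (S P)"
        using sub ab(1) c(2) by blast
      then show False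
        using ends ab_cases by blast
    qed
    then obtain c where "a < c" "c < b" "c \<notin> S P"
      by blast
    then have "\<forall>\<^sub>F Q in nhds P. \<not> {a..b} \<subseteq> S Q"
      using ab by (intro eventually_not_contains_Icc[OF S, of c]) auto
    then show ?thesis
      unfolding conn by (rule eventually_mono) (use False in simp)
  qed
qed

text \<open>For almost every sample the order of finitely many labels is eventually constant along a
  convergent sequence of paintboxes, and dominated convergence transfers this to
  probabilities.\<close>

lemma continuous_paintbox_prob:
  assumes w: "distinct w" "set w \<subseteq> {1..}"
  shows "continuous_on UNIV (\<lambda>P. paintbox_prob P w)"
proof -
  note E = expectation_of_bool[OF prob_space_uniform_sample sorted_placed_left_event[OF w(2)]]
  interpret prob_space uniform_sample
    by (rule prob_space_uniform_sample)
  have "isCont (\<lambda>P. paintbox_prob P w) P" for P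
    unfolding continuous_at_sequentially
  proof (intro allI impI)
    fix X :: "nat \<Rightarrow> paintbox" assume X: "X \<longlonglongrightarrow> P"
    \<comment> \<open>The exceptional set depends on the limit paintbox only and is countable, so
      one null event of samples serves the whole sequence.\<close>
    let ?C = "gap_endpoints (up_set P) \<union> gap_endpoints (down_set P)"
    have "AE x in uniform01. x \<notin> ?C"
      by (intro AE_uniform01_countable countable_Un countable_gap_endpoints)
    with AE_uniform01_range have "AE x in uniform01. x \<in> {0..1} \<and> x \<notin> ?C"
      by eventually_elim blast
    then have "AE \<xi> in uniform_sample. \<forall>i\<in>set w. \<xi> i \<in> {0..1} \<and> \<xi> i \<notin> ?C"
      using w(2) by (intro AE_finite_allI finite_set AE_uniform_sample) auto
    then have AE: "AE \<xi> in uniform_sample. (\<lambda>k. of_bool (sorted_wrt (placed_left (X k) \<xi>) w) :: real)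
        \<longlonglongrightarrow> of_bool (sorted_wrt (placed_left P \<xi>) w)"
      using AE_uniform_sample_inj
    proof eventually_elim
      case (elim \<xi>)
      have "\<forall>\<^sub>F k in sequentially. placed_left (X k) \<xi> i j \<longleftrightarrow> placed_left P \<xi> i j"
        if ij: "i \<in> set w" "j \<in> set w" "i \<noteq> j" for i j
      proof -
        have r: "\<xi> i \<in> {0..1}" "\<xi> j \<in> {0..1}" "\<xi> i \<noteq> \<xi> j"
          and e: "\<xi> i \<notin> ?C" "\<xi> j \<notin> ?C"
          using elim ij w(2) by (auto dest: inj_onD)
        have "\<forall>\<^sub>F Q in nhds P. (connected_component (up_set Q) (\<xi> i) (\<xi> j) \<longleftrightarrow> connected_component (up_set P) (\<xi> i) (\<xi> j)) \<and>
            (connected_component (down_set Q) (\<xi> i) (\<xi> j) \<longleftrightarrow> connected_component (down_set P) (\<xi> i) (\<xi> j))"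
          by (intro eventually_conj eventually_connected_iff[of up_set, OF _ r] eventually_connected_iff[of down_set, OF _ r])
            (use e in blast)+
        then have "\<forall>\<^sub>F Q in nhds P. placed_left Q \<xi> i j \<longleftrightarrow> placed_left P \<xi> i j"
          by eventually_elim (simp add: placed_left_def connected_component_up_down)
        then show ?thesis
          by (rule eventually_compose_filterlim[OF _ X])
      qed
      then have "\<forall>\<^sub>F k in sequentially. \<forall>i\<in>set w. \<forall>j\<in>set w. i \<noteq> j \<longrightarrow> (placed_left (X k) \<xi> i j \<longleftrightarrow> placed_left P \<xi> i j)"
        by (intro eventually_ball_finite ballI finite_set) (auto intro: eventually_mono)
      then have "\<forall>\<^sub>F k in sequentially. sorted_wrt (placed_left (X k) \<xi>) w \<longleftrightarrow> sorted_wrt (placed_left P \<xi>) w"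
      proof eventually_elim
        case (elim k)
        then show ?case
          by (intro sorted_wrt_cong_on[OF w(1)]) blast
      qed
      then have "\<forall>\<^sub>F k in sequentially. (of_bool (sorted_wrt (placed_left (X k) \<xi>) w) :: real) = of_bool (sorted_wrt (placed_left P \<xi>) w)"
        by eventually_elim simp
      then show ?case
        by (rule tendsto_eventually)
    qed
    have "(\<lambda>k. LINT \<xi>|uniform_sample. (of_bool (sorted_wrt (placed_left (X k) \<xi>) w) :: real))
        \<longlonglongrightarrow> (LINT \<xi>|uniform_sample. of_bool (sorted_wrt (placed_left P \<xi>) w))"
      by (rule integral_dominated_convergence[where w = "\<lambda>_. 1"])
        (use E(1) AE in \<open>auto intro: borel_measurable_integrable\<close>)
    then show "((\<lambda>P. paintbox_prob P w) \<circ> X) \<longlonglongrightarrow> paintbox_prob P w"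
      unfolding E(2) paintbox_prob_def comp_def .
  qed
  then show ?thesis
    by (simp add: continuous_on_eq_continuous_at)
qed

lemma continuous_paintbox_function: "continuous_on UNIV (\<lambda>P. paintbox_function P \<mu>)"
proof -
  obtain w where w: "w \<in> perms (zigzag_size \<mu>)" "zs w = \<mu>"
    using exists_perm_zs by blast
  then have "distinct w" "set w \<subseteq> {1..}"
    by (auto simp: permutations_of_set_def)
  then show ?thesis
    using continuous_paintbox_prob paintbox_function_zs w(2) by (metis (no_types, lifting) continuous_on_cong)
qed

text \<open>For sets \<open>U\<close>, \<open>D\<close> of rising and falling components, \<open>before U D x\<close> is the set of sample points placed
  to the left of a point \<open>x\<close> with a larger label. Exchanging \<open>U\<close> and \<open>D\<close> turns earlier labels into later ones.\<close>

definition before :: "real set \<Rightarrow> real set \<Rightarrow> real \<Rightarrow> real set" where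
  "before U D x = {y. \<not> (connected_component U y x \<or> connected_component D y x) \<and> y < x \<or> connected_component U y x}"

definition before_mass :: "real set \<Rightarrow> real set \<Rightarrow> real \<Rightarrow> real" where
  "before_mass U D x = measure uniform01 (before U D x)"

lemma placed_left_iff_before:
  "j < i \<Longrightarrow> placed_left P \<xi> j i \<longleftrightarrow> \<xi> j \<in> before (up_set P) (down_set P) (\<xi> i)"
  "i < j \<Longrightarrow> placed_left P \<xi> j i \<longleftrightarrow> \<xi> j \<in> before (down_set P) (up_set P) (\<xi> i)"
  by (auto simp: placed_left_def before_def connected_component_up_down)

lemma measurable_before:
  fixes P :: paintbox
  shows "{z. snd z \<in> before (up_set P) (down_set P) (fst z)} \<in> sets (borel \<Otimes>\<^sub>M borel)"
    and "{z. snd z \<in> before (down_set P) (up_set P) (fst z)} \<in> sets (borel \<Otimes>\<^sub>M borel)"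
proof -
  have "Measurable.pred (borel \<Otimes>\<^sub>M borel) (\<lambda>z. snd z \<in> before (up_set P) (down_set P) (fst z))"
    "Measurable.pred (borel \<Otimes>\<^sub>M borel) (\<lambda>z. snd z \<in> before (down_set P) (up_set P) (fst z))"
    unfolding before_def mem_Collect_eq by measurable
  then show "{z. snd z \<in> before (up_set P) (down_set P) (fst z)} \<in> sets (borel \<Otimes>\<^sub>M borel)"
    "{z. snd z \<in> before (down_set P) (up_set P) (fst z)} \<in> sets (borel \<Otimes>\<^sub>M borel)"
    by (auto simp: pred_def space_pair_measure)
qed

lemma before_sets:
  "before (up_set P) (down_set P) x \<in> sets borel" "before (down_set P) (up_set P) x \<in> sets borel"
  using sets_Pair1[OF measurable_before(1), of x P] sets_Pair1[OF measurable_before(2), of x P] by (simp_all add: vimage_def)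

lemma measurable_before_mass [measurable]:
  "before_mass (up_set P) (down_set P) \<in> borel_measurable borel"
  "before_mass (down_set P) (up_set P) \<in> borel_measurable borel"
proof -
  interpret prob_space uniform01
    by (rule prob_space_uniform01)
  have sets: "sets (borel \<Otimes>\<^sub>M uniform01) = sets (borel \<Otimes>\<^sub>M borel)"
    by (intro sets_pair_measure_cong) simp_all
  have "(\<lambda>x. emeasure uniform01 (Pair x -` {z. snd z \<in> before (up_set P) (down_set P) (fst z)})) \<in> borel_measurable borel"
    "(\<lambda>x. emeasure uniform01 (Pair x -` {z. snd z \<in> before (down_set P) (up_set P) (fst z)})) \<in> borel_measurable borel"
    by (rule measurable_emeasure_Pair; simp only: sets measurable_before)+
  then show "before_mass (up_set P) (down_set P) \<in> borel_measurable borel"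
    "before_mass (down_set P) (up_set P) \<in> borel_measurable borel"
    unfolding before_mass_def[abs_def] measure_def by (simp_all add: vimage_def)
qed

lemma before_mass_range: "0 \<le> before_mass U D x" "before_mass U D x \<le> 1"
  using prob_space.prob_le_1[OF prob_space_uniform01] by (auto simp: before_mass_def)

text \<open>Condition on the sample point \<open>x\<close> of label k + 1. The k smaller labels fall
  to its left independently with probability \<open>before_mass U D x\<close>, the l larger ones
  with probability \<open>before_mass D U x\<close>. On the other side are the words in which k + 1
  stands last, so paintbox functions determine all joint moments.\<close>

lemma before_mass_moment:
  "(LINT x|uniform01. before_mass (up_set P) (down_set P) x ^ k * before_mass (down_set P) (up_set P) x ^ l) =
   (\<Sum>w | w \<in> perms (k + 1 + l) \<and> (\<forall>j\<in>{1..k} \<union> {k+2..k+1+l}. left_of w j (k + 1)). paintbox_function P (zs w))"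
proof -
  interpret prob_space uniform_sample
    by (rule prob_space_uniform_sample)
  let ?i = "k + 1" and ?J = "{1..k} \<union> {k+2..k+1+l}"
  let ?U = "up_set P" and ?D = "down_set P"
  let ?W = "{w. w \<in> perms (k + 1 + l) \<and> (\<forall>j\<in>?J. left_of w j ?i)}"
  let ?G = "{\<xi> \<in> space uniform_sample. \<forall>j\<in>?J. placed_left P \<xi> j ?i}"
  let ?R = "PiM ({1..} - {?i}) (\<lambda>_. uniform01)"
  define S where "S x j = (if j \<le> k then before ?U ?D x else before ?D ?U x)" for x :: real and j :: nat
  interpret R: product_prob_space "\<lambda>_ :: nat. uniform01" "{1..} - {?i}"
    by (intro product_prob_spaceI prob_space_uniform01)
  have pl: "placed_left P \<xi> j ?i \<longleftrightarrow> \<xi> j \<in> S (\<xi> ?i) j" if "j \<in> ?J" for \<xi> j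
    using that placed_left_iff_before[of j ?i P \<xi>] placed_left_iff_before[of ?i j P \<xi>] by (auto simp: S_def)
  have ev_pred: "Measurable.pred uniform_sample (\<lambda>\<xi>. \<forall>j\<in>?J. placed_left P \<xi> j ?i)"
    by (intro pred_intros_finite measurable_placed_left) auto
  then have ev: "?G \<in> events"
    by (rule predE)
  have "emeasure uniform_sample ?G = (\<integral>\<^sup>+\<xi>. indicator ?G \<xi> \<partial>uniform_sample)"
    using ev by simp
  also have "\<dots> = (\<integral>\<^sup>+x. (\<integral>\<^sup>+X. indicator ?G (X(?i := x)) \<partial>?R) \<partial>uniform01)"
    using ev by (intro nn_integral_uniform_sample_insert) auto
  also have "\<dots> = (\<integral>\<^sup>+x. ennreal (before_mass ?U ?D x ^ k * before_mass ?D ?U x ^ l) \<partial>uniform01)"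
  proof (rule nn_integral_cong)
    fix x :: real
    let ?B = "{X \<in> space ?R. \<forall>j\<in>?J. X j \<in> S x j}"
    have SB: "S x j \<in> sets uniform01" for j
      using before_sets by (simp add: S_def)
    have "(\<integral>\<^sup>+X. indicator ?G (X(?i := x)) \<partial>?R) = (\<integral>\<^sup>+X. indicator ?B X \<partial>?R)"
    proof (rule nn_integral_cong)
      fix X assume X: "X \<in> space ?R"
      then have "X(?i := x) \<in> space uniform_sample"
        by (auto simp: uniform_sample_def space_PiM PiE_iff extensional_def)
      moreover have "(\<forall>j\<in>?J. placed_left P (X(?i := x)) j ?i) \<longleftrightarrow> (\<forall>j\<in>?J. X j \<in> S x j)"
        by (rule ball_cong[OF refl], subst pl) auto
      ultimately show "indicator ?G (X(?i := x)) = (indicator ?B X :: ennreal)"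
        using X by (simp add: indicator_def)
    qed
    also have "\<dots> = emeasure ?R ?B"
    proof (rule nn_integral_indicator)
      have "{X \<in> space ?R. \<forall>j\<in>J. X j \<in> S x j} = prod_emb ({1..} - {?i}) (\<lambda>_. uniform01) J (Pi\<^sub>E J (S x))" for J
        by (auto simp: prod_emb_def space_PiM restrict_PiE_iff)
      moreover have "prod_emb ({1..} - {?i}) (\<lambda>_. uniform01) ?J (Pi\<^sub>E ?J (S x)) \<in> sets ?R"
        using SB by (intro sets_PiM_I) auto
      ultimately show "?B \<in> sets ?R"
        by (simp only:)
    qed
    also have "\<dots> = (\<Prod>j\<in>?J. emeasure uniform01 (S x j))"
      using SB by (intro R.emeasure_PiM_Collect) auto
    also have "\<dots> = (\<Prod>j\<in>?J. ennreal (if j \<le> k then before_mass ?U ?D x else before_mass ?D ?U x))"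
      using prob_space_uniform01
      by (intro prod.cong refl) (auto simp: S_def before_mass_def finite_measure.emeasure_eq_measure prob_space.finite_measure)
    also have "\<dots> = (\<Prod>j\<in>{1..k}. ennreal (before_mass ?U ?D x)) * (\<Prod>j\<in>{k+2..k+1+l}. ennreal (before_mass ?D ?U x))"
      by (subst prod.union_disjoint) (auto intro!: arg_cong2[of _ _ _ _ "(*)"] prod.cong)
    also have "\<dots> = ennreal (before_mass ?U ?D x ^ k * before_mass ?D ?U x ^ l)"
      using before_mass_range by (simp add: ennreal_power ennreal_mult)
    finally show "(\<integral>\<^sup>+X. indicator ?G (X(?i := x)) \<partial>?R) = ennreal (before_mass ?U ?D x ^ k * before_mass ?D ?U x ^ l)" .
  qed
  finally have emG: "emeasure uniform_sample ?G =
      (\<integral>\<^sup>+x. ennreal (before_mass ?U ?D x ^ k * before_mass ?D ?U x ^ l) \<partial>uniform01)" .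
  have lhs: "prob ?G = (LINT x|uniform01. before_mass ?U ?D x ^ k * before_mass ?D ?U x ^ l)"
  proof -
    have meas: "before_mass ?U ?D \<in> borel_measurable uniform01" "before_mass ?D ?U \<in> borel_measurable uniform01"
      by (simp_all cong: measurable_cong_sets)
    have "(LINT x|uniform01. before_mass ?U ?D x ^ k * before_mass ?D ?U x ^ l) =
        enn2real (\<integral>\<^sup>+x. ennreal (before_mass ?U ?D x ^ k * before_mass ?D ?U x ^ l) \<partial>uniform01)"
      by (rule integral_eq_nn_integral) (use meas before_mass_range in auto)
    then show ?thesis
      unfolding measure_def emG by simp
  qed
  have finW: "finite ?W"
    by simp
  let ?E = "\<lambda>w. {\<xi> \<in> space uniform_sample. sorted_wrt (placed_left P \<xi>) w}"
  have evW: "?E w \<in> events" if "w \<in> ?W" for w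
    using that by (intro sorted_placed_left_event) (auto simp: permutations_of_set_def)
  have unique: "\<exists>!w. w \<in> perms (k + 1 + l) \<and> sorted_wrt (placed_left P \<xi>) w" if "inj_on \<xi> {1..}" for \<xi>
    by (rule ex1_placed_left_word[OF that]) auto
  have left: "left_of w j ?i \<longleftrightarrow> placed_left P \<xi> j ?i"
    if w: "w \<in> perms (k + 1 + l)" "sorted_wrt (placed_left P \<xi>) w" and \<xi>: "inj_on \<xi> {1..}" and j: "j \<in> ?J" for w \<xi> j
  proof -
    have inj: "inj_on \<xi> {1..k+1+l}"
      using \<xi> by (rule inj_on_subset) auto
    have "(\<forall>a\<in>{1..k+1+l}. \<forall>b\<in>{1..k+1+l}. a \<noteq> b \<longrightarrow> (left_of w a b \<longleftrightarrow> placed_left P \<xi> a b)) \<longleftrightarrow> sorted_wrt (placed_left P \<xi>) w"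
      by (rule left_of_iff_sorted_wrt)
        (use w(1) placed_left_order(1,2)[OF inj] in \<open>auto simp: permutations_of_set_def\<close>)
    then show ?thesis
      using w(2) j by auto
  qed
  have AE: "AE \<xi> in uniform_sample. of_bool (\<forall>j\<in>?J. placed_left P \<xi> j ?i) =
      (\<Sum>w\<in>?W. of_bool (sorted_wrt (placed_left P \<xi>) w) :: real)"
    using AE_uniform_sample_inj
  proof eventually_elim
    case (elim \<xi>)
    obtain w where w: "w \<in> perms (k + 1 + l)" "sorted_wrt (placed_left P \<xi>) w"
      using unique[OF elim] by blast
    have iff: "sorted_wrt (placed_left P \<xi>) v \<longleftrightarrow> v = w" if "v \<in> ?W" for v
      using unique[OF elim] w that by blast
    have "(\<Sum>v\<in>?W. of_bool (sorted_wrt (placed_left P \<xi>) v) :: real) = (\<Sum>v\<in>?W. if v = w then 1 else 0)"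
      by (rule sum.cong[OF refl]) (simp only: iff of_bool_def)
    also have "\<dots> = of_bool (w \<in> ?W)"
      unfolding sum.delta[OF finW] of_bool_def ..
    also have "w \<in> ?W \<longleftrightarrow> (\<forall>j\<in>?J. placed_left P \<xi> j ?i)"
      using w left[OF w elim] by blast
    finally show ?case ..
  qed
  note E = expectation_of_bool[OF prob_space_uniform_sample]
  have "prob ?G = (LINT \<xi>|uniform_sample. of_bool (\<forall>j\<in>?J. placed_left P \<xi> j ?i))"
    by (rule E(2)[OF ev, symmetric])
  also have "\<dots> = (LINT \<xi>|uniform_sample. (\<Sum>w\<in>?W. of_bool (sorted_wrt (placed_left P \<xi>) w)))"
  proof (rule integral_cong_AE[OF _ _ AE])
    show "(\<lambda>\<xi>. of_bool (\<forall>j\<in>?J. placed_left P \<xi> j ?i) :: real) \<in> borel_measurable uniform_sample"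
      by (rule borel_measurable_integrable[OF E(1)[OF ev]])
    show "(\<lambda>\<xi>. \<Sum>w\<in>?W. of_bool (sorted_wrt (placed_left P \<xi>) w) :: real) \<in> borel_measurable uniform_sample"
      by (rule borel_measurable_sum, rule borel_measurable_integrable[OF E(1)[OF evW]])
  qed
  also have "\<dots> = (\<Sum>w\<in>?W. LINT \<xi>|uniform_sample. of_bool (sorted_wrt (placed_left P \<xi>) w))"
    by (rule Bochner_Integration.integral_sum, rule E(1)[OF evW])
  also have "\<dots> = (\<Sum>w\<in>?W. prob (?E w))"
    by (rule sum.cong[OF refl], rule E(2)[OF evW])
  also have "\<dots> = (\<Sum>w\<in>?W. paintbox_function P (zs w))"
    by (rule sum.cong[OF refl], subst paintbox_function_zs) (auto simp: permutations_of_set_def paintbox_prob_def)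
  finally show ?thesis
    using lhs by simp
qed

text \<open>For a paintbox and \<open>x\<close> in the unit interval, the masses
  \<open>before_mass U D x\<close> and \<open>before_mass D U x\<close> are b and a if
  \<open>x\<close> lies in a component of \<open>U\<close> with ends a < b, they are a and b in such
  a component of \<open>D\<close>, and both equal \<open>x\<close> elsewhere. The integrand is
  therefore positive exactly when \<open>x\<close> and \<open>c\<close> share a component of
  \<open>U\<close>.\<close>

lemma before_mass_determines:
  fixes U D :: "real set"
  assumes U: "open U" "U \<subseteq> {0<..<1}" and disj: "U \<inter> D = {}" and c: "0 < c" "c < 1"
    and sets: "\<And>x. before U D x \<in> sets borel" "\<And>x. before D U x \<in> sets borel"
    and meas: "before_mass U D \<in> borel_measurable borel" "before_mass D U \<in> borel_measurable borel"
  shows "0 < (LINT x|uniform01. max 0 (before_mass U D x - c) * max 0 (c - before_mass D U x)) \<longleftrightarrow> c \<in> U"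
proof -
  interpret prob_space uniform01
    by (rule prob_space_uniform01)
  let ?f = "\<lambda>x. max 0 (before_mass U D x - c) * max 0 (c - before_mass D U x)"
  have Icc: "measure uniform01 {a..b} = b - a" "measure uniform01 {a..<b} = b - a" if "0 \<le> a" "a \<le> b" "b \<le> 1" for a b
  proof -
    have "{0..1} \<inter> {a..b} = {a..b}" "{0..1} \<inter> {a..<b} = {a..<b}"
      using that by auto
    then show "measure uniform01 {a..b} = b - a" "measure uniform01 {a..<b} = b - a"
      using that by (simp_all add: measure_uniform_measure)
  qed
  have notin: "prob (S \<inter> {0..1}) = prob S" if "S \<in> sets borel" for S
    by (rule measure_eq_AE) (use AE_uniform01_range that in \<open>auto elim: eventually_mono\<close>)
  note conn = connected_component_real_iff
  have meas_f [measurable]: "?f \<in> borel_measurable borel"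
    using meas by measurable
  then have [measurable]: "?f \<in> borel_measurable uniform01"
    by (simp cong: measurable_cong_sets)
  have f01: "0 \<le> ?f x \<and> ?f x \<le> 1" for x
    using before_mass_range[of U D x] before_mass_range[of D U x] c by (auto intro!: mult_le_one)
  have int_f: "integrable uniform01 ?f"
    by (rule integrable_const_bound[of _ 1]) (use f01 in auto)
  show ?thesis
  proof
    assume "c \<in> U"
    then obtain e0 where e0: "0 < e0" "ball c e0 \<subseteq> U"
      using U(1) openE by blast
    define e where "e = e0 / 2"
    have e: "0 < e" "{c - e..c + e} \<subseteq> U"
      using e0 by (auto simp: e_def subset_iff dist_real_def)
    have "c - e \<in> U" "c + e \<in> U"
      using e by auto
    then have range: "0 < c - e" "c + e < 1"
      using U(2) by auto
    \<comment> \<open>All of \<open>{0..c + e}\<close> lies before \<open>x\<close>, while within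
      the unit interval nothing of \<open>before D U x\<close> lies beyond c - e; so both factors
      are at least \<open>e\<close>.\<close>
    have lower: "e * e \<le> ?f x" if x: "x \<in> {c - e..c + e}" for x
    proof -
      have noD: "\<not> connected_component D y x" "\<not> connected_component D x y" for y
        using x e(2) disj connected_component_in by blast+
      have "{0..c + e} \<subseteq> before U D x"
      proof
        fix y assume y: "y \<in> {0..c + e}"
        show "y \<in> before U D x"
        proof (cases "y < x")
          case False
          then have "{min y x..max y x} \<subseteq> {c - e..c + e}"
            using x y by auto
          then have "connected_component U y x"
            unfolding conn using e(2) by (rule order_trans)
          then show ?thesis by (simp add: before_def)
        qed (use noD in \<open>auto simp: before_def\<close>)
      qed
      then have "prob {0..c + e} \<le> before_mass U D x"
        unfolding before_mass_def using sets by (intro finite_measure_mono) auto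
      moreover have "before D U x \<inter> {0..1} \<subseteq> {0..c - e}"
      proof
        fix y assume y: "y \<in> before D U x \<inter> {0..1}"
        then have y': "y < x" "\<not> connected_component U y x"
          using noD by (auto simp: before_def)
        have "y \<le> c - e"
        proof (rule ccontr)
          assume "\<not> y \<le> c - e"
          then have "{min y x..max y x} \<subseteq> {c - e..c + e}"
            using x y' by auto
          then show False
            using y'(2) e(2) unfolding conn by blast
        qed
        then show "y \<in> {0..c - e}"
          using y by simp
      qed
      then have "prob (before D U x \<inter> {0..1}) \<le> prob {0..c - e}"
        by (intro finite_measure_mono) auto
      moreover have "prob {0..c + e} = c + e" "prob {0..c - e} = c - e"
        using Icc(1)[of 0 "c + e"] Icc(1)[of 0 "c - e"] range e(1) c by simp_all
      moreover have "prob (before D U x \<inter> {0..1}) = before_mass D U x"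
        unfolding before_mass_def by (rule notin[OF sets(2)])
      ultimately have "c + e \<le> before_mass U D x" "before_mass D U x \<le> c - e"
        by linarith+
      then show ?thesis
        using e(1) by (intro mult_mono) auto
    qed
    have "0 < e * e * (2 * e)"
      using e(1) by simp
    also have "\<dots> = (LINT x|uniform01. e * e * indicator {c - e..c + e} x)"
      using Icc(1)[of "c - e" "c + e"] range e(1) by simp
    also have "\<dots> \<le> (LINT x|uniform01. ?f x)"
    proof (rule integral_mono[OF _ int_f])
      show "integrable uniform01 (\<lambda>x. e * e * indicator {c - e..c + e} x)"
        by (intro integrable_mult_right integrable_real_indicator) (auto simp: emeasure_eq_measure)
      show "e * e * indicator {c - e..c + e} x \<le> ?f x" for x
        using lower[of x] f01[of x] by (auto simp: indicator_def)
    qed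
    finally show "0 < (LINT x|uniform01. ?f x)" .
  next
    assume pos: "0 < (LINT x|uniform01. ?f x)"
    show "c \<in> U"
    proof (rule ccontr)
      assume cU: "c \<notin> U"
      \<comment> \<open>No component of \<open>U\<close> crosses \<open>c\<close>. For x to the
        right of \<open>c\<close> or at \<open>c\<close> the second mass is at least
        \<open>c\<close>, and for x to its left the first mass is at most \<open>c\<close>.\<close>
      have zero: "?f x = 0" for x
      proof (cases "c \<le> x")
        case True
        have "{0..<c} \<subseteq> before D U x"
        proof
          fix y assume y: "y \<in> {0..<c}"
          then have "c \<in> {min y x..max y x}"
            using True by auto
          then have "\<not> connected_component U y x"
            unfolding conn using cU by blast
          then show "y \<in> before D U x"
            using y True by (auto simp: before_def)
        qed
        then have "prob {0..<c} \<le> before_mass D U x"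
          unfolding before_mass_def using sets by (intro finite_measure_mono) auto
        then have "c \<le> before_mass D U x"
          using Icc(2)[of 0 c] c by simp
        then show ?thesis
          by simp
      next
        case False
        have "before U D x \<inter> {0..1} \<subseteq> {0..c}"
        proof
          fix y assume y: "y \<in> before U D x \<inter> {0..1}"
          have "y \<le> c"
          proof (rule ccontr)
            assume "\<not> y \<le> c"
            then have "connected_component U y x" "c \<in> {min y x..max y x}"
              using y False by (auto simp: before_def)
            then show False
              unfolding conn using cU by blast
          qed
          then show "y \<in> {0..c}"
            using y by simp
        qed
        then have "prob (before U D x \<inter> {0..1}) \<le> prob {0..c}"
          by (intro finite_measure_mono) auto
        then have "before_mass U D x \<le> c"
          using Icc(1)[of 0 c] c notin[OF sets(1)] by (simp add: before_mass_def)
        then show ?thesis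
          by simp
      qed
      show False
        using pos unfolding zero by simp
    qed
  qed
qed

text \<open>Polynomial approximation in each of the two variables separately suffices, because only
  products of one-variable test functions are needed.\<close>

lemma integral_product_eq_if_moments_eq:
  fixes a b a' b' u v :: "real \<Rightarrow> real" and M :: "real measure"
  assumes M: "prob_space M" and meas: "a \<in> borel_measurable M" "b \<in> borel_measurable M" "a' \<in> borel_measurable M" "b' \<in> borel_measurable M"
    and range: "\<And>x. a x \<in> {0..1}" "\<And>x. b x \<in> {0..1}" "\<And>x. a' x \<in> {0..1}" "\<And>x. b' x \<in> {0..1}"
    and moments: "\<And>k l. (LINT x|M. a x ^ k * b x ^ l) = (LINT x|M. a' x ^ k * b' x ^ l)"
    and u: "continuous_on {0..1} u" "\<And>t. t \<in> {0..1} \<Longrightarrow> \<bar>u t\<bar> \<le> 1" "u \<in> borel_measurable borel"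
    and v: "continuous_on {0..1} v" "\<And>t. t \<in> {0..1} \<Longrightarrow> \<bar>v t\<bar> \<le> 1" "v \<in> borel_measurable borel"
  shows "(LINT x|M. u (a x) * v (b x)) = (LINT x|M. u (a' x) * v (b' x))"
proof -
  interpret prob_space M by fact
  note [measurable] = meas u(3) v(3)
  have "\<bar>(LINT x|M. u (a x) * v (b x)) - (LINT x|M. u (a' x) * v (b' x))\<bar> \<le> 0 + \<epsilon>" if "0 < \<epsilon>" for \<epsilon>
  proof -
    \<comment> \<open>With \<open>e\<close> at most 1 the polynomial \<open>g\<close> is bounded by
      2, so a product is off by at most e + 2 * e. This error occurs for both pairs of functions,
      hence the sixth of \<epsilon>.\<close>
    define e where "e = min 1 (\<epsilon> / 6)"
    have e: "0 < e" "e \<le> 1" "6 * e \<le> \<epsilon>"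
      using that by (auto simp: e_def)
    obtain g where g: "real_polynomial_function g" "\<And>t. t \<in> {0..1} \<Longrightarrow> \<bar>u t - g t\<bar> < e"
      using Stone_Weierstrass_real_polynomial_function[OF compact_Icc u(1) e(1)] by metis
    obtain h where h: "real_polynomial_function h" "\<And>t. t \<in> {0..1} \<Longrightarrow> \<bar>v t - h t\<bar> < e"
      using Stone_Weierstrass_real_polynomial_function[OF compact_Icc v(1) e(1)] by metis
    obtain p n q m where g_eq: "g = (\<lambda>t. \<Sum>i\<le>n. p i * t ^ i)" and h_eq: "h = (\<lambda>t. \<Sum>i\<le>m. q i * t ^ i)"
      using g(1) h(1) unfolding real_polynomial_function_iff_sum by blast
    have int_mono: "integrable M (\<lambda>x. A x ^ k * B x ^ l)"
      if [measurable]: "A \<in> borel_measurable M" "B \<in> borel_measurable M" and "\<And>x. A x \<in> {0..1}" "\<And>x. B x \<in> {0..1}" for A B :: "real \<Rightarrow> real" and k l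
    proof (rule integrable_const_bound[of _ 1])
      have "\<bar>A x ^ k * B x ^ l\<bar> \<le> 1" for x
        using that(3,4)[of x] by (auto simp: abs_mult power_abs intro!: mult_le_one power_le_one)
      then show "AE x in M. norm (A x ^ k * B x ^ l) \<le> 1"
        by simp
    qed measurable
    have gh: "(LINT x|M. g (A x) * h (B x)) = (\<Sum>i\<le>n. \<Sum>j\<le>m. p i * q j * (LINT x|M. A x ^ i * B x ^ j))"
      and int_gh: "integrable M (\<lambda>x. g (A x) * h (B x))"
      if "A \<in> borel_measurable M" "B \<in> borel_measurable M" "\<And>x. A x \<in> {0..1}" "\<And>x. B x \<in> {0..1}" for A B :: "real \<Rightarrow> real"
    proof -
      have eq: "g (A x) * h (B x) = (\<Sum>i\<le>n. \<Sum>j\<le>m. p i * q j * (A x ^ i * B x ^ j))" for x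
        by (simp add: g_eq h_eq sum_product mult_ac)
      show "(LINT x|M. g (A x) * h (B x)) = (\<Sum>i\<le>n. \<Sum>j\<le>m. p i * q j * (LINT x|M. A x ^ i * B x ^ j))"
        "integrable M (\<lambda>x. g (A x) * h (B x))"
        unfolding eq using int_mono[OF that] by simp_all
    qed
    have close: "\<bar>(LINT x|M. u (A x) * v (B x)) - (LINT x|M. g (A x) * h (B x))\<bar> \<le> 3 * e"
      if [measurable]: "A \<in> borel_measurable M" "B \<in> borel_measurable M" and AB: "\<And>x. A x \<in> {0..1}" "\<And>x. B x \<in> {0..1}" for A B :: "real \<Rightarrow> real"
    proof -
      have bound: "\<bar>u (A x) * v (B x)\<bar> \<le> 1" for x
        using u(2)[OF AB(1)[of x]] v(2)[OF AB(2)[of x]] by (simp add: abs_mult mult_le_one)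
      have int_uv: "integrable M (\<lambda>x. u (A x) * v (B x))"
        by (rule integrable_const_bound[of _ 1]) (use bound in auto)
      have diff: "\<bar>u (A x) * v (B x) - g (A x) * h (B x)\<bar> \<le> 3 * e" for x
      proof -
        have 1: "\<bar>u (A x) - g (A x)\<bar> \<le> e" "\<bar>v (B x) - h (B x)\<bar> \<le> e"
          using g(2)[OF AB(1)[of x]] h(2)[OF AB(2)[of x]] by simp_all
        have 2: "\<bar>u (A x)\<bar> \<le> 1" "\<bar>v (B x)\<bar> \<le> 1" "\<bar>g (A x)\<bar> \<le> 2"
          using u(2)[OF AB(1)[of x]] v(2)[OF AB(2)[of x]] 1 e(2) by linarith+
        have "u (A x) * v (B x) - g (A x) * h (B x) = (u (A x) - g (A x)) * v (B x) + g (A x) * (v (B x) - h (B x))"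
          by (simp add: algebra_simps)
        also have "\<bar>\<dots>\<bar> \<le> \<bar>u (A x) - g (A x)\<bar> * \<bar>v (B x)\<bar> + \<bar>g (A x)\<bar> * \<bar>v (B x) - h (B x)\<bar>"
          by (metis abs_mult abs_triangle_ineq)
        also have "\<dots> \<le> e * 1 + 2 * e"
          using 1 2 e(1) by (intro add_mono mult_mono) auto
        finally show ?thesis
          by simp
      qed
      have "(LINT x|M. u (A x) * v (B x)) - (LINT x|M. g (A x) * h (B x)) = (LINT x|M. u (A x) * v (B x) - g (A x) * h (B x))"
        using int_uv int_gh[OF that] by simp
      also have "\<bar>\<dots>\<bar> \<le> (LINT x|M. \<bar>u (A x) * v (B x) - g (A x) * h (B x)\<bar>)"
        by (rule integral_abs_bound)
      also have "\<dots> \<le> (LINT x|M. 3 * e)"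
        by (rule integral_mono) (use int_uv int_gh[OF that] diff in auto)
      finally show ?thesis
        by (simp add: prob_space)
    qed
    have "(LINT x|M. g (a x) * h (b x)) = (LINT x|M. g (a' x) * h (b' x))"
      using gh[OF meas(1,2) range(1,2)] gh[OF meas(3,4) range(3,4)] moments by simp
    then show ?thesis
      using close[OF meas(1,2) range(1,2)] close[OF meas(3,4) range(3,4)] e(3) by linarith
  qed
  then have "\<bar>(LINT x|M. u (a x) * v (b x)) - (LINT x|M. u (a' x) * v (b' x))\<bar> \<le> 0"
    by (rule field_le_epsilon)
  then show ?thesis
    by simp
qed

lemma paintbox_function_inject:
  assumes "paintbox_function P = paintbox_function Q"
  shows "P = Q"
proof (rule paintbox_eqI)
  let ?m = "\<lambda>P. before_mass (up_set P) (down_set P)" and ?m' = "\<lambda>P. before_mass (down_set P) (up_set P)"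
  have moments: "(LINT x|uniform01. ?m P x ^ k * ?m' P x ^ l) = (LINT x|uniform01. ?m Q x ^ k * ?m' Q x ^ l)" for k l
    unfolding before_mass_moment assms ..
  then have moments': "(LINT x|uniform01. ?m' P x ^ k * ?m P x ^ l) = (LINT x|uniform01. ?m' Q x ^ k * ?m Q x ^ l)" for k l
    by (simp add: mult.commute)
  have range: "?m P x \<in> {0..1}" "?m' P x \<in> {0..1}" for P x
    using before_mass_range by auto
  have meas: "?m P \<in> borel_measurable uniform01" "?m' P \<in> borel_measurable uniform01" for P
    by (simp_all cong: measurable_cong_sets)
  have u: "continuous_on {0..1} (\<lambda>t. max 0 (t - c))" "continuous_on {0..1} (\<lambda>t. max 0 (c - t))"
      "\<And>t. t \<in> {0..1} \<Longrightarrow> \<bar>max 0 (t - c)\<bar> \<le> 1" "\<And>t. t \<in> {0..1} \<Longrightarrow> \<bar>max 0 (c - t)\<bar> \<le> 1"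
    if "0 < c" "c < 1" for c :: real
    using that by (auto intro!: continuous_intros)
  have "c \<in> up_set P \<longleftrightarrow> c \<in> up_set Q" for c
  proof (cases "0 < c \<and> c < 1")
    case True
    note det = before_mass_determines[OF paintbox_props(1,3,5) _ _ before_sets measurable_before_mass, of c]
    have "(LINT x|uniform01. max 0 (?m P x - c) * max 0 (c - ?m' P x)) = (LINT x|uniform01. max 0 (?m Q x - c) * max 0 (c - ?m' Q x))"
      by (rule integral_product_eq_if_moments_eq[OF prob_space_uniform01 meas meas range range moments])
        (use u True in auto)
    then show ?thesis
      using det[of P] det[of Q] True by simp
  next
    case False
    then show ?thesis
      using paintbox_props(3)[of P] paintbox_props(3)[of Q] by auto
  qed
  then show "up_set P = up_set Q"
    by blast
  \<comment> \<open>The down set is recovered by exchanging the roles of the two masses, which is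
    why \<open>before\<close> takes both sets as arguments.\<close>
  have "c \<in> down_set P \<longleftrightarrow> c \<in> down_set Q" for c
  proof (cases "0 < c \<and> c < 1")
    case True
    have disj: "down_set P \<inter> up_set P = {}" for P
      using paintbox_props(5)[of P] by blast
    note det = before_mass_determines[OF paintbox_props(2,4) disj _ _ before_sets(2,1) measurable_before_mass(2,1), of c]
    have "(LINT x|uniform01. max 0 (?m' P x - c) * max 0 (c - ?m P x)) = (LINT x|uniform01. max 0 (?m' Q x - c) * max 0 (c - ?m Q x))"
      by (rule integral_product_eq_if_moments_eq[OF prob_space_uniform01 meas(2,1) meas(2,1) range(2,1) range(2,1) moments'])
        (use u True in auto)
    then show ?thesis
      using det[of P] det[of Q] True by simp
  next
    case False
    then show ?thesis
      using paintbox_props(4)[of P] paintbox_props(4)[of Q] by auto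
  qed
  then show "down_set P = down_set Q"
    by blast
qed

section \<open>Mixtures of paintboxes\<close>

text \<open>Closed sets form an intersection-stable generator, and the indicator of a nonempty
  closed set is a bounded limit of truncated linear functions of the distance to it.\<close>

lemma prob_measure_eqI_continuous:
  fixes \<mu> \<nu> :: "'a::metric_space measure"
  assumes prob: "prob_space \<mu>" "prob_space \<nu>" and sets: "sets \<mu> = sets borel" "sets \<nu> = sets borel"
    and eq: "\<And>f :: 'a \<Rightarrow> real. continuous_on UNIV f \<Longrightarrow> (\<And>x. \<bar>f x\<bar> \<le> 1) \<Longrightarrow> integral\<^sup>L \<mu> f = integral\<^sup>L \<nu> f"
  shows "\<mu> = \<nu>"
proof (rule measure_eqI_generator_eq[where E = "Collect closed" and \<Omega> = UNIV and A = "\<lambda>_. UNIV"])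
  interpret \<mu>: prob_space \<mu> by fact
  interpret \<nu>: prob_space \<nu> by fact
  show "sets \<mu> = sigma_sets UNIV (Collect closed)" "sets \<nu> = sigma_sets UNIV (Collect closed)"
    unfolding sets borel_eq_closed by simp_all
  fix C :: "'a set" assume "C \<in> Collect closed"
  then have C: "closed C" by simp
  show "emeasure \<mu> C = emeasure \<nu> C"
  \<comment> \<open>The distance to the empty set is 0 by convention, so the approximation would
    give 1 there.\<close>
  proof (cases "C = {}")
    case False
    define f where "f n x = max 0 (1 - real n * infdist x C)" for n x
    have f01: "0 \<le> f n x" "f n x \<le> 1" for n x
      by (auto simp: f_def infdist_nonneg)
    have cont: "continuous_on UNIV (f n)" for n
      unfolding f_def by (intro continuous_intros)
    have lim: "(\<lambda>n. f n x) \<longlonglongrightarrow> indicator C x" for x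
    proof (cases "x \<in> C")
      case True
      then show ?thesis by (simp add: f_def)
    next
      case False
      then have pos: "0 < infdist x C"
        using C \<open>C \<noteq> {}\<close> by (metis in_closed_iff_infdist_zero infdist_nonneg less_eq_real_def)
      obtain N where N: "1 < real N * infdist x C"
        using reals_Archimedean3[OF pos] by blast
      have "f n x = 0" if "N \<le> n" for n
      proof -
        have "real N * infdist x C \<le> real n * infdist x C"
          using that pos by (intro mult_right_mono) auto
        then show ?thesis
          using N by (simp add: f_def)
      qed
      then have "\<forall>\<^sub>F n in sequentially. f n x = indicator C x"
        using False by (auto simp: eventually_sequentially intro!: exI[of _ N])
      then show ?thesis
        by (rule tendsto_eventually)
    qed
    have meas: "f n \<in> borel_measurable \<mu>" "f n \<in> borel_measurable \<nu>" for n
      using borel_measurable_continuous_onI[OF cont] sets by (simp_all cong: measurable_cong_sets)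
    have C_sets: "C \<in> sets \<mu>" "C \<in> sets \<nu>"
      using C sets by auto
    have l1: "(\<lambda>n. integral\<^sup>L \<mu> (f n)) \<longlonglongrightarrow> (LINT x|\<mu>. indicator C x :: real)"
      by (rule integral_dominated_convergence[where w = "\<lambda>_. 1"]) (use meas C_sets lim f01 in auto)
    have l2: "(\<lambda>n. integral\<^sup>L \<nu> (f n)) \<longlonglongrightarrow> (LINT x|\<nu>. indicator C x :: real)"
      by (rule integral_dominated_convergence[where w = "\<lambda>_. 1"]) (use meas C_sets lim f01 in auto)
    have eq_f: "integral\<^sup>L \<mu> (f n) = integral\<^sup>L \<nu> (f n)" for n
      by (rule eq[OF cont]) (use f01 in simp)
    have "(LINT x|\<mu>. indicator C x :: real) = (LINT x|\<nu>. indicator C x)"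
      by (rule LIMSEQ_unique[OF l1[unfolded eq_f] l2])
    then have "\<mu>.prob C = \<nu>.prob C"
      using sets_eq_imp_space_eq[OF sets(1)] sets_eq_imp_space_eq[OF sets(2)] by simp
    then show ?thesis
      by (simp add: \<mu>.emeasure_eq_measure \<nu>.emeasure_eq_measure)
  qed simp
next
  interpret \<mu>: prob_space \<mu> by fact
  show "emeasure \<mu> UNIV \<noteq> \<infinity>"
    by (simp add: \<mu>.emeasure_eq_measure)
qed (auto simp: Int_stable_def)

lemma paintbox_function_range: "0 \<le> paintbox_function P \<mu>" "paintbox_function P \<mu> \<le> 1"
  using prob_space.prob_le_1[OF prob_space_uniform_sample] by (auto simp: paintbox_function_def paintbox_prob_def)

lemma measurable_paintbox_function [measurable]: "(\<lambda>P. paintbox_function P \<mu>) \<in> borel_measurable borel"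
  by (rule borel_measurable_continuous_onI[OF continuous_paintbox_function])

lemma integrable_paintbox_function:
  assumes "prob_space \<nu>" "sets \<nu> = sets borel" "g \<in> borel_measurable borel" "\<And>P. \<bar>g P\<bar> \<le> (B :: real)"
  shows "integrable \<nu> (\<lambda>P. g P * paintbox_function P \<mu>)"
proof -
  interpret prob_space \<nu> by fact
  note [measurable] = assms(3)
  have "(\<lambda>P. g P * paintbox_function P \<mu>) \<in> borel_measurable \<nu>"
    using assms(2) by (simp cong: measurable_cong_sets)
  moreover have "\<bar>g P * paintbox_function P \<mu>\<bar> \<le> B" for P
  proof -
    have "\<bar>g P\<bar> * \<bar>paintbox_function P \<mu>\<bar> \<le> B * 1"
      using assms(4)[of P] paintbox_function_range[of P \<mu>] by (intro mult_mono) auto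
    then show ?thesis
      by (simp add: abs_mult)
  qed
  ultimately show ?thesis
    by (intro integrable_const_bound[of _ B]) auto
qed

lemma integrable_paintbox_function_1:
  assumes "prob_space \<nu>" "sets \<nu> = sets borel"
  shows "integrable \<nu> (\<lambda>P. paintbox_function P \<mu>)"
  using integrable_paintbox_function[OF assms, of "\<lambda>_. 1" 1] by simp

section \<open>The algebra of paintbox functions and uniqueness of mixtures\<close>

lemma paintbox_function_mult:
  obtains W where "finite W" "\<And>P. paintbox_function P \<mu> * paintbox_function P \<mu>' = (\<Sum>w\<in>W. paintbox_function P (zs w))"
proof -
  define m where "m = zigzag_size \<mu>"
  define k where "k = zigzag_size \<mu>'"
  obtain u v0 where u: "u \<in> perms m" "zs u = \<mu>" and v0: "v0 \<in> perms k" "zs v0 = \<mu>'"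
    using exists_perm_zs unfolding m_def k_def by blast
  \<comment> \<open>Shifted past the labels of \<open>u\<close>, which makes the label sets
    disjoint. The shuffles forming \<open>?W\<close> do not depend on the paintbox.\<close>
  let ?v = "map (\<lambda>i. m + i) v0"
  let ?A = "{1..m}" and ?B = "{m+1..m+k}"
  have "set ?v = ?B"
    using v0(1) image_add_atLeastAtMost[of m 1 k] by (simp add: permutations_of_set_def)
  then have v: "?v \<in> permutations_of_set ?B"
    using v0(1) by (auto simp: permutations_of_set_def distinct_map)
  have zs_v: "zs ?v = \<mu>'"
    unfolding v0(2)[symmetric] by (rule zs_eqI) auto
  let ?W = "{w \<in> permutations_of_set (?A \<union> ?B). filter (\<lambda>i. i \<in> ?A) w = u \<and> filter (\<lambda>i. i \<in> ?B) w = ?v}"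
  have pf: "paintbox_function P (zs w) = paintbox_prob P w" if "w \<in> permutations_of_set S" "S \<subseteq> {1..}" for P w S
    using that by (intro paintbox_function_zs) (auto simp: permutations_of_set_def)
  have "paintbox_function P \<mu> * paintbox_function P \<mu>' = (\<Sum>w\<in>?W. paintbox_function P (zs w))" for P
  proof -
    have "paintbox_function P \<mu> * paintbox_function P \<mu>' = paintbox_prob P u * paintbox_prob P ?v"
      using pf[OF u(1)] pf[OF v] by (simp add: u(2) zs_v)
    also have "\<dots> = (\<Sum>w\<in>?W. paintbox_prob P w)"
      by (rule paintbox_prob_mult[OF _ _ _ _ _ u(1) v]) auto
    also have "\<dots> = (\<Sum>w\<in>?W. paintbox_function P (zs w))"
      by (rule sum.cong[OF refl], rule pf[symmetric, where S = "?A \<union> ?B"]) auto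
    finally show ?thesis .
  qed
  then show thesis
    by (intro that[of ?W]) auto
qed

text \<open>Generated by linear operations only. Equality of integrals thus passes from the
  generators to all members, while closure under products is a separate fact about shuffles.\<close>

inductive_set paintbox_algebra :: "(paintbox \<Rightarrow> real) set" where
  gen: "(\<lambda>P. paintbox_function P \<mu>) \<in> paintbox_algebra"
| add: "f \<in> paintbox_algebra \<Longrightarrow> g \<in> paintbox_algebra \<Longrightarrow> (\<lambda>P. f P + g P) \<in> paintbox_algebra"
| scale: "f \<in> paintbox_algebra \<Longrightarrow> (\<lambda>P. c * f P) \<in> paintbox_algebra"

lemma paintbox_algebra_sum:
  assumes "finite W" "\<And>w. w \<in> W \<Longrightarrow> F w \<in> paintbox_algebra"
  shows "(\<lambda>P. \<Sum>w\<in>W. F w P) \<in> paintbox_algebra"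
  using assms
proof (induction W rule: finite_induct)
  case empty
  show ?case
    using paintbox_algebra.scale[OF paintbox_algebra.gen, of 0] by simp
next
  case (insert w W)
  then show ?case
    using paintbox_algebra.add[of "F w" "\<lambda>P. \<Sum>w\<in>W. F w P"] by simp
qed

lemma paintbox_algebra_mult:
  assumes "f \<in> paintbox_algebra" "g \<in> paintbox_algebra"
  shows "(\<lambda>P. f P * g P) \<in> paintbox_algebra"
  using assms(1)
proof (induction f rule: paintbox_algebra.induct)
  case (gen \<mu>)
  show ?case
    using assms(2)
  proof (induction g rule: paintbox_algebra.induct)
    case (gen \<mu>')
    obtain W where "finite W" "\<And>P. paintbox_function P \<mu> * paintbox_function P \<mu>' = (\<Sum>w\<in>W. paintbox_function P (zs w))"
      using paintbox_function_mult by blast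
    then show ?case
      by (simp add: paintbox_algebra_sum paintbox_algebra.gen)
  next
    case (add f g)
    then show ?case
      using paintbox_algebra.add by (simp add: distrib_left)
  next
    case (scale f c)
    then show ?case
      using paintbox_algebra.scale[of _ c] by (simp add: mult.left_commute)
  qed
next
  case (add f f')
  then show ?case
    using paintbox_algebra.add by (simp add: distrib_right)
next
  case (scale f c)
  then show ?case
    using paintbox_algebra.scale[of _ c] by (simp add: mult.assoc)
qed

lemma paintbox_algebra_continuous: "f \<in> paintbox_algebra \<Longrightarrow> continuous_on UNIV f"
  by (induction f rule: paintbox_algebra.induct) (auto intro!: continuous_intros continuous_paintbox_function)

theorem paintbox_measure_eqI:
  assumes prob: "prob_space \<nu>" "prob_space \<nu>'" and sets: "sets \<nu> = sets borel" "sets \<nu>' = sets borel"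
    and eq: "\<And>\<mu>. (LINT P|\<nu>. paintbox_function P \<mu>) = (LINT P|\<nu>'. paintbox_function P \<mu>)"
  shows "\<nu> = \<nu>'"
proof (rule prob_measure_eqI_continuous[OF prob sets])
  interpret \<nu>: prob_space \<nu> by fact
  interpret \<nu>': prob_space \<nu>' by fact
  interpret function_ring_on paintbox_algebra UNIV
  proof
    show "(\<lambda>_. c) \<in> paintbox_algebra" for c
    proof -
      have "paintbox_function P (zs []) = 1" for P
        by (rule harmonicD(2)[OF paintbox_function_harmonic])
      then show ?thesis
        using paintbox_algebra.scale[OF paintbox_algebra.gen[of "zs []"], of c] by simp
    qed
    show "\<exists>f\<in>paintbox_algebra. f P \<noteq> f Q" if PQ: "P \<noteq> Q" for P Q
    proof -
      have "paintbox_function P \<noteq> paintbox_function Q"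
        using paintbox_function_inject PQ by blast
      then obtain \<mu> where "paintbox_function P \<mu> \<noteq> paintbox_function Q \<mu>"
        by (auto simp: fun_eq_iff)
      then show ?thesis
        by (intro bexI[OF _ paintbox_algebra.gen[of \<mu>]])
    qed
  qed (auto simp: compact_UNIV_paintbox intro: paintbox_algebra_continuous paintbox_algebra.add paintbox_algebra_mult)
  have alg: "integrable \<nu> f \<and> integrable \<nu>' f \<and> integral\<^sup>L \<nu> f = integral\<^sup>L \<nu>' f" if "f \<in> paintbox_algebra" for f
    using that by (induction f rule: paintbox_algebra.induct)
      (auto simp: eq integrable_paintbox_function_1[OF prob(1) sets(1)] integrable_paintbox_function_1[OF prob(2) sets(2)])
  fix f :: "paintbox \<Rightarrow> real" assume f: "continuous_on UNIV f" "\<And>P. \<bar>f P\<bar> \<le> 1"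
  have meas: "f \<in> borel_measurable \<nu>" "f \<in> borel_measurable \<nu>'"
    using borel_measurable_continuous_onI[OF f(1)] sets by (simp_all cong: measurable_cong_sets)
  have int: "integrable \<nu> f" "integrable \<nu>' f"
    by (rule \<nu>.integrable_const_bound[of _ 1]; use f meas in simp)
      (rule \<nu>'.integrable_const_bound[of _ 1]; use f meas in simp)
  have "\<bar>integral\<^sup>L \<nu> f - integral\<^sup>L \<nu>' f\<bar> \<le> 0 + e" if "0 < e" for e
  proof -
    obtain g where g: "g \<in> paintbox_algebra" "\<And>P. \<bar>f P - g P\<bar> < e / 2"
      using Stone_Weierstrass_basic[OF f(1), of "e / 2"] \<open>0 < e\<close> by auto
    note ig = alg[OF g(1)]
    have "\<bar>integral\<^sup>L N f - integral\<^sup>L N g\<bar> \<le> e / 2"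
      if N: "prob_space N" "integrable N f" "integrable N g" for N
    proof -
      have "\<bar>integral\<^sup>L N f - integral\<^sup>L N g\<bar> = \<bar>LINT P|N. f P - g P\<bar>"
        using N by simp
      also have "\<dots> \<le> (LINT P|N. \<bar>f P - g P\<bar>)"
        by (rule integral_abs_bound)
      also have "\<dots> \<le> (LINT P|N. e / 2)"
        by (rule integral_mono)
          (use N g(2) in \<open>auto intro: less_imp_le simp: finite_measure.integrable_const prob_space.finite_measure\<close>)
      finally show ?thesis
        using prob_space.prob_space[OF N(1)] by simp
    qed
    from this[OF prob(1) int(1)] this[OF prob(2) int(2)] show ?thesis
      using ig by linarith
  qed
  then have "\<bar>integral\<^sup>L \<nu> f - integral\<^sup>L \<nu>' f\<bar> \<le> 0"
    by (rule field_le_epsilon)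
  then show "integral\<^sup>L \<nu> f = integral\<^sup>L \<nu>' f"
    by simp
qed

text \<open>The weights \<open>p (zs w)\<close> define a random paintbox with finitely many values.
  For a fixed shape the approximation error vanishes as the number of middle labels grows, and
  continuity of paintbox functions lets the weak limit be evaluated on them.\<close>

theorem harmonic_mixture:
  assumes p: "p \<in> harmonic_functions"
  obtains \<nu> where "prob_space \<nu>" "sets \<nu> = sets borel" "\<And>\<mu>. p \<mu> = (LINT P|\<nu>. paintbox_function P \<mu>)"
proof -
  define Q where "Q n W U \<longleftrightarrow> finite W \<and> (\<Sum>w\<in>W. p (zs w)) = 1 \<and>
    (\<forall>m. \<forall>u\<in>perms m. m \<le> Suc n \<longrightarrow>
      \<bar>(\<Sum>w\<in>W. p (zs w) * paintbox_function (U w) (zs u)) - p (zs u)\<bar> \<le> (real m ^ 2 + 4) / real (Suc n))"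
    for n :: nat and W :: "nat list set" and U
  have "\<exists>W U. Q n W U" for n
    using harmonic_paintbox_approx[OF p, of "Suc n"] unfolding Q_def by blast
  then obtain W U where Q: "\<And>n. Q n (W n) (U n)"
    by metis
  have W: "finite (W n)" "(\<Sum>w\<in>W n. p (zs w)) = 1" for n
    using Q[of n] unfolding Q_def by blast+
  have approx: "\<bar>(\<Sum>w\<in>W n. p (zs w) * paintbox_function (U n w) (zs u)) - p (zs u)\<bar> \<le> (real m ^ 2 + 4) / real (Suc n)"
    if "u \<in> perms m" "m \<le> Suc n" for n m u
    using Q[of n] that unfolding Q_def by blast
  \<comment> \<open>Extended by zero to all words, to be turned into a probability mass function on
    the type of words.\<close>
  define q where "q n w = (if w \<in> W n then p (zs w) else 0)" for n w
  have q_nonneg: "0 \<le> q n w" for n w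
    by (simp add: q_def harmonicD(1)[OF p])
  have q_sum: "(\<integral>\<^sup>+w. ennreal (q n w) \<partial>count_space UNIV) = 1" for n
  proof -
    have "(\<integral>\<^sup>+w. ennreal (q n w) \<partial>count_space UNIV) = (\<Sum>w\<in>W n. ennreal (q n w))"
      by (rule nn_integral_count_space'[OF W(1)]) (auto simp: q_def)
    also have "\<dots> = ennreal (\<Sum>w\<in>W n. p (zs w))"
      by (simp add: q_def harmonicD(1)[OF p])
    finally show ?thesis
      by (simp add: W(2))
  qed
  note pmf_q = pmf_embed_pmf[OF q_nonneg q_sum] and set_q = set_embed_pmf[OF q_nonneg q_sum]
  define \<nu>n where "\<nu>n n = map_pmf (U n) (embed_pmf (q n))" for n
  have exp_\<nu>n: "measure_pmf.expectation (\<nu>n n) (\<lambda>P. paintbox_function P \<mu>) = (\<Sum>w\<in>W n. p (zs w) * paintbox_function (U n w) \<mu>)" for n \<mu>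
  proof -
    have "measure_pmf.expectation (\<nu>n n) (\<lambda>P. paintbox_function P \<mu>) =
        measure_pmf.expectation (embed_pmf (q n)) (\<lambda>w. paintbox_function (U n w) \<mu>)"
      by (simp add: \<nu>n_def)
    also have "\<dots> = (\<Sum>w\<in>W n. paintbox_function (U n w) \<mu> * pmf (embed_pmf (q n)) w)"
      by (rule integral_measure_pmf_real[OF W(1)]) (auto simp: set_q q_def split: if_splits)
    finally show ?thesis
      by (simp add: pmf_q q_def mult.commute)
  qed
  obtain \<nu> r where \<nu>: "prob_space \<nu>" "sets \<nu> = sets (borel :: paintbox measure)" "strict_mono r"
    and lim: "\<And>f :: paintbox \<Rightarrow> real. continuous_on UNIV f \<Longrightarrow>
       (\<lambda>n. measure_pmf.expectation (\<nu>n (r n)) f) \<longlonglongrightarrow> integral\<^sup>L \<nu> f"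
    using compact_weak_limit[OF compact_UNIV_paintbox, of \<nu>n] by blast
  have "p \<mu> = (LINT P|\<nu>. paintbox_function P \<mu>)" for \<mu>
  proof -
    obtain u where u: "u \<in> perms (zigzag_size \<mu>)" "zs u = \<mu>"
      using exists_perm_zs by blast
    let ?m = "zigzag_size \<mu>"
    let ?e = "\<lambda>n. measure_pmf.expectation (\<nu>n n) (\<lambda>P. paintbox_function P \<mu>)"
    have "(\<lambda>n. ?e n - p \<mu>) \<longlonglongrightarrow> 0"
    proof (rule Lim_null_comparison)
      show "\<forall>\<^sub>F n in sequentially. norm (?e n - p \<mu>) \<le> (real ?m ^ 2 + 4) / real (Suc n)"
        using approx[OF u(1)] u(2) by (auto simp: exp_\<nu>n eventually_sequentially intro!: exI[of _ ?m])
      show "(\<lambda>n. (real ?m ^ 2 + 4) / real (Suc n)) \<longlonglongrightarrow> 0"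
        by (rule LIMSEQ_Suc[OF lim_const_over_n])
    qed
    then have "?e \<longlonglongrightarrow> p \<mu>"
      by (simp add: LIM_zero_iff)
    from LIMSEQ_subseq_LIMSEQ[OF this \<nu>(3)] have "(\<lambda>n. ?e (r n)) \<longlonglongrightarrow> p \<mu>"
      by (simp add: comp_def)
    then show ?thesis
      using lim[OF continuous_paintbox_function] LIMSEQ_unique by blast
  qed
  then show thesis
    using that \<nu> by blast
qed

section \<open>Extreme points among the harmonic functions\<close>

lemma weighted_mixture_harmonic:
  assumes \<nu>: "prob_space \<nu>" "sets \<nu> = sets borel"
    and g: "g \<in> borel_measurable borel" "\<And>P. 0 \<le> g P" "\<And>P. g P \<le> (B :: real)" "integral\<^sup>L \<nu> g = 1"
  shows "(\<lambda>\<mu>. LINT P|\<nu>. g P * paintbox_function P \<mu>) \<in> harmonic_functions"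
proof (rule harmonicI)
  have int: "integrable \<nu> (\<lambda>P. g P * paintbox_function P \<mu>)" for \<mu>
    by (rule integrable_paintbox_function[OF \<nu> g(1), of B]) (use g(2,3) in simp)
  show "0 \<le> (LINT P|\<nu>. g P * paintbox_function P \<mu>)" for \<mu>
    using g(2) paintbox_function_range by (intro integral_nonneg_AE) auto
  show "(LINT P|\<nu>. g P * paintbox_function P (zs [])) = 1"
    using g(4) by (simp add: harmonicD(2)[OF paintbox_function_harmonic])
  fix u n assume u: "u \<in> perms n"
  then have "paintbox_function P (zs u) = (\<Sum>w\<in>set (insertions (Suc n) u). paintbox_function P (zs w))" for P
    by (intro harmonic_insertions[OF paintbox_function_harmonic, symmetric]) (auto simp: permutations_of_set_def)
  then show "(LINT P|\<nu>. g P * paintbox_function P (zs u)) = (\<Sum>w\<in>set (insertions (Suc n) u). LINT P|\<nu>. g P * paintbox_function P (zs w))"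
    using int by (simp add: sum_distrib_left)
qed

text \<open>Let c be the value of \<open>paintbox_function U\<close> at a shape. By the product
  formula the squared deviation from c is a linear expression in paintbox functions, so its mean
  over the mixtures of \<open>q\<close> and \<open>r\<close> together equals its value at
  \<open>U\<close>, which is 0. Both mixtures then sit on paintboxes with value c at that
  shape.\<close>

lemma paintbox_function_in_boundary: "paintbox_function U \<in> zigzag_boundary"
  unfolding zigzag_boundary_def
proof (intro CollectI conjI ballI allI impI)
  show "paintbox_function U \<in> harmonic_functions"
    by (rule paintbox_function_harmonic)
  fix q r t assume q: "q \<in> harmonic_functions" and r: "r \<in> harmonic_functions"
    and t: "0 < t \<and> t < 1 \<and> paintbox_function U = (\<lambda>\<mu>. (1 - t) * q \<mu> + t * r \<mu>)"
  obtain \<nu>q where \<nu>q: "prob_space \<nu>q" "sets \<nu>q = sets borel" "\<And>\<mu>. q \<mu> = (LINT P|\<nu>q. paintbox_function P \<mu>)"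
    using harmonic_mixture[OF q] by blast
  obtain \<nu>r where \<nu>r: "prob_space \<nu>r" "sets \<nu>r = sets borel" "\<And>\<mu>. r \<mu> = (LINT P|\<nu>r. paintbox_function P \<mu>)"
    using harmonic_mixture[OF r] by blast
  have mix: "paintbox_function U \<mu> = (1 - t) * q \<mu> + t * r \<mu>" for \<mu>
    using t by metis
  have "q \<mu> = r \<mu>" for \<mu>
  proof -
    define c where "c = paintbox_function U \<mu>"
    obtain W where W: "finite W" "\<And>P. paintbox_function P \<mu> * paintbox_function P \<mu> = (\<Sum>w\<in>W. paintbox_function P (zs w))"
      using paintbox_function_mult by blast
    have sq: "(paintbox_function P \<mu> - c)\<^sup>2 = (\<Sum>w\<in>W. paintbox_function P (zs w)) - 2 * c * paintbox_function P \<mu> + c\<^sup>2" for P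
      using W(2)[of P] by (simp add: power2_eq_square algebra_simps)
    have V: "(LINT P|\<nu>. (paintbox_function P \<mu> - c)\<^sup>2) = (\<Sum>w\<in>W. h (zs w)) - 2 * c * h \<mu> + c\<^sup>2"
      and iV: "integrable \<nu> (\<lambda>P. (paintbox_function P \<mu> - c)\<^sup>2)"
      if \<nu>: "prob_space \<nu>" "sets \<nu> = sets borel" "\<And>\<mu>. h \<mu> = (LINT P|\<nu>. paintbox_function P \<mu>)" for \<nu> h
    proof -
      interpret prob_space \<nu> by fact
      note int = integrable_paintbox_function_1[OF \<nu>(1,2)]
      show "(LINT P|\<nu>. (paintbox_function P \<mu> - c)\<^sup>2) = (\<Sum>w\<in>W. h (zs w)) - 2 * c * h \<mu> + c\<^sup>2"
        "integrable \<nu> (\<lambda>P. (paintbox_function P \<mu> - c)\<^sup>2)"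
        unfolding sq \<nu>(3) using int by (simp_all add: prob_space)
    qed
    let ?Vq = "LINT P|\<nu>q. (paintbox_function P \<mu> - c)\<^sup>2" and ?Vr = "LINT P|\<nu>r. (paintbox_function P \<mu> - c)\<^sup>2"
    have "(1 - t) * ?Vq + t * ?Vr = (\<Sum>w\<in>W. (1 - t) * q (zs w) + t * r (zs w)) - 2 * c * ((1 - t) * q \<mu> + t * r \<mu>) + c\<^sup>2"
    proof -
      have "(\<Sum>w\<in>W. (1 - t) * q (zs w) + t * r (zs w)) = (1 - t) * (\<Sum>w\<in>W. q (zs w)) + t * (\<Sum>w\<in>W. r (zs w))"
        by (simp add: sum.distrib sum_distrib_left)
      then show ?thesis
        unfolding V[OF \<nu>q] V[OF \<nu>r] by (simp only:) (simp add: algebra_simps)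
    qed
    \<comment> \<open>After \<open>mix\<close> the expression is the squared deviation of
      \<open>U\<close> from its own value.\<close>
    also have "\<dots> = 0"
      unfolding mix[symmetric] using W(2)[of U] by (simp add: c_def power2_eq_square)
    finally have sum0: "(1 - t) * ?Vq + t * ?Vr = 0" .
    have nonneg: "0 \<le> ?Vq" "0 \<le> ?Vr"
      by (simp_all add: integral_nonneg_AE)
    then have "0 \<le> (1 - t) * ?Vq" "0 \<le> t * ?Vr"
      using t by auto
    then have "(1 - t) * ?Vq = 0" "t * ?Vr = 0"
      using sum0 by linarith+
    then have zero: "?Vq = 0" "?Vr = 0"
      using t by auto
    have const: "h \<mu> = c"
      if \<nu>: "prob_space \<nu>" "sets \<nu> = sets borel" "\<And>\<mu>. h \<mu> = (LINT P|\<nu>. paintbox_function P \<mu>)"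
        and 0: "(LINT P|\<nu>. (paintbox_function P \<mu> - c)\<^sup>2) = 0" for \<nu> h
    proof -
      interpret prob_space \<nu> by fact
      have "AE P in \<nu>. (paintbox_function P \<mu> - c)\<^sup>2 = 0"
        using integral_nonneg_eq_0_iff_AE[OF iV[OF \<nu>]] 0 by simp
      then have "AE P in \<nu>. paintbox_function P \<mu> = c"
        by eventually_elim simp
      moreover have "(\<lambda>P. paintbox_function P \<mu>) \<in> borel_measurable \<nu>"
        using borel_measurable_integrable[OF integrable_paintbox_function_1[OF \<nu>(1,2)]] .
      ultimately have "(LINT P|\<nu>. paintbox_function P \<mu>) = (LINT P|\<nu>. c)"
        by (intro integral_cong_AE) auto
      then show ?thesis
        unfolding \<nu>(3) by (simp add: prob_space)
    qed
    show ?thesis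
      using const[OF \<nu>q zero(1)] const[OF \<nu>r zero(2)] by simp
  qed
  then show "q = r"
    by (rule ext)
qed

text \<open>Cut the mixing measure at the paintboxes whose value at a given shape exceeds that of
  \<open>p\<close>. The two conditional mixtures are harmonic, and extremality identifies them with
  \<open>p\<close>; so the mean excess over that set is 0 and the set is null. As the overall mean
  is \<open>p\<close>, values are almost surely equal to it, for all shapes simultaneously.\<close>

lemma boundary_is_paintbox_function:
  assumes "p \<in> zigzag_boundary"
  obtains U where "p = paintbox_function U"
proof -
  have p: "p \<in> harmonic_functions"
    and extreme: "\<And>q r t. q \<in> harmonic_functions \<Longrightarrow> r \<in> harmonic_functions \<Longrightarrow> 0 < t \<Longrightarrow> t < 1 \<Longrightarrow>
      p = (\<lambda>\<mu>. (1 - t) * q \<mu> + t * r \<mu>) \<Longrightarrow> q = r"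
    using assms unfolding zigzag_boundary_def by blast+
  obtain \<nu> where \<nu>: "prob_space \<nu>" "sets \<nu> = sets borel" and rep: "\<And>\<mu>. p \<mu> = (LINT P|\<nu>. paintbox_function P \<mu>)"
    using harmonic_mixture[OF p] by blast
  interpret prob_space \<nu> by fact
  have space: "space \<nu> = UNIV"
    using sets_eq_imp_space_eq[OF \<nu>(2)] by simp
  have AE: "AE P in \<nu>. paintbox_function P \<mu> = p \<mu>" for \<mu>
  proof -
    note int = integrable_paintbox_function_1[OF \<nu>]
    let ?A = "{P. p \<mu> < paintbox_function P \<mu>}"
    have A_borel [measurable]: "?A \<in> sets borel"
      by measurable
    then have A: "?A \<in> events"
      using \<nu>(2) by simp
    define a where "a = prob ?A"
    have a: "0 \<le> a" "a \<le> 1"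
      by (simp_all add: a_def)
    have int_ind: "integrable \<nu> (\<lambda>P. indicator S P * paintbox_function P \<mu>')" if "S \<in> sets borel" for S \<mu>'
      using that by (intro integrable_paintbox_function[OF \<nu>, of _ 1]) (auto simp: indicator_def)
    have int_S: "integrable \<nu> (indicator S :: _ \<Rightarrow> real)" if "S \<in> sets borel" for S
      using that \<nu>(2) by (intro integrable_real_indicator) (auto simp: emeasure_eq_measure)
    have exp_S: "expectation (indicator S :: _ \<Rightarrow> real) = prob S" if "S \<in> sets borel" for S
      using that space by simp
    have weight: "(\<lambda>\<mu>'. LINT P|\<nu>. (indicator S P / b) * paintbox_function P \<mu>') \<in> harmonic_functions"
      if S: "S \<in> sets borel" "prob S = b" "0 < b" for S b
    proof (rule weighted_mixture_harmonic[OF \<nu>, of _ "1 / b"])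
      show "(\<lambda>P. indicator S P / b) \<in> borel_measurable borel"
        using S(1) by measurable
      show "0 \<le> indicator S P / b" "indicator S P / b \<le> 1 / b" for P
        using S(3) by (auto simp: indicator_def)
      show "(LINT P|\<nu>. indicator S P / b) = 1"
        using exp_S[OF S(1)] S(2,3) by simp
    qed
    have "(LINT P|\<nu>. indicator ?A P * paintbox_function P \<mu>) = p \<mu> * a"
    proof -
      \<comment> \<open>Conditional mixtures on both parts require 0 < a < 1; in the extreme cases
        the indicator is almost surely constant.\<close>
      consider "a = 0" | "a = 1" | "0 < a" "a < 1"
        using a by linarith
      then show ?thesis
      proof cases
        case 1
        then have "AE P in \<nu>. P \<notin> ?A"
          using A by (simp add: a_def AE_iff_measurable[OF A] emeasure_eq_measure space)
        then have "(LINT P|\<nu>. indicator ?A P * paintbox_function P \<mu>) = (LINT P|\<nu>. 0)"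
          by (intro integral_cong_AE borel_measurable_integrable int_ind A_borel) (auto elim!: eventually_mono)
        then show ?thesis
          using 1 by simp
      next
        case 2
        then have "AE P in \<nu>. P \<in> ?A"
          using A by (simp add: a_def prob_eq_1)
        then have "(LINT P|\<nu>. indicator ?A P * paintbox_function P \<mu>) = (LINT P|\<nu>. paintbox_function P \<mu>)"
          by (intro integral_cong_AE borel_measurable_integrable int_ind A_borel int) (auto elim!: eventually_mono)
        then show ?thesis
          using 2 rep by simp
      next
        case 3
        define q where "q \<mu>' = (LINT P|\<nu>. (indicator ?A P / a) * paintbox_function P \<mu>')" for \<mu>'
        define r where "r \<mu>' = (LINT P|\<nu>. (indicator (- ?A) P / (1 - a)) * paintbox_function P \<mu>')" for \<mu>'
        have "q \<in> harmonic_functions"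
          unfolding q_def by (rule weight[OF A_borel]) (use 3 in \<open>simp_all add: a_def\<close>)
        moreover have compl: "prob (- ?A) = 1 - a"
          using prob_compl[OF A] space by (simp add: a_def Compl_eq_Diff_UNIV)
        have "r \<in> harmonic_functions"
          unfolding r_def by (rule weight[OF borel_comp[OF A_borel] compl]) (use 3 in simp)
        moreover have "p = (\<lambda>\<mu>'. (1 - (1 - a)) * q \<mu>' + (1 - a) * r \<mu>')"
        proof
          fix \<mu>'
          have "p \<mu>' = (LINT P|\<nu>. indicator ?A P * paintbox_function P \<mu>' + indicator (- ?A) P * paintbox_function P \<mu>')"
            unfolding rep by (intro Bochner_Integration.integral_cong) (auto simp: indicator_def)
          also have "\<dots> = (LINT P|\<nu>. indicator ?A P * paintbox_function P \<mu>') + (LINT P|\<nu>. indicator (- ?A) P * paintbox_function P \<mu>')"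
            by (intro Bochner_Integration.integral_add int_ind) auto
          also have "(LINT P|\<nu>. indicator ?A P * paintbox_function P \<mu>') = a * q \<mu>'"
            using 3 by (simp add: q_def)
          also have "(LINT P|\<nu>. indicator (- ?A) P * paintbox_function P \<mu>') = (1 - a) * r \<mu>'"
            using 3 by (simp add: r_def)
          finally show "p \<mu>' = (1 - (1 - a)) * q \<mu>' + (1 - a) * r \<mu>'"
            by simp
        qed
        ultimately have qr: "q = r"
          using extreme[of q r "1 - a"] 3 by simp
        have "p \<mu> = (1 - (1 - a)) * q \<mu> + (1 - a) * r \<mu>"
          using \<open>p = _\<close> by metis
        then have "q \<mu> = p \<mu>"
          using qr by (simp add: algebra_simps)
        then show ?thesis
          using 3 by (simp add: q_def field_simps)
      qed
    qed
    then have "(LINT P|\<nu>. indicator ?A P * paintbox_function P \<mu> - p \<mu> * indicator ?A P) = 0"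
      using int_ind[OF A_borel] int_S[OF A_borel] exp_S[OF A_borel] by (simp add: a_def)
    moreover have "integrable \<nu> (\<lambda>P. indicator ?A P * paintbox_function P \<mu> - p \<mu> * indicator ?A P)"
      using int_ind[OF A_borel] int_S[OF A_borel] by simp
    ultimately have "AE P in \<nu>. indicator ?A P * paintbox_function P \<mu> - p \<mu> * indicator ?A P = 0"
      by (subst (asm) integral_nonneg_eq_0_iff_AE) (auto simp: indicator_def)
    then have le: "AE P in \<nu>. 0 \<le> p \<mu> - paintbox_function P \<mu>"
      by eventually_elim (auto simp: indicator_def split: if_splits)
    have "(LINT P|\<nu>. p \<mu> - paintbox_function P \<mu>) = 0"
      using int rep by (simp add: prob_space)
    then have "AE P in \<nu>. p \<mu> - paintbox_function P \<mu> = 0"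
      using integral_nonneg_eq_0_iff_AE[OF _ le] int by simp
    then show ?thesis
      by eventually_elim simp
  qed
  \<comment> \<open>Quantifying over words gives a countable family of null sets, and every shape is
    the shape of a word.\<close>
  have "AE P in \<nu>. \<forall>w. paintbox_function P (zs w) = p (zs w)"
    unfolding AE_all_countable using AE by blast
  then have "\<exists>U. \<forall>w. paintbox_function U (zs w) = p (zs w)"
  proof (rule contrapos_pp)
    assume "\<nexists>U. \<forall>w. paintbox_function U (zs w) = p (zs w)"
    then have none: "(\<forall>w. paintbox_function P (zs w) = p (zs w)) = False" for P
      by blast
    show "\<not> (AE P in \<nu>. \<forall>w. paintbox_function P (zs w) = p (zs w))"
      unfolding none by simp
  qed
  then obtain U where U: "\<forall>w. paintbox_function U (zs w) = p (zs w)"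
    by blast
  have "p = paintbox_function U"
  proof
    fix \<mu>
    obtain w where "zs w = \<mu>"
      using exists_perm_zs by blast
    then show "p \<mu> = paintbox_function U \<mu>"
      using U by metis
  qed
  then show thesis
    by (rule that)
qed

text \<open>The paintbox map is a continuous bijection from a compact space onto a Hausdorff space,
  so continuity of the inverse needs no estimate.\<close>

theorem zigzag_boundary_homeomorphic: "zigzag_boundary homeomorphic (UNIV :: paintbox set)"
proof -
  have range: "range paintbox_function = zigzag_boundary"
    using paintbox_function_in_boundary boundary_is_paintbox_function by blast
  have inj: "inj paintbox_function"
    by (rule injI) (rule paintbox_function_inject)
  have cont: "continuous_on UNIV paintbox_function"
    by (rule continuous_on_coordinatewise_then_product) (rule continuous_paintbox_function)
  let ?B = "top_of_set zigzag_boundary"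
  have "Hausdorff_space (euclidean :: (zigzag \<Rightarrow> real) topology)"
    unfolding euclidean_product_topology[symmetric] Hausdorff_space_product_topology by simp
  then have "Hausdorff_space ?B"
    by (rule Hausdorff_space_subtopology)
  moreover have "continuous_map euclidean ?B paintbox_function"
    unfolding continuous_map_in_subtopology using cont range by auto
  moreover have "compact_space (euclidean :: paintbox topology)"
    using compact_UNIV_paintbox by (simp add: compact_space_def)
  ultimately have "homeomorphic_map euclidean ?B paintbox_function"
    using range inj by (intro continuous_imp_homeomorphic_map) auto
  then obtain g where "homeomorphic_maps euclidean ?B paintbox_function g"
    unfolding homeomorphic_map_maps by blast
  then have "continuous_on zigzag_boundary g" "\<And>P. g (paintbox_function P) = P"
    "\<And>p. p \<in> zigzag_boundary \<Longrightarrow> paintbox_function (g p) = p"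
    by (auto simp: homeomorphic_maps_def)
  then have "homeomorphism zigzag_boundary UNIV g paintbox_function"
    using cont range by (intro homeomorphismI) auto
  then show ?thesis
    unfolding homeomorphic_def by blast
qed

section \<open>Laws of random arrangements\<close>

lemma space_arrangement_space: "space arrangement_space = arrangements"
proof -
  have "arrangements \<subseteq> (\<Pi>\<^sub>E n\<in>{1..}. perms n)"
    by (auto simp: arrangements_def)
  then show ?thesis
    by (auto simp: arrangement_space_def space_restrict_space space_PiM)
qed

lemma arrangement_in_perms:
  assumes "\<pi> \<in> arrangements" "1 \<le> n"
  shows "\<pi> n \<in> perms n"
proof -
  have "\<pi> \<in> (\<Pi>\<^sub>E n\<in>{1..}. perms n)"
    using assms(1) unfolding arrangements_def by blast
  then show ?thesis
    using PiE_mem[of \<pi> "{1..}" perms n] assms(2) by simp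
qed

lemma arrangements_filter:
  assumes "\<pi> \<in> arrangements" "1 \<le> m" "m \<le> n"
  shows "\<pi> m = filter (\<lambda>i. i \<in> {1..m}) (\<pi> n)"
proof (cases "m = n")
  case True
  have "set (\<pi> n) = {1..n}"
    using assms by (auto simp: arrangements_def PiE_iff permutations_of_set_def)
  then have "\<forall>i\<in>set (\<pi> n). i \<in> {1..n}"
    by blast
  then show ?thesis
    unfolding True by (simp only: filter_True)
next
  case False
  have m: "\<pi> m \<in> perms m" and n: "\<pi> n \<in> perms n" and "coherent (\<pi> m) (\<pi> n)"
    using assms False by (auto simp: arrangements_def PiE_iff)
  moreover have "distinct (\<pi> m)" "distinct (\<pi> n)" "set (\<pi> m) = {1..m}" "set (\<pi> n) = {1..n}"
    using m n by (auto simp: permutations_of_set_def)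
  ultimately show ?thesis
    using coherent_iff_filter[of "\<pi> m" "\<pi> n"] assms by auto
qed

lemma sets_arrangement_space:
  "sets arrangement_space = sigma_sets arrangements {{\<pi> \<in> arrangements. \<pi> n \<in> S} | n S. 1 \<le> n \<and> S \<subseteq> perms n}"
proof -
  let ?\<Omega> = "\<Pi>\<^sub>E n\<in>{1..}. perms n" and ?M = "\<Pi>\<^sub>M n\<in>{1..}. count_space (perms n)"
  let ?G = "{{f \<in> \<Pi>\<^sub>E i\<in>{1..}. space (count_space (perms i)). f i \<in> A} | i A. i \<in> {1..} \<and> A \<in> sets (count_space (perms i))}"
  have sub: "arrangements \<subseteq> ?\<Omega>"
    by (auto simp: arrangements_def)
  have "sets arrangement_space = {(\<lambda>x. x) -` A \<inter> arrangements | A. A \<in> sigma_sets ?\<Omega> ?G}"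
    unfolding arrangement_space_def sets_restrict_space sets_PiM_single by (auto simp: image_iff Int_commute)
  also have "\<dots> = sigma_sets arrangements {(\<lambda>x. x) -` A \<inter> arrangements | A. A \<in> ?G}"
    by (rule sigma_sets_vimage_commute) (use sub in auto)
  also have "{(\<lambda>x. x) -` A \<inter> arrangements | A. A \<in> ?G} = {{\<pi> \<in> arrangements. \<pi> n \<in> S} | n S. 1 \<le> n \<and> S \<subseteq> perms n}"
  proof (intro equalityI subsetI)
    fix X assume "X \<in> {(\<lambda>x. x) -` A \<inter> arrangements | A. A \<in> ?G}"
    then obtain i A where "1 \<le> i" "A \<subseteq> perms i" "X = {f \<in> ?\<Omega>. f i \<in> A} \<inter> arrangements"
      by auto
    moreover then have "X = {\<pi> \<in> arrangements. \<pi> i \<in> A}"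
      using sub by blast
    ultimately show "X \<in> {{\<pi> \<in> arrangements. \<pi> n \<in> S} | n S. 1 \<le> n \<and> S \<subseteq> perms n}"
      by blast
  next
    fix X assume "X \<in> {{\<pi> \<in> arrangements. \<pi> n \<in> S} | n S. 1 \<le> n \<and> S \<subseteq> perms n}"
    then obtain n S where nS: "1 \<le> n" "S \<subseteq> perms n" "X = {\<pi> \<in> arrangements. \<pi> n \<in> S}"
      by blast
    then have "X = (\<lambda>x. x) -` {f \<in> ?\<Omega>. f n \<in> S} \<inter> arrangements"
      using sub by blast
    moreover have "{f \<in> ?\<Omega>. f n \<in> S} \<in> ?G"
      using nS by auto
    ultimately show "X \<in> {(\<lambda>x. x) -` A \<inter> arrangements | A. A \<in> ?G}"
      by blast
  qed
  finally show ?thesis .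
qed

lemma arrangement_event: "1 \<le> n \<Longrightarrow> S \<subseteq> perms n \<Longrightarrow> {\<pi> \<in> arrangements. \<pi> n \<in> S} \<in> sets arrangement_space"
  unfolding sets_arrangement_space by (rule sigma_sets.Basic) blast

text \<open>A level determines all lower levels by deletion of letters, so events concerning a
  single level are stable under intersection, and the probabilities at each level determine the
  law.\<close>

lemma arrangement_measure_eqI:
  assumes sets: "sets M = sets arrangement_space" "sets N = sets arrangement_space"
    and fin: "emeasure M arrangements \<noteq> \<infinity>"
    and eq: "\<And>n w. 1 \<le> n \<Longrightarrow> w \<in> perms n \<Longrightarrow> emeasure M {\<pi> \<in> arrangements. \<pi> n = w} = emeasure N {\<pi> \<in> arrangements. \<pi> n = w}"
  shows "M = N"
proof (rule measure_eqI_generator_eq)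
  let ?E = "{{\<pi> \<in> arrangements. \<pi> n \<in> S} | n S. 1 \<le> n \<and> S \<subseteq> perms n}"
  have inter: "\<exists>R\<subseteq>perms n. {\<pi> \<in> arrangements. \<pi> m \<in> S} \<inter> {\<pi> \<in> arrangements. \<pi> n \<in> T} = {\<pi> \<in> arrangements. \<pi> n \<in> R}"
    if "1 \<le> m" "m \<le> n" "T \<subseteq> perms n" for m n S T
  proof (intro exI conjI)
    show "{w \<in> T. filter (\<lambda>i. i \<in> {1..m}) w \<in> S} \<subseteq> perms n"
      using that by blast
    show "{\<pi> \<in> arrangements. \<pi> m \<in> S} \<inter> {\<pi> \<in> arrangements. \<pi> n \<in> T} =
        {\<pi> \<in> arrangements. \<pi> n \<in> {w \<in> T. filter (\<lambda>i. i \<in> {1..m}) w \<in> S}}"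
      using arrangements_filter[OF _ that(1,2)] by auto
  qed
  show "Int_stable ?E"
  proof (rule Int_stableI, clarify)
    fix m S n T assume mn: "(1::nat) \<le> m" "S \<subseteq> perms m" "(1::nat) \<le> n" "T \<subseteq> perms n"
    show "\<exists>n' R. {\<pi> \<in> arrangements. \<pi> m \<in> S} \<inter> {\<pi> \<in> arrangements. \<pi> n \<in> T} = {\<pi> \<in> arrangements. \<pi> n' \<in> R} \<and> 1 \<le> n' \<and> R \<subseteq> perms n'"
    proof (cases "m \<le> n")
      case True
      then show ?thesis
        using inter[of m n T S] mn by blast
    next
      case False
      then have "\<exists>R\<subseteq>perms m. {\<pi> \<in> arrangements. \<pi> m \<in> S} \<inter> {\<pi> \<in> arrangements. \<pi> n \<in> T} = {\<pi> \<in> arrangements. \<pi> m \<in> R}"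
        using inter[of n m S T] mn by (subst Int_commute) simp
      then show ?thesis
        using mn(1) by blast
    qed
  qed
  show "?E \<subseteq> Pow arrangements"
    by blast
  show "sets M = sigma_sets arrangements ?E" "sets N = sigma_sets arrangements ?E"
    unfolding sets sets_arrangement_space by simp_all
  show "range (\<lambda>_ :: nat. arrangements) \<subseteq> ?E"
  proof -
    have "arrangements = {\<pi> \<in> arrangements. \<pi> 1 \<in> perms 1}"
      using arrangement_in_perms[of _ 1] by blast
    then show ?thesis
      by blast
  qed
  show "(\<Union>i :: nat. arrangements) = arrangements"
    by simp
  show "emeasure M arrangements \<noteq> \<infinity>"
    by (rule fin)
  fix X assume "X \<in> ?E"
  then obtain n S where nS: "1 \<le> n" "S \<subseteq> perms n" "X = {\<pi> \<in> arrangements. \<pi> n \<in> S}"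
    by blast
  have finS: "finite S"
    using nS(2) by (rule finite_subset) simp
  have sum: "emeasure K X = (\<Sum>w\<in>S. emeasure K {\<pi> \<in> arrangements. \<pi> n = w})" if "sets K = sets arrangement_space" for K
  proof -
    have "X = (\<Union>w\<in>S. {\<pi> \<in> arrangements. \<pi> n = w})"
      unfolding nS(3) by blast
    moreover have "{\<pi> \<in> arrangements. \<pi> n = w} \<in> sets K" if "w \<in> S" for w
      using arrangement_event[of n "{w}"] nS that \<open>sets K = _\<close> by auto
    ultimately show ?thesis
      using finS by (simp only:, subst sum_emeasure[symmetric]) (auto simp: disjoint_family_on_def)
  qed
  show "emeasure M X = emeasure N X"
    unfolding sum[OF sets(1)] sum[OF sets(2)] using eq nS by (intro sum.cong) auto
qed

lemma measurable_paintbox_arrangement: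
  assumes \<nu>: "sets \<nu> = sets borel"
  shows "(\<lambda>(P, \<xi>). paintbox_arrangement P \<xi>) \<in> \<nu> \<Otimes>\<^sub>M uniform_sample \<rightarrow>\<^sub>M arrangement_space"
  unfolding arrangement_space_def
proof (rule measurable_restrict_space2)
  let ?N = "\<nu> \<Otimes>\<^sub>M uniform_sample"
  show "(\<lambda>(P, \<xi>). paintbox_arrangement P \<xi>) \<in> space ?N \<rightarrow> arrangements"
    using paintbox_arrangement_in_arrangements by auto
  have fst_meas [measurable]: "fst \<in> ?N \<rightarrow>\<^sub>M borel"
    using measurable_fst[of \<nu> uniform_sample] \<nu> by (simp cong: measurable_cong_sets)
  have xi: "(\<lambda>z. snd z i) \<in> borel_measurable ?N" if "1 \<le> i" for i
    using measurable_compose[OF measurable_snd measurable_uniform_sample[OF that]] .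
  have inj: "Measurable.pred ?N (\<lambda>z. inj_on (snd z) {1..})"
  proof -
    \<comment> \<open>Written with \<open>Suc\<close>, injectivity is a countable conjunction over
      all pairs of naturals.\<close>
    have "inj_on \<xi> {1..} \<longleftrightarrow> (\<forall>i j. \<xi> (Suc i) = \<xi> (Suc j) \<longrightarrow> i = j)" for \<xi> :: "nat \<Rightarrow> real"
      unfolding inj_on_def by (metis Suc_le_D atLeast_iff le_add1 old.nat.inject One_nat_def plus_1_eq_Suc)
    moreover have [measurable]: "(\<lambda>z. snd z (Suc i)) \<in> borel_measurable ?N" for i
      by (rule xi) simp
    ultimately show ?thesis
      by simp
  qed
  have comp: "(\<lambda>z. paintbox_arrangement (fst z) (snd z) n) \<in> ?N \<rightarrow>\<^sub>M count_space (perms n)" if n: "1 \<le> n" for n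
  proof (subst measurable_count_space_eq2)
    have range: "paintbox_arrangement P \<xi> n \<in> perms n" for P \<xi>
      using paintbox_arrangement_in_arrangements[of P \<xi>] n by (auto simp: arrangements_def PiE_iff)
    have "{z \<in> space ?N. paintbox_arrangement (fst z) (snd z) n = w} \<in> sets ?N" if w: "w \<in> perms n" for w
    proof -
      \<comment> \<open>The second alternative is the default order used when sample points
        coincide.\<close>
      have "paintbox_arrangement P \<xi> n = w \<longleftrightarrow>
          (inj_on \<xi> {1..} \<and> sorted_wrt (placed_left P \<xi>) w \<or> \<not> inj_on \<xi> {1..} \<and> w = [1..<Suc n])" for P \<xi>
        using paintbox_arrangement_eq_iff[OF _ n w, of \<xi> P] n
        by (cases "inj_on \<xi> {1..}") (auto simp: paintbox_arrangement_def simp del: upt_Suc)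
      moreover have "Measurable.pred ?N (\<lambda>z. sorted_wrt (placed_left (fst z) (snd z)) w)"
        using w by (intro measurable_sorted_placed_left fst_meas xi) (auto simp: permutations_of_set_def)
      then have "Measurable.pred ?N (\<lambda>z. inj_on (snd z) {1..} \<and> sorted_wrt (placed_left (fst z) (snd z)) w \<or>
          \<not> inj_on (snd z) {1..} \<and> w = [1..<Suc n])"
        using inj by measurable
      ultimately show ?thesis
        by (simp add: pred_def)
    qed
    then show "(\<lambda>z. paintbox_arrangement (fst z) (snd z) n) \<in> space ?N \<rightarrow> perms n \<and>
        (\<forall>w\<in>perms n. (\<lambda>z. paintbox_arrangement (fst z) (snd z) n) -` {w} \<inter> space ?N \<in> sets ?N)"
      using range by (auto simp: vimage_def Int_def conj_commute)
  qed simp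
  show "(\<lambda>(P, \<xi>). paintbox_arrangement P \<xi>) \<in> ?N \<rightarrow>\<^sub>M (\<Pi>\<^sub>M n\<in>{1..}. count_space (perms n))"
  proof (rule measurable_PiM_single')
    fix n :: nat assume "n \<in> {1..}"
    then show "(\<lambda>z. (case z of (P, \<xi>) \<Rightarrow> paintbox_arrangement P \<xi>) n) \<in> ?N \<rightarrow>\<^sub>M count_space (perms n)"
      using comp[of n] by (simp add: case_prod_beta')
  next
    show "(\<lambda>z n. (case z of (P, \<xi>) \<Rightarrow> paintbox_arrangement P \<xi>) n) \<in> space ?N \<rightarrow> (\<Pi>\<^sub>E n\<in>{1..}. space (count_space (perms n)))"
      using paintbox_arrangement_in_arrangements by (auto simp: arrangements_def)
  qed
qed

lemma paintbox_law_event: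
  assumes \<nu>: "prob_space \<nu>" "sets \<nu> = sets borel" and n: "1 \<le> n" "w \<in> perms n"
  shows "emeasure (paintbox_law \<nu>) {\<pi> \<in> arrangements. \<pi> n = w} = ennreal (LINT P|\<nu>. paintbox_function P (zs w))"
proof -
  interpret \<nu>: prob_space \<nu> by fact
  interpret U: prob_space uniform_sample
    by (rule prob_space_uniform_sample)
  let ?N = "\<nu> \<Otimes>\<^sub>M uniform_sample" and ?f = "\<lambda>(P, \<xi>). paintbox_arrangement P \<xi>"
  let ?X = "{\<pi> \<in> arrangements. \<pi> n = w}"
  note meas = measurable_paintbox_arrangement[OF \<nu>(2)]
  have X: "?X \<in> sets arrangement_space"
    using arrangement_event[of n "{w}"] n by auto
  have "emeasure (paintbox_law \<nu>) ?X = emeasure ?N (?f -` ?X \<inter> space ?N)"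
    unfolding paintbox_law_def by (rule emeasure_distr[OF meas X])
  also have "\<dots> = (\<integral>\<^sup>+P. emeasure uniform_sample (Pair P -` (?f -` ?X \<inter> space ?N)) \<partial>\<nu>)"
    by (rule U.emeasure_pair_measure_alt) (rule measurable_sets[OF meas X])
  also have "\<dots> = (\<integral>\<^sup>+P. ennreal (paintbox_function P (zs w)) \<partial>\<nu>)"
  proof (rule nn_integral_cong)
    fix P assume P: "P \<in> space \<nu>"
    have w: "distinct w" "set w \<subseteq> {1..}"
      using n by (auto simp: permutations_of_set_def)
    have ev: "Pair P -` (?f -` ?X \<inter> space ?N) \<in> sets uniform_sample"
      by (rule sets_Pair1[OF measurable_sets[OF meas X]])
    have "emeasure uniform_sample (Pair P -` (?f -` ?X \<inter> space ?N)) =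
        emeasure uniform_sample {\<xi> \<in> space uniform_sample. sorted_wrt (placed_left P \<xi>) w}"
    proof (rule emeasure_eq_AE[OF _ ev sorted_placed_left_event[OF w(2)]])
      show "AE \<xi> in uniform_sample. \<xi> \<in> Pair P -` (?f -` ?X \<inter> space ?N) \<longleftrightarrow> \<xi> \<in> {\<xi> \<in> space uniform_sample. sorted_wrt (placed_left P \<xi>) w}"
        using AE_uniform_sample_inj AE_space
      proof eventually_elim
        case (elim \<xi>)
        then show ?case
          using paintbox_arrangement_eq_iff[OF elim(1) n] paintbox_arrangement_in_arrangements[of P \<xi>] P
          by (simp add: space_pair_measure)
      qed
    qed
    then show "emeasure uniform_sample (Pair P -` (?f -` ?X \<inter> space ?N)) = ennreal (paintbox_function P (zs w))"
      using paintbox_function_zs[OF w] by (simp add: paintbox_prob_def U.emeasure_eq_measure)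
  qed
  also have "\<dots> = ennreal (LINT P|\<nu>. paintbox_function P (zs w))"
    by (rule nn_integral_eq_integral[OF integrable_paintbox_function_1[OF \<nu>]]) (simp add: paintbox_function_range)
  finally show ?thesis .
qed

lemma distr_event:
  assumes X: "X \<in> M \<rightarrow>\<^sub>M arrangement_space" and n: "1 \<le> n" "w \<in> perms n"
  shows "{\<omega> \<in> space M. X \<omega> n = w} \<in> sets M"
    and "emeasure (distr M arrangement_space X) {\<pi> \<in> arrangements. \<pi> n = w} = emeasure M {\<omega> \<in> space M. X \<omega> n = w}"
proof -
  have ev: "{\<pi> \<in> arrangements. \<pi> n = w} \<in> sets arrangement_space"
    using arrangement_event[of n "{w}"] n by auto
  have eq: "X -` {\<pi> \<in> arrangements. \<pi> n = w} \<inter> space M = {\<omega> \<in> space M. X \<omega> n = w}"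
    using measurable_space[OF X] by (auto simp: space_arrangement_space)
  show "{\<omega> \<in> space M. X \<omega> n = w} \<in> sets M"
    using measurable_sets[OF X ev] unfolding eq .
  show "emeasure (distr M arrangement_space X) {\<pi> \<in> arrangements. \<pi> n = w} = emeasure M {\<omega> \<in> space M. X \<omega> n = w}"
    unfolding emeasure_distr[OF X ev] eq ..
qed

text \<open>Sufficiency of the descent set says that level probabilities are a function
  \<open>p\<close> of the shape. Coherence makes \<open>p\<close> harmonic, and its mixing measure
  gives a paintbox law with the same level probabilities.\<close>

theorem descent_sufficient_paintbox:
  assumes M: "prob_space M" and X: "X \<in> M \<rightarrow>\<^sub>M arrangement_space" and suff: "descent_sufficient M X"
  shows "\<exists>\<nu>. prob_space \<nu> \<and> sets \<nu> = sets borel \<and> distr M arrangement_space X = paintbox_law \<nu>"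
proof -
  interpret prob_space M by fact
  let ?E = "\<lambda>n w. {\<omega> \<in> space M. X \<omega> n = w}"
  have X_arr: "X \<omega> \<in> arrangements" if "\<omega> \<in> space M" for \<omega>
    using measurable_space[OF X that] by (simp add: space_arrangement_space)
  define c where "c \<mu> = (SOME w. w \<in> perms (zigzag_size \<mu>) \<and> zs w = \<mu>)" for \<mu>
  have c: "c \<mu> \<in> perms (zigzag_size \<mu>)" "zs (c \<mu>) = \<mu>" for \<mu>
  proof -
    have "\<exists>w. w \<in> perms (zigzag_size \<mu>) \<and> zs w = \<mu>"
      using exists_perm_zs by blast
    from someI_ex[OF this] show "c \<mu> \<in> perms (zigzag_size \<mu>)" "zs (c \<mu>) = \<mu>"
      by (simp_all add: c_def)
  qed
  \<comment> \<open>Arrangements begin at level 1, so the value 1 at the empty shape is supplied by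
    hand.\<close>
  define p where "p \<mu> = (if zigzag_size \<mu> = 0 then 1 else prob (?E (zigzag_size \<mu>) (c \<mu>)))" for \<mu>
  have p_zs: "p (zs w) = prob (?E n w)" if "w \<in> perms n" "1 \<le> n" for w n
  proof -
    have len: "zigzag_size (zs w) = n"
      using that by (simp add: zigzag_size_zs length_finite_permutations_of_set)
    have "prob (?E n (c (zs w))) = prob (?E n w)"
      using suff[unfolded descent_sufficient_def, rule_format, of n "c (zs w)" w] that c[of "zs w"] len by simp
    then show ?thesis
      unfolding p_def len using that(2) by simp
  qed
  have "p \<in> harmonic_functions"
  proof (rule harmonicI)
    show "0 \<le> p \<mu>" for \<mu>
      by (simp add: p_def)
    show "p (zs []) = 1"
      by (simp add: p_def zigzag_size_zs)
    fix u n assume u: "u \<in> perms n"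
    let ?I = "set (insertions (Suc n) u)"
    have I: "w \<in> perms (Suc n)" if "w \<in> ?I" for w
      using that perms_Suc_iff[OF u] by blast
    have "(\<Sum>w\<in>?I. p (zs w)) = (\<Sum>w\<in>?I. prob (?E (Suc n) w))"
      by (rule sum.cong[OF refl], rule p_zs[OF I]) auto
    also have "\<dots> = prob (\<Union>w\<in>?I. ?E (Suc n) w)"
      by (rule finite_measure_finite_Union[symmetric])
        (use distr_event(1)[OF X _ I] in \<open>auto simp: disjoint_family_on_def\<close>)
    also have "\<dots> = p (zs u)"
    proof (cases "n = 0")
      case True
      then have "u = []"
        using u by simp
      have "X \<omega> (Suc 0) = [Suc 0]" if "\<omega> \<in> space M" for \<omega>
        using arrangement_in_perms[OF X_arr[OF that], of 1] by simp
      then have "(\<Union>w\<in>?I. ?E (Suc n) w) = space M"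
        using \<open>u = []\<close> True by auto
      then show ?thesis
        using \<open>u = []\<close> by (simp add: prob_space p_def zigzag_size_zs)
    next
      case False
      \<comment> \<open>Deleting the largest letter of level n + 1 yields level n, so the insertions
        into \<open>u\<close> partition the event that level n shows \<open>u\<close>.\<close>
      have "X \<omega> (Suc n) \<in> ?I \<longleftrightarrow> X \<omega> n = u" if \<omega>: "\<omega> \<in> space M" for \<omega>
      proof -
        have fl: "X \<omega> n = filter (\<lambda>i. i \<in> {1..n}) (X \<omega> (Suc n))"
          by (rule arrangements_filter[OF X_arr[OF \<omega>]]) (use False in auto)
        have w: "X \<omega> (Suc n) \<in> perms (Suc n)"
          using X_arr[OF \<omega>] by (auto simp: arrangements_def PiE_iff)
        then have "coherent u (X \<omega> (Suc n)) \<longleftrightarrow> filter (\<lambda>i. i \<in> set u) (X \<omega> (Suc n)) = u"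
          using u by (intro coherent_iff_filter) (auto simp: permutations_of_set_def)
        moreover have "set u = {1..n}"
          using u by (simp add: permutations_of_set_def)
        ultimately show ?thesis
          unfolding perms_Suc_iff[OF u] using w fl by simp
      qed
      then have "(\<Union>w\<in>?I. ?E (Suc n) w) = ?E n u"
        by blast
      then show ?thesis
        using p_zs[OF u] False by simp
    qed
    finally show "p (zs u) = (\<Sum>w\<in>?I. p (zs w))" ..
  qed
  then obtain \<nu> where \<nu>: "prob_space \<nu>" "sets \<nu> = sets borel" and rep: "\<And>\<mu>. p \<mu> = (LINT P|\<nu>. paintbox_function P \<mu>)"
    using harmonic_mixture by blast
  have "distr M arrangement_space X = paintbox_law \<nu>"
  proof (rule arrangement_measure_eqI)
    show "sets (distr M arrangement_space X) = sets arrangement_space" "sets (paintbox_law \<nu>) = sets arrangement_space"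
      by (simp_all add: paintbox_law_def)
    interpret D: prob_space "distr M arrangement_space X"
      by (rule prob_space_distr[OF X])
    show "emeasure (distr M arrangement_space X) arrangements \<noteq> \<infinity>"
      by (simp add: D.emeasure_eq_measure)
    fix n w assume n: "1 \<le> n" "w \<in> perms n"
    show "emeasure (distr M arrangement_space X) {\<pi> \<in> arrangements. \<pi> n = w} =
        emeasure (paintbox_law \<nu>) {\<pi> \<in> arrangements. \<pi> n = w}"
      unfolding distr_event(2)[OF X n] paintbox_law_event[OF \<nu> n] rep[symmetric] p_zs[OF n(2,1)]
      by (rule emeasure_eq_measure)
  qed
  then show ?thesis
    using \<nu> by blast
qed

theorem paintbox_law_inject:
  assumes \<nu>: "prob_space \<nu>" "sets \<nu> = sets borel" and \<nu>': "prob_space \<nu>'" "sets \<nu>' = sets borel"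
    and eq: "paintbox_law \<nu> = paintbox_law \<nu>'"
  shows "\<nu> = \<nu>'"
proof (rule paintbox_measure_eqI[OF \<nu>(1) \<nu>'(1) \<nu>(2) \<nu>'(2)])
  fix \<mu>
  interpret \<nu>: prob_space \<nu> by fact
  interpret \<nu>': prob_space \<nu>' by fact
  obtain w where w: "w \<in> perms (zigzag_size \<mu>)" "zs w = \<mu>"
    using exists_perm_zs by blast
  show "(LINT P|\<nu>. paintbox_function P \<mu>) = (LINT P|\<nu>'. paintbox_function P \<mu>)"
  \<comment> \<open>The empty shape is invisible in an arrangement; there both integrals are
    1.\<close>
  proof (cases "zigzag_size \<mu> = 0")
    case True
    then have "\<mu> = zs []"
      using w by simp
    then show ?thesis
      by (simp add: harmonicD(2)[OF paintbox_function_harmonic] \<nu>.prob_space \<nu>'.prob_space)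
  next
    case False
    have nonneg: "0 \<le> (LINT P|\<kappa>. paintbox_function P \<mu>)" for \<kappa>
      by (rule integral_nonneg_AE) (simp add: paintbox_function_range)
    have "ennreal (LINT P|\<nu>. paintbox_function P (zs w)) = ennreal (LINT P|\<nu>'. paintbox_function P (zs w))"
      using paintbox_law_event[OF \<nu> _ w(1)] paintbox_law_event[OF \<nu>' _ w(1)] False unfolding eq by simp
    then show ?thesis
      using nonneg w(2) by simp
  qed
qed

theorem theorem43:
  shows "zigzag_boundary homeomorphic (UNIV :: paintbox set) \<and>
    (\<forall>(M :: 'a measure) X.
       prob_space M \<and> X \<in> M \<rightarrow>\<^sub>M arrangement_space \<and> descent_sufficient M X \<longrightarrow>
       (\<exists>\<nu>. prob_space \<nu> \<and> sets \<nu> = sets borel \<and>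
          distr M arrangement_space X = paintbox_law \<nu>)) \<and>
    (\<forall>(M :: 'a measure) X \<nu> \<nu>'.
       prob_space M \<and> X \<in> M \<rightarrow>\<^sub>M arrangement_space \<and> descent_sufficient M X \<and>
       prob_space \<nu> \<and> sets \<nu> = sets borel \<and> distr M arrangement_space X = paintbox_law \<nu> \<and>
       prob_space \<nu>' \<and> sets \<nu>' = sets borel \<and> distr M arrangement_space X = paintbox_law \<nu>' \<longrightarrow>
       \<nu> = \<nu>')"
proof (intro conjI allI impI)
  show "zigzag_boundary homeomorphic (UNIV :: paintbox set)"
    by (rule zigzag_boundary_homeomorphic)
qed (use descent_sufficient_paintbox paintbox_law_inject in metis)+

end
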